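(* Let $n\ge 1$ be an integer, $\theta\in[0,\tfrac12)$, $\gamma\in(0,1)$, $p>1$, and set $q=n+2\theta$. Define $$p_c=p_c(n,\gamma,\theta):=1+\frac{2\left(1+(1-\gamma)(1-\theta)\right)}{\left(n-2+2\gamma(1-\theta)\right)_+},$$ where $(a)_+=\max\{a,0\}$ and $p_c:=+\infty$ if the denominator is $0$, and $$\overline p=\begin{cases}\gamma^{-1}, & \text{if } \gamma\in\left(0,\frac{n-2}{n}\right],\\[2pt] p_c, & \text{if } \gamma\in\left(\frac{n-2}{n},1\right).\end{cases}$$ Assume that $u_0,u_1\in L^1(\mathbb{R}^n,\langle x\rangle^{q}\,dx)$ and that $$\int_{\mathbb{R}^n}u_1(x)\,dx>0 .$$ If there exists a (nontrivial) global in-time weak solution $$u\in L^p\left([0,\infty),L^p(\mathbb{R}^n,\langle x\rangle^{-q}\,dx)\right)$$ to the Cauchy problem $$\begin{cases} u_{tt}-\Delta u_{tt}+\Delta^2u-\Delta u+(-\Delta)^\theta u_t=\displaystyle\int_0^t(t-s)^{-\gamma}|u(s,x)|^p\,ds, & t\ge 0,\ x\in\mathbb{R}^n,\\ (u,u_t)(0,x)=(u_0,u_1)(x),\end{cases}$$ then $p\ge\overline p$. Furthermore, in the case $\gamma\in\left(\frac{n-2}{n},1\right)$ the inequality is strict, that is, $p>\overline p=p_c$. (In particular, if $p_c=+\infty$, no such solution exists for any $p>1$.)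
   Context: Notation: $\langle x\rangle=(1+|x|^2)^{1/2}$; $(-\Delta)^\sigma f=\mathcal F^{-1}(|\xi|^{2\sigma}\hat f)$ for $\sigma>0$, where $\hat f=\mathcal F f$ is the Fourier transform, and $(-\Delta)^0$ is the identity. Test function space: with $q=n+2\theta$, $\mathcal C^\infty_q(\mathbb{R}^n)$ is the space of infinitely differentiable functions $\varphi$ on $\mathbb{R}^n$ such that $\langle x\rangle^q\varphi$ is bounded and such that $\langle x\rangle^q(-\Delta)^\sigma\varphi$ is bounded for every $\sigma>0$ that is an integer or satisfies $\sigma-\lfloor\sigma\rfloor\in[\theta,1)$. Weak solution: write $F(t,u)(x)=\int_0^t(t-s)^{-\gamma}|u(s,x)|^p\,ds$. For $0<T<\infty$, $u$ is a weak solution on $[0,T)$ if for every $\psi\in\mathcal C^2([0,T])$ with $\psi(0)=1$, $\psi(T)=\psi_t(T)=0$, and every $\varphi\in\mathcal C^\infty_q(\mathbb{R}^n)$, all the integrals below converge absolutely and $$\begin{aligned}\int_0^T\psi(t)\int_{\mathbb{R}^n}F(t,u)\varphi\,dx\,dt={}&\int_0^T\psi(t)\int_{\mathbb{R}^n}u(t,x)(-\Delta\varphi)(x)\,dx\,dt+\int_0^T\psi(t)\int_{\mathbb{R}^n}u(t,x)(\Delta^2\varphi)(x)\,dx\,dt\\&-\int_0^T\psi_t(t)\int_{\mathbb{R}^n}u(t,x)((-\Delta)^\theta\varphi)(x)\,dx\,dt+\int_0^T\psi_{tt}(t)\int_{\mathbb{R}^n}u(t,x)\varphi(x)\,dx\,dt\\&+\int_0^T\psi_{tt}(t)\int_{\mathbb{R}^n}u(t,x)(-\Delta\varphi)(x)\,dx\,dt-\int_{\mathbb{R}^n}u_0\,(-\Delta)^\theta\varphi\,dx\\&-\int_{\mathbb{R}^n}u_1\varphi\,dx-\int_{\mathbb{R}^n}u_1(-\Delta\varphi)\,dx+\psi_t(0)\left(\int_{\mathbb{R}^n}u_0\varphi\,dx+\int_{\mathbb{R}^n}u_0(-\Delta\varphi)\,dx\right).\end{aligned}$$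 A global in-time weak solution is a function $u$ on $[0,\infty)\times\mathbb{R}^n$ whose restriction to $[0,T)\times\mathbb{R}^n$ is a weak solution on $[0,T)$ for every $T>0$. *)

theory Defs
  imports "HOL-Analysis.Analysis"
begin

section \<open>Weights\<close>

definition japanese_bracket :: "'a::euclidean_space \<Rightarrow> real" where
  "japanese_bracket x = sqrt (1 + (norm x)\<^sup>2)"

definition weighted_lborel :: "real \<Rightarrow> 'a::euclidean_space measure" where
  "weighted_lborel a = density lborel (\<lambda>x. ennreal (japanese_bracket x powr a))"

section \<open>Smooth functions and the Laplacian\<close>

definition partial_deriv :: "'a::euclidean_space \<Rightarrow> ('a \<Rightarrow> real) \<Rightarrow> 'a \<Rightarrow> real" where
  "partial_deriv b f x = frechet_derivative f (at x) b"

primrec C_k :: "nat \<Rightarrow> ('a::euclidean_space \<Rightarrow> real) \<Rightarrow> bool" where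
  "C_k 0 f \<longleftrightarrow> continuous_on UNIV f"
| "C_k (Suc k) f \<longleftrightarrow> f differentiable_on UNIV \<and> (\<forall>b\<in>Basis. C_k k (partial_deriv b f))"

definition smooth :: "('a::euclidean_space \<Rightarrow> real) \<Rightarrow> bool" where
  "smooth f \<longleftrightarrow> (\<forall>k. C_k k f)"

definition laplacian :: "('a::euclidean_space \<Rightarrow> real) \<Rightarrow> 'a \<Rightarrow> real" where
  "laplacian f x = (\<Sum>b\<in>Basis. partial_deriv b (partial_deriv b f) x)"

section \<open>Fourier transform and fractional Laplacian\<close>

text \<open>The normalisation of the Fourier transform is \<open>\<integral> exp (-i \<xi> \<bullet> x) f x dx\<close>; a constant
  factor in front would not affect the fractional Laplacian below.\<close>

definition fourier_L1 :: "('a::euclidean_space \<Rightarrow> complex) \<Rightarrow> 'a \<Rightarrow> complex" where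
  "fourier_L1 f \<xi> = (LINT x|lborel. cis (- (\<xi> \<bullet> x)) * f x)"

definition square_integrable :: "('a::euclidean_space \<Rightarrow> complex) \<Rightarrow> bool" where
  "square_integrable f \<longleftrightarrow>
     f \<in> borel_measurable lborel \<and> (\<integral>\<^sup>+ x. ennreal ((norm (f x))\<^sup>2) \<partial>lborel) < \<infinity>"

definition tendsto_L2 :: "(nat \<Rightarrow> 'a::euclidean_space \<Rightarrow> complex) \<Rightarrow> ('a \<Rightarrow> complex) \<Rightarrow> bool" where
  "tendsto_L2 F f \<longleftrightarrow>
     (\<lambda>k. \<integral>\<^sup>+ x. ennreal ((norm (F k x - f x))\<^sup>2) \<partial>lborel) \<longlonglongrightarrow> 0"

text \<open>The (Plancherel) Fourier transform on \<open>L\<^sup>2\<close>: the continuous extension of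
  \<^const>\<open>fourier_L1\<close> from the dense subspace \<open>L\<^sup>1 \<inter> L\<^sup>2\<close>, as a relation, since transforms are
  determined only up to null sets. The extension is needed because functions bounded by
  \<open>\<langle>x\<rangle> powr (-q)\<close> are in \<open>L\<^sup>2\<close>, but for \<open>\<theta> = 0\<close>, \<open>q = n\<close> not necessarily in \<open>L\<^sup>1\<close>.\<close>

definition has_fourier :: "('a::euclidean_space \<Rightarrow> complex) \<Rightarrow> ('a \<Rightarrow> complex) \<Rightarrow> bool" where
  "has_fourier f h \<longleftrightarrow> square_integrable f \<and> square_integrable h \<and>
     (\<exists>F. (\<forall>k. integrable lborel (F k) \<and> square_integrable (F k)) \<and>
          tendsto_L2 F f \<and> tendsto_L2 (\<lambda>k. fourier_L1 (F k)) h)"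

text \<open>\<open>has_frac_laplacian \<sigma> f g\<close> says that \<open>g\<close> is (a version of) \<open>(-\<Delta>)\<^sup>\<sigma> f\<close>: the inverse
  Fourier transform of \<open>|\<xi>| powr (2 \<sigma>)\<close> times the Fourier transform of \<open>f\<close>. For \<open>\<sigma> > 0\<close> such a
  \<open>g\<close> is unique up to null sets.\<close>

definition has_frac_laplacian ::
    "real \<Rightarrow> ('a::euclidean_space \<Rightarrow> real) \<Rightarrow> ('a \<Rightarrow> real) \<Rightarrow> bool" where
  "has_frac_laplacian \<sigma> f g \<longleftrightarrow>
     (if \<sigma> = 0 then g = f
      else (\<exists>h. has_fourier (\<lambda>x. complex_of_real (f x)) h \<and>
                has_fourier (\<lambda>x. complex_of_real (g x))
                  (\<lambda>\<xi>. complex_of_real (norm \<xi> powr (2 * \<sigma>)) * h \<xi>)))"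

section \<open>Test functions\<close>

definition decay_exponent :: "'a::euclidean_space itself \<Rightarrow> real \<Rightarrow> real" where
  "decay_exponent _ \<theta> = real DIM('a) + 2 * \<theta>"

definition test_functions :: "real \<Rightarrow> ('a::euclidean_space \<Rightarrow> real) set" where
  "test_functions \<theta> = (let q = decay_exponent TYPE('a) \<theta> in
     {\<phi>. smooth \<phi> \<and> bounded (range (\<lambda>x. japanese_bracket x powr q * \<phi> x)) \<and>
         (\<forall>\<sigma>>0. \<sigma> \<in> \<int> \<or> \<sigma> - of_int \<lfloor>\<sigma>\<rfloor> \<in> {\<theta>..<1} \<longrightarrow>
            (\<exists>g. has_frac_laplacian \<sigma> \<phi> g \<and>
                 bounded (range (\<lambda>x. japanese_bracket x powr q * g x))))})"

text \<open>\<open>\<psi>\<close> is twice continuously differentiable on \<open>[0,T]\<close>, with one-sided derivatives at the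
  endpoints, and first and second derivatives \<open>\<psi>'\<close> and \<open>\<psi>''\<close>.\<close>

definition C2_on_interval ::
    "real \<Rightarrow> (real \<Rightarrow> real) \<Rightarrow> (real \<Rightarrow> real) \<Rightarrow> (real \<Rightarrow> real) \<Rightarrow> bool" where
  "C2_on_interval T \<psi> \<psi>' \<psi>'' \<longleftrightarrow>
     (\<forall>t\<in>{0..T}. (\<psi> has_real_derivative \<psi>' t) (at t within {0..T}) \<and>
                 (\<psi>' has_real_derivative \<psi>'' t) (at t within {0..T})) \<and>
     continuous_on {0..T} \<psi>''"

section \<open>Weak solutions\<close>

definition memory_term :: "real \<Rightarrow> real \<Rightarrow> (real \<Rightarrow> 'a \<Rightarrow> real) \<Rightarrow> real \<Rightarrow> 'a \<Rightarrow> real" where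
  "memory_term \<gamma> p u t x = (LINT s:{0..t}|lborel. (t - s) powr (- \<gamma>) * \<bar>u s x\<bar> powr p)"

definition memory_converges ::
    "real \<Rightarrow> real \<Rightarrow> real \<Rightarrow> (real \<Rightarrow> 'a::euclidean_space \<Rightarrow> real) \<Rightarrow> bool" where
  "memory_converges \<gamma> p T u \<longleftrightarrow>
     (AE t in lborel. t \<in> {0..T} \<longrightarrow> (AE x in lborel.
        set_integrable lborel {0..t} (\<lambda>s. (t - s) powr (- \<gamma>) * \<bar>u s x\<bar> powr p)))"

text \<open>The iterated integral \<open>\<integral>\<^sub>0\<^sup>T \<eta> t (\<integral> v t x * w x dx) dt\<close>. The Bochner integral of a
  non-integrable function is 0, so the absolute convergence of the inner and outer integrals
  is a separate predicate.\<close>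

definition space_time_integral ::
    "real \<Rightarrow> (real \<Rightarrow> real) \<Rightarrow> (real \<Rightarrow> 'a::euclidean_space \<Rightarrow> real) \<Rightarrow> ('a \<Rightarrow> real) \<Rightarrow> real" where
  "space_time_integral T \<eta> v w = (LINT t:{0..T}|lborel. \<eta> t * (LINT x|lborel. v t x * w x))"

definition space_time_converges ::
    "real \<Rightarrow> (real \<Rightarrow> real) \<Rightarrow> (real \<Rightarrow> 'a::euclidean_space \<Rightarrow> real) \<Rightarrow> ('a \<Rightarrow> real) \<Rightarrow> bool" where
  "space_time_converges T \<eta> v w \<longleftrightarrow>
     (AE t in lborel. t \<in> {0..T} \<longrightarrow> integrable lborel (\<lambda>x. v t x * w x)) \<and>
     set_integrable lborel {0..T} (\<lambda>t. \<eta> t * (LINT x|lborel. v t x * w x))"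

definition weak_solution_on ::
    "real \<Rightarrow> real \<Rightarrow> real \<Rightarrow> ('a::euclidean_space \<Rightarrow> real) \<Rightarrow> ('a \<Rightarrow> real) \<Rightarrow>
     real \<Rightarrow> (real \<Rightarrow> 'a \<Rightarrow> real) \<Rightarrow> bool" where
  "weak_solution_on \<theta> \<gamma> p u0 u1 T u \<longleftrightarrow>
     (\<forall>\<psi> \<psi>' \<psi>'' \<phi> \<phi>\<theta>.
        C2_on_interval T \<psi> \<psi>' \<psi>'' \<and> \<psi> 0 = 1 \<and> \<psi> T = 0 \<and> \<psi>' T = 0 \<and>
        \<phi> \<in> test_functions \<theta> \<and> has_frac_laplacian \<theta> \<phi> \<phi>\<theta> \<longrightarrow>
        memory_converges \<gamma> p T u \<and>
        space_time_converges T \<psi> (memory_term \<gamma> p u) \<phi> \<and>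
        space_time_converges T \<psi> u (\<lambda>x. - laplacian \<phi> x) \<and>
        space_time_converges T \<psi> u (laplacian (laplacian \<phi>)) \<and>
        space_time_converges T \<psi>' u \<phi>\<theta> \<and>
        space_time_converges T \<psi>'' u \<phi> \<and>
        space_time_converges T \<psi>'' u (\<lambda>x. - laplacian \<phi> x) \<and>
        integrable lborel (\<lambda>x. u0 x * \<phi>\<theta> x) \<and>
        integrable lborel (\<lambda>x. u1 x * \<phi> x) \<and>
        integrable lborel (\<lambda>x. u1 x * (- laplacian \<phi> x)) \<and>
        integrable lborel (\<lambda>x. u0 x * \<phi> x) \<and>
        integrable lborel (\<lambda>x. u0 x * (- laplacian \<phi> x)) \<and>
        space_time_integral T \<psi> (memory_term \<gamma> p u) \<phi> =
          space_time_integral T \<psi> u (\<lambda>x. - laplacian \<phi> x)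
        + space_time_integral T \<psi> u (laplacian (laplacian \<phi>))
        - space_time_integral T \<psi>' u \<phi>\<theta>
        + space_time_integral T \<psi>'' u \<phi>
        + space_time_integral T \<psi>'' u (\<lambda>x. - laplacian \<phi> x)
        - (LINT x|lborel. u0 x * \<phi>\<theta> x)
        - (LINT x|lborel. u1 x * \<phi> x)
        - (LINT x|lborel. u1 x * (- laplacian \<phi> x))
        + \<psi>' 0 * ((LINT x|lborel. u0 x * \<phi> x) + (LINT x|lborel. u0 x * (- laplacian \<phi> x))))"

definition global_weak_solution ::
    "real \<Rightarrow> real \<Rightarrow> real \<Rightarrow> ('a::euclidean_space \<Rightarrow> real) \<Rightarrow> ('a \<Rightarrow> real) \<Rightarrow>
     (real \<Rightarrow> 'a \<Rightarrow> real) \<Rightarrow> bool" where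
  "global_weak_solution \<theta> \<gamma> p u0 u1 u \<longleftrightarrow> (\<forall>T>0. weak_solution_on \<theta> \<gamma> p u0 u1 T u)"

text \<open>\<open>L\<^sup>p([0,\<infinity>), L\<^sup>p(\<langle>x\<rangle> powr (-q) dx))\<close>, identified as usual with an \<open>L\<^sup>p\<close> space for the
  product measure; values of \<open>u\<close> at negative times play no role.\<close>

definition Lp_Lp_weighted ::
    "real \<Rightarrow> real \<Rightarrow> (real \<Rightarrow> 'a::euclidean_space \<Rightarrow> real) set" where
  "Lp_Lp_weighted p q = (let M = restrict_space lborel {0..} \<Otimes>\<^sub>M weighted_lborel (- q) in
     {u. (\<lambda>(t, x). u t x) \<in> borel_measurable M \<and> integrable M (\<lambda>(t, x). \<bar>u t x\<bar> powr p)})"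

definition nontrivial_function :: "(real \<Rightarrow> 'a::euclidean_space \<Rightarrow> real) \<Rightarrow> bool" where
  "nontrivial_function u \<longleftrightarrow>
     \<not> (AE (t, x) in restrict_space lborel {0..} \<Otimes>\<^sub>M lborel. u t x = 0)"

section \<open>Critical exponents\<close>

definition p_crit :: "nat \<Rightarrow> real \<Rightarrow> real \<Rightarrow> ereal" where
  "p_crit n \<gamma> \<theta> = (let d = max (real n - 2 + 2 * \<gamma> * (1 - \<theta>)) 0 in
     if d = 0 then \<infinity> else ereal (1 + 2 * (1 + (1 - \<gamma>) * (1 - \<theta>)) / d))"

definition p_bar :: "nat \<Rightarrow> real \<Rightarrow> real \<Rightarrow> ereal" where
  "p_bar n \<gamma> \<theta> =
     (if \<gamma> \<le> (real n - 2) / real n then ereal (1 / \<gamma>) else p_crit n \<gamma> \<theta>)"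

end

theory Submission
  imports Defs "HOL-Probability.Characteristic_Functions"
begin

text \<open>Why the theorem holds. Write \<open>n\<close> for the dimension and \<open>p' = p / (p - 1)\<close>. The weak formulation is
  tested with \<open>\<psi> t * \<phi> x\<close>, where \<open>\<psi> t = (1 - (t/T)\<^sup>2) ^ N\<close> and \<open>\<phi>\<close> is a positive function spread over a
  ball of radius about \<open>sqrt \<mu>\<close>. Exchanging the order of integration moves the memory kernel on to
  \<open>\<psi>\<close>, and \<open>\<integral>\<^sub>s\<^sup>T (t - s) powr (-\<gamma>) * \<psi> t dt\<close> is at least a constant times
  \<open>T powr (1 - \<gamma>) * (1 - (s/T)\<^sup>2) ^ (N + 1)\<close>. So the left-hand side controls \<open>T powr (1 - \<gamma>)\<close> times
  the energy \<open>X\<close>, a weighted integral of \<open>\<bar>u\<bar> powr p * \<phi>\<close>. The right-hand side is linear in \<open>u\<close>, with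
  coefficients of size \<open>\<phi> / \<mu>\<close>, \<open>\<phi> / T\<^sup>2\<close> and, from the damping term, \<open>(t/T) * \<phi> * T powr (-1) * \<mu> powr (-\<theta>)\<close>.
  Young's inequality and a division by \<open>T powr (1 - \<gamma>)\<close> give
  \<open>c * X \<le> \<tau> * Y + A * (T powr (1 - (1 - \<gamma>) * p') * \<mu> powr (n/2) * ((1/\<mu> + 1/T\<^sup>2) powr p' +
  \<tau> powr (-1/(p-1)) * (T powr (-1) * \<mu> powr (-\<theta>)) powr p') + T powr (-(1 - \<gamma>)))\<close>
  for every \<open>\<tau> > 0\<close> (lemma \<open>scaled_energy_estimate\<close>). Here \<open>Y\<close> is the energy with the additional weight
  \<open>(t/T) powr p\<close>, and the last term is what remains of the initial data.

  Two ways of letting \<open>T\<close> tend to infinity show that \<open>u\<close> vanishes, against the assumption that it is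
  nontrivial. If \<open>p * \<gamma> < 1\<close>, take \<open>\<mu> = 1\<close>: the right-hand side tends to 0
  (\<open>energy_zero_below_inverse_gamma\<close>). If \<open>p\<close> is at most the critical exponent, use the parabolic scaling
  \<open>\<mu> = K * T powr (1/(1 - \<theta>))\<close>, for which the remaining power of \<open>T\<close> is nonpositive. Then \<open>X\<close> is bounded,
  hence \<open>\<bar>u\<bar> powr p\<close> is integrable over space-time, \<open>Y\<close> tends to 0 by dominated convergence, and what is
  left is a multiple of \<open>K powr (n/2 - p')\<close> if \<open>\<tau> = K powr p\<close>. This tends to 0 as \<open>K\<close> grows, because
  \<open>n/2 < p'\<close> when \<open>\<gamma> > (n - 2)/n\<close> (\<open>energy_zero_up_to_critical\<close>). Only the second step sees the equality
  case, which is why the inequality is strict for these \<open>\<gamma>\<close>.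

  The test function is \<open>\<phi> = (1 + \<bar>x\<bar>\<^sup>2/(4\<mu>)) powr (-(n/2 + \<beta>))\<close>. For \<open>\<theta> > 0\<close> the choice \<open>\<beta> = \<theta>\<close> gives it the
  tail \<open>\<bar>x\<bar> powr (-n - 2\<theta>)\<close>, which is the tail of \<open>(-\<Delta>)\<^sup>\<theta>\<close> of any nice function with nonzero
  integral; so \<open>\<bar>(-\<Delta>)\<^sup>\<theta> \<phi>\<bar> \<le> C * \<mu> powr (-\<theta>) * \<phi>\<close> is possible. To prove it, write \<open>\<phi>\<close> as a mixture
  \<open>\<integral> \<rho> b * k b x db\<close> of heat kernels, with density \<open>\<rho> b\<close> proportional to
  \<open>b powr (-1 - \<beta>) * exp (-\<mu>/b)\<close>. For \<open>m > \<sigma>\<close> and \<open>s = m - \<sigma>\<close>, the identity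
  \<open>\<bar>\<xi>\<bar> powr (2\<sigma>) = \<bar>\<xi>\<bar> ^ (2m) * (\<integral> \<tau> powr (s-1) * exp (-\<tau> * \<bar>\<xi>\<bar>\<^sup>2) d\<tau>) / Gamma s\<close> shows that
  \<open>(-\<Delta>)\<^sup>\<sigma> \<phi> = \<integral> (I\<^sup>s \<rho>) b * ((-\<Delta>)\<^sup>m k) b x db\<close>, where \<open>I\<^sup>s\<close> is the Riemann-Liouville integral of
  order \<open>s\<close>. Everything converges absolutely, so the Fourier transform reduces to that of Gaussians, and the
  decay follows from \<open>\<bar>(-\<Delta>)\<^sup>m k b x\<bar> \<le> C * b powr (-m - n/2) * exp (-\<bar>x\<bar>\<^sup>2/(8b))\<close> and a Gamma integral
  (\<open>frac_laplacian_bracket\<close>, \<open>test_function_family\<close>).\<close>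

section \<open>Gamma integrals\<close>

lemma nn_integral_gamma_exp:
  fixes s y :: real
  assumes s: "s > 0" and y: "y > 0"
  shows "(\<integral>\<^sup>+ t\<in>{0<..}. ennreal (t powr (s - 1) * exp (- (y * t))) \<partial>lborel)
    = ennreal (Gamma s * y powr (- s))"
proof -
  have "ennreal (Gamma s) = (\<integral>\<^sup>+ t. ennreal (indicator {0..} t * t powr (s - 1) / exp t) \<partial>lborel)"
    by (rule Gamma_conv_nn_integral_real[OF s])
  also have "\<dots> = ennreal \<bar>y\<bar> * (\<integral>\<^sup>+ t. ennreal
    (indicator {0..} (0 + y * t) * (0 + y * t) powr (s - 1) / exp (0 + y * t)) \<partial>lborel)"
    using y by (intro nn_integral_real_affine) auto
  also have "(\<integral>\<^sup>+ t. ennreal (indicator {0..} (0 + y * t)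
    * (0 + y * t) powr (s - 1) / exp (0 + y * t)) \<partial>lborel)
      = (\<integral>\<^sup>+ t. ennreal (y powr (s - 1)) * (ennreal (t powr (s - 1) * exp (- (y * t)))
        * indicator {0<..} t) \<partial>lborel)"
  proof (intro nn_integral_cong)
    fix t :: real
    show "ennreal (indicator {0..} (0 + y * t) * (0 + y * t) powr (s - 1) / exp (0 + y * t))
      = ennreal (y powr (s - 1)) * (ennreal (t powr (s - 1) * exp (- (y * t))) * indicator {0<..} t)"
      using y by (cases "t > 0"; cases "t = 0")
        (auto simp: powr_mult exp_minus field_simps indicator_def zero_le_mult_iff simp flip: ennreal_mult')
  qed
  also have "ennreal \<bar>y\<bar> * \<dots> = ennreal (y powr s) *
      (\<integral>\<^sup>+ t\<in>{0<..}. ennreal (t powr (s - 1) * exp (- (y * t))) \<partial>lborel)"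
    using y by (subst nn_integral_cmult) (auto simp flip: ennreal_mult' mult.assoc simp: powr_diff)
  finally have *: "ennreal (Gamma s) = ennreal (y powr s) *
      (\<integral>\<^sup>+ t\<in>{0<..}. ennreal (t powr (s - 1) * exp (- (y * t))) \<partial>lborel)" .
  have "ennreal (y powr (-s)) * ennreal (Gamma s) = (ennreal (y powr (-s)) * ennreal (y powr s)) *
      (\<integral>\<^sup>+ t\<in>{0<..}. ennreal (t powr (s - 1) * exp (- (y * t))) \<partial>lborel)"
    by (subst *) (simp add: mult.assoc)
  also have "ennreal (y powr (-s)) * ennreal (y powr s) = 1"
    using y by (simp flip: ennreal_mult' powr_add)
  finally have "(\<integral>\<^sup>+ t\<in>{0<..}. ennreal (t powr (s - 1) * exp (- (y * t))) \<partial>lborel)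
      = ennreal (y powr (-s)) * ennreal (Gamma s)"
    by simp
  then show ?thesis
    by (subst mult.commute[of "Gamma s"], subst ennreal_mult') auto
qed

text \<open>The substitution \<open>b \<mapsto> 1/b\<close> in the Gamma integral. In this form, with \<open>A\<close> a sum of \<open>\<bar>x\<bar>\<^sup>2\<close> and a
  constant, it turns mixtures of Gaussians into powers of \<open>1 + \<bar>x\<bar>\<^sup>2\<close>.\<close>

lemma nn_integral_inverse_gamma:
  fixes \<alpha> A :: real
  assumes \<alpha>: "\<alpha> > 0" and A: "A > 0"
  shows "(\<integral>\<^sup>+ b\<in>{0<..}. ennreal (b powr (- 1 - \<alpha>) * exp (- (A / b))) \<partial>lborel)
    = ennreal (Gamma \<alpha> * A powr (- \<alpha>))"
proof -
  define f where "f = (\<lambda>u::real. u powr (\<alpha> - 1) * exp (- (A * u)))"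
  define I where "I = Gamma \<alpha> * A powr (- \<alpha>)"
  have I0: "I \<ge> 0" using assms by (simp add: I_def Gamma_real_pos less_imp_le)
  have f_int: "((\<lambda>u. f u * indicator {0<..} u) has_integral I) UNIV"
  proof (rule nn_integral_has_integral)
    have "(\<integral>\<^sup>+ u. ennreal (f u * indicator {0<..} u) \<partial>lborel) = (\<integral>\<^sup>+ t\<in>{0<..}. ennreal (f t) \<partial>lborel)"
      by (intro nn_integral_cong) (auto simp: indicator_def)
    then show "(\<integral>\<^sup>+ u. ennreal (f u * indicator {0<..} u) \<partial>lborel) = ennreal I"
      using nn_integral_gamma_exp[OF \<alpha> A] by (simp add: f_def I_def)
  qed (auto simp: f_def I0)
  have f_int': "(f has_integral I) {0<..}"
  proof -
    have "(\<lambda>u. f u * indicator {0<..} u) = (\<lambda>u. if u \<in> {0<..} then f u else 0)" by auto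
    with f_int show ?thesis by (simp only: has_integral_restrict_UNIV)
  qed
  have f_abs: "f absolutely_integrable_on {0<..}"
    using f_int' by (intro nonnegative_absolutely_integrable_1) (auto simp: f_def integrable_on_def)
  have img: "(\<lambda>b::real. 1 / b) ` {0<..} = {0<..}"
  proof (intro equalityI subsetI)
    fix x :: real assume "x \<in> {0<..}"
    then show "x \<in> (\<lambda>b. 1 / b) ` {0<..}" by (intro image_eqI[of _ _ "1 / x"]) auto
  qed auto
  have "(\<lambda>b. \<bar>- 1 / b\<^sup>2\<bar> * f (1 / b)) absolutely_integrable_on {0<..} \<and>
        integral {0<..} (\<lambda>b. \<bar>- 1 / b\<^sup>2\<bar> * f (1 / b)) = I"
  proof (rule iffD2[OF has_absolute_integral_change_of_variables_1'[where g = "\<lambda>b. 1 / b"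
    and g' = "\<lambda>b. - 1 / b\<^sup>2"]])
    fix x :: real assume "x \<in> {0<..}"
    then show "((\<lambda>b. 1 / b) has_real_derivative (- 1 / x\<^sup>2)) (at x within {0<..})"
      by (auto intro!: derivative_eq_intros simp: power2_eq_square)
  next
    show "inj_on (\<lambda>b::real. 1 / b) {0<..}" by (auto simp: inj_on_def)
    show "f absolutely_integrable_on (\<lambda>b. 1 / b) ` {0<..} \<and> integral ((\<lambda>b. 1 / b) ` {0<..}) f = I"
      unfolding img using f_abs f_int' by (simp add: integral_unique)
  qed simp
  then have "((\<lambda>b. \<bar>- 1 / b\<^sup>2\<bar> * f (1 / b)) has_integral I) {0<..}"
    using absolutely_integrable_on_def has_integral_integrable_integral by blast
  then have "ennreal I = (\<integral>\<^sup>+ b. ennreal (indicator {0<..} b * (\<bar>- 1 / b\<^sup>2\<bar> * f (1 / b))) \<partial>lborel)"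
    by (intro nn_integral_has_integral_lebesgue[symmetric]) (auto simp: f_def)
  also have "\<dots> = (\<integral>\<^sup>+ b\<in>{0<..}. ennreal (b powr (- 1 - \<alpha>) * exp (- (A / b))) \<partial>lborel)"
  proof (intro nn_integral_cong)
    fix b :: real
    have *: "\<bar>- 1 / b\<^sup>2\<bar> * f (1 / b) = b powr (- 1 - \<alpha>) * exp (- (A / b))" if "b > 0"
    proof -
      have h1: "(1 / b) powr (\<alpha> - 1) = b powr (1 - \<alpha>)"
      proof -
        have "1 / b = b powr (-1)" using that by (simp add: powr_minus_divide)
        then show ?thesis unfolding \<open>1 / b = _\<close> powr_powr by simp
      qed
      have h2: "\<bar>- 1 / b\<^sup>2\<bar> = b powr (-2)"
        using that by (simp add: powr_minus powr_numeral divide_inverse)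
      have "\<bar>- 1 / b\<^sup>2\<bar> * f (1 / b) = (b powr (-2) * b powr (1 - \<alpha>)) * exp (- (A / b))"
        unfolding f_def h1 h2 by (simp only: mult.assoc times_divide_eq_right mult_1_right)
      then show ?thesis by (simp only: powr_add[symmetric]) simp
    qed
    show "ennreal (indicator {0<..} b * (\<bar>- 1 / b\<^sup>2\<bar> * f (1 / b))) =
       ennreal (b powr (- 1 - \<alpha>) * exp (- (A / b))) * indicator {0<..} b"
    proof (cases "b > 0")
      case True
      then show ?thesis by (simp only: *[OF True]) simp
    qed auto
  qed
  finally show ?thesis by (simp add: I_def)
qed

section \<open>The Fourier transform of the heat kernel\<close>

definition heat_kernel_1 :: "real \<Rightarrow> real \<Rightarrow> real" where
  "heat_kernel_1 b y = exp (- y\<^sup>2 / (4 * b)) / sqrt (4 * pi * b)"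

text \<open>A rescaling of the characteristic function of the standard normal distribution.\<close>

lemma integral_cis_heat_kernel_1:
  fixes b t :: real
  assumes b: "b > 0"
  shows "(LINT y|lborel. cis (t * y) * complex_of_real (heat_kernel_1 b y))
    = complex_of_real (exp (- (b * t\<^sup>2)))"
    and "integrable lborel (heat_kernel_1 b)"
proof -
  have 1: "(LINT y|lborel. std_normal_density y *\<^sub>R cis (u * y)) = complex_of_real (exp (- u\<^sup>2 / 2))" for u
  proof -
    have "char std_normal_distribution u = (LINT y|lborel. std_normal_density y *\<^sub>R cis (u * y))"
      unfolding char_def by (subst integral_density) (auto simp: cis_conv_exp)
    then show ?thesis using char_std_normal_distribution by (simp add: fun_eq_iff)
  qed
  define c where "c = sqrt (2 * b)"
  have c: "c > 0" "c\<^sup>2 = 2 * b" using b by (auto simp: c_def)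
  have hk: "heat_kernel_1 b (c * y) = std_normal_density y / c" for y
  proof -
    have "sqrt (4 * pi * b) = sqrt (2 * pi) * c"
      unfolding c_def by (simp flip: real_sqrt_mult)
    moreover have "(c * y)\<^sup>2 / (4 * b) = y\<^sup>2 / 2" using b c by (simp add: power_mult_distrib)
    ultimately show ?thesis
      by (simp add: heat_kernel_1_def normal_density_def)
  qed
  have "(LINT y|lborel. cis (t * y) * complex_of_real (heat_kernel_1 b y))
      = \<bar>c\<bar> *\<^sub>R (LINT y|lborel. cis (t * (0 + c * y)) * complex_of_real (heat_kernel_1 b (0 + c * y)))"
    using c by (intro lborel_integral_real_affine) auto
  also have "\<dots> = (LINT y|lborel. c *\<^sub>R (cis (t * (0 + c * y))
    * complex_of_real (heat_kernel_1 b (0 + c * y))))"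
    using c by simp
  also have "\<dots> = (LINT y|lborel. std_normal_density y *\<^sub>R cis ((t * c) * y))"
    using c by (intro Bochner_Integration.integral_cong)
      (simp_all add: hk scaleR_conv_of_real mult.assoc mult.commute[of t])
  also have "\<dots> = complex_of_real (exp (- (b * t\<^sup>2)))"
    using c by (simp only: 1 power_mult_distrib) simp
  finally show "(LINT y|lborel. cis (t * y) * complex_of_real (heat_kernel_1 b y))
    = complex_of_real (exp (- (b * t\<^sup>2)))" .
  have "integrable lborel (\<lambda>y. heat_kernel_1 b (0 + c * y))"
    unfolding add_0 hk by (intro integrable_divide) (auto intro: integrable_normal_density)
  then show "integrable lborel (heat_kernel_1 b)"
    using c by (subst (asm) lborel_integrable_real_affine_iff) auto
qed

definition heat_kernel :: "real \<Rightarrow> 'a::euclidean_space \<Rightarrow> real" where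
  "heat_kernel b x = (4 * pi * b) powr (- (real DIM('a) / 2)) * exp (- ((norm x)\<^sup>2 / (4 * b)))"

lemma heat_kernel_nonneg: "heat_kernel b x \<ge> 0"
  by (simp add: heat_kernel_def)

lemma heat_kernel_eq_prod:
  fixes x :: "'a::euclidean_space"
  assumes "b > 0"
  shows "heat_kernel b x = (\<Prod>e\<in>Basis. heat_kernel_1 b (x \<bullet> e))"
proof -
  have "(norm x)\<^sup>2 = (\<Sum>e\<in>Basis. (x \<bullet> e)\<^sup>2)"
    by (simp add: norm_eq_sqrt_inner euclidean_inner[of x x] power2_eq_square sum_nonneg)
  then have "exp (- ((norm x)\<^sup>2 / (4 * b))) = (\<Prod>e\<in>(Basis::'a set). exp (- (x \<bullet> e)\<^sup>2 / (4 * b)))"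
    by (simp add: exp_sum[symmetric] sum_divide_distrib sum_negf)
  moreover have "(4 * pi * b) powr (- (real DIM('a) / 2)) = (1 / sqrt (4 * pi * b)) ^ DIM('a)"
  proof -
    have "1 / sqrt (4 * pi * b) = (4 * pi * b) powr (- (1/2))"
      using assms by (subst powr_minus) (simp add: powr_half_sqrt inverse_eq_divide)
    moreover have "((4 * pi * b) powr (- (1/2))) ^ DIM('a)
      = ((4 * pi * b) powr (- (1/2))) powr (real DIM('a))"
      using assms by (intro powr_realpow[symmetric]) simp
    ultimately show ?thesis by (simp only: powr_powr) simp
  qed
  ultimately show ?thesis
    unfolding heat_kernel_def heat_kernel_1_def by (simp only: prod_dividef power_divide prod_constant) simp
qed

lemma cis_sum: "finite A \<Longrightarrow> cis (\<Sum>i\<in>A. f i) = (\<Prod>i\<in>A. cis (f i))"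
  by (induction A rule: finite_induct) (auto simp flip: cis_mult)

text \<open>Fubini for products of functions of single coordinates; it reduces the Gaussian Fourier integral
  to dimension one.\<close>

lemma lborel_integral_prod_Basis:
  fixes f :: "'a::euclidean_space \<Rightarrow> real \<Rightarrow> 'b::{real_normed_field, banach, second_countable_topology}"
  assumes f: "\<And>e. e \<in> Basis \<Longrightarrow> integrable lborel (f e)"
  shows "(LINT x|lborel. (\<Prod>e\<in>Basis. f e (x \<bullet> e))) = (\<Prod>e\<in>(Basis::'a set). LINT y|lborel. f e y)"
    and "integrable lborel (\<lambda>x. \<Prod>e\<in>(Basis::'a set). f e (x \<bullet> e))"
proof -
  interpret product_sigma_finite "\<lambda>_::'a. lborel :: real measure" by standard
  have [measurable]: "f e \<in> borel_measurable borel" if "e \<in> Basis" for e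
    using borel_measurable_integrable[OF f[OF that]] by simp
  have eq: "(lborel :: 'a measure) = distr (Pi\<^sub>M Basis (\<lambda>b. lborel)) borel (\<lambda>g. \<Sum>b\<in>Basis. g b *\<^sub>R b)"
    by (subst lborel_def) (simp only: lborel_eq_real)
  have comp: "(\<Prod>e\<in>Basis. f e ((\<Sum>b\<in>Basis. g b *\<^sub>R b) \<bullet> e)) = (\<Prod>e\<in>(Basis::'a set). f e (g e))"
    for g :: "'a \<Rightarrow> real"
    by (intro prod.cong refl) simp
  show "(LINT x|lborel. (\<Prod>e\<in>Basis. f e (x \<bullet> e))) = (\<Prod>e\<in>(Basis::'a set). LINT y|lborel. f e y)"
    by (subst eq, subst integral_distr) (auto simp: comp intro!: product_integral_prod f)
  show "integrable lborel (\<lambda>x. \<Prod>e\<in>(Basis::'a set). f e (x \<bullet> e))"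
    by (subst eq, subst integrable_distr_eq) (auto simp: comp intro!: product_integrable_prod f)
qed

lemma fourier_heat_kernel:
  fixes \<xi> :: "'a::euclidean_space"
  assumes b: "b > 0"
  shows "fourier_L1 (\<lambda>x. complex_of_real (heat_kernel b x)) \<xi> = complex_of_real (exp (- (b * (norm \<xi>)\<^sup>2)))"
    and "integrable lborel (heat_kernel b :: 'a \<Rightarrow> real)"
proof -
  have int1: "integrable lborel (\<lambda>y. cis (t * y) * complex_of_real (heat_kernel_1 b y))" for t
  proof (rule Bochner_Integration.integrable_bound[OF integral_cis_heat_kernel_1(2)[OF b]])
    show "(\<lambda>y. cis (t * y) * complex_of_real (heat_kernel_1 b y)) \<in> borel_measurable lborel"
      unfolding heat_kernel_1_def cis_conv_exp by measurable
  qed (auto simp: norm_mult)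
  have "cis (- (\<xi> \<bullet> x)) * complex_of_real (heat_kernel b x)
      = (\<Prod>e\<in>Basis. cis ((- (\<xi> \<bullet> e)) * (x \<bullet> e)) * complex_of_real (heat_kernel_1 b (x \<bullet> e)))" for x
    by (simp add: heat_kernel_eq_prod[OF b] prod.distrib cis_sum[symmetric] sum_negf
      euclidean_inner[of \<xi> x])
  then have "fourier_L1 (\<lambda>x. complex_of_real (heat_kernel b x)) \<xi>
     = (LINT x|lborel. (\<Prod>e\<in>Basis. cis ((- (\<xi> \<bullet> e)) * (x \<bullet> e)) * complex_of_real (heat_kernel_1 b (x \<bullet> e))))"
    by (simp add: fourier_L1_def)
  also have "\<dots> = (\<Prod>e\<in>(Basis::'a set). complex_of_real (exp (- (b * (\<xi> \<bullet> e)\<^sup>2))))"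
    by (subst lborel_integral_prod_Basis(1)[OF int1])
      (simp only: integral_cis_heat_kernel_1[OF b] power2_minus)
  also have "\<dots> = complex_of_real (exp (- (b * (norm \<xi>)\<^sup>2)))"
  proof -
    have "(norm \<xi>)\<^sup>2 = (\<Sum>e\<in>Basis. (\<xi> \<bullet> e)\<^sup>2)"
      by (simp add: norm_eq_sqrt_inner euclidean_inner[of \<xi> \<xi>] power2_eq_square sum_nonneg)
    then show ?thesis
      by (simp add: exp_sum sum_distrib_left sum_negf[symmetric] flip: of_real_prod)
  qed
  finally show "fourier_L1 (\<lambda>x. complex_of_real (heat_kernel b x)) \<xi>
    = complex_of_real (exp (- (b * (norm \<xi>)\<^sup>2)))" .
  show "integrable lborel (heat_kernel b :: 'a \<Rightarrow> real)"
    using lborel_integral_prod_Basis(2)[OF integral_cis_heat_kernel_1(2)[OF b]]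
    by (simp add: heat_kernel_eq_prod[OF b] cong: Bochner_Integration.integrable_cong)
qed

lemma nn_integral_heat_kernel:
  assumes b: "b > 0"
  shows "(\<integral>\<^sup>+ x. ennreal (heat_kernel b (x::'a::euclidean_space)) \<partial>lborel) = 1"
proof -
  have "complex_of_real (LINT x|lborel. heat_kernel b (x::'a)) = 1"
    using fourier_heat_kernel(1)[OF b, of "0::'a"] unfolding fourier_L1_def inner_zero_left by simp
  then have "(LINT x|lborel. heat_kernel b (x::'a)) = 1"
    by (simp only: of_real_eq_1_iff)
  moreover have "(\<integral>\<^sup>+ x. ennreal (heat_kernel b (x::'a)) \<partial>lborel)
    = ennreal (LINT x|lborel. heat_kernel b (x::'a))"
    by (intro nn_integral_eq_integral fourier_heat_kernel(2)[OF b]) (simp add: heat_kernel_nonneg)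
  ultimately show ?thesis by simp
qed

section \<open>Powers of the Laplacian of the heat kernel\<close>

text \<open>The polynomial factor of \<open>(-\<partial>/\<partial>b)\<^sup>m\<close> applied to \<open>b powr (-d) * exp (-r/b)\<close>, as a function of \<open>y = r/b\<close>:
  each derivative multiplies by \<open>d + m - y\<close> and adds \<open>y\<close> times the derivative (Laguerre polynomials up
  to normalisation).\<close>

primrec heat_poly :: "real \<Rightarrow> nat \<Rightarrow> real poly" where
  "heat_poly d 0 = 1"
| "heat_poly d (Suc m) = [:d + real m, -1:] * heat_poly d m + [:0, 1:] * pderiv (heat_poly d m)"

text \<open>The function \<open>(-\<Delta>)\<^sup>m\<close> of the heat kernel at time \<open>b\<close>. Since the kernel solves the heat equation, this
  is \<open>(-\<partial>/\<partial>b)\<^sup>m\<close> of the kernel, which is what the formula spells out.\<close>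

definition heat_kernel_lap :: "nat \<Rightarrow> real \<Rightarrow> 'a::euclidean_space \<Rightarrow> real" where
  "heat_kernel_lap m b x = (4 * pi) powr (- (real DIM('a) / 2)) * b powr (- (real DIM('a) / 2 + real m)) *
     exp (- ((norm x)\<^sup>2 / (4 * b))) * poly (heat_poly (real DIM('a) / 2) m) ((norm x)\<^sup>2 / (4 * b))"

lemma heat_kernel_lap_0: "b > 0 \<Longrightarrow> heat_kernel_lap 0 b x = heat_kernel b x"
  by (simp add: heat_kernel_lap_def heat_kernel_def powr_mult)

lemma borel_measurable_poly [measurable]:
  fixes p :: "real poly"
  assumes [measurable]: "f \<in> borel_measurable M"
  shows "(\<lambda>x. poly p (f x)) \<in> borel_measurable M"
  by (induction p) auto

lemma borel_measurable_heat_kernel_lap [measurable]: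
  assumes [measurable]: "f \<in> borel_measurable M" "g \<in> M \<rightarrow>\<^sub>M borel"
  shows "(\<lambda>w. heat_kernel_lap m (f w) (g w :: 'a::euclidean_space)) \<in> borel_measurable M"
  unfolding heat_kernel_lap_def by measurable

lemma DERIV_heat_kernel_lap:
  fixes x :: "'a::euclidean_space"
  assumes b: "b > 0"
  shows "((\<lambda>b. heat_kernel_lap m b x) has_real_derivative - heat_kernel_lap (Suc m) b x) (at b)"
proof -
  define a r p where "a = real DIM('a) / 2 + real m" and "r = (norm x)\<^sup>2 / 4"
    and "p = heat_poly (real DIM('a) / 2) m"
  have y: "(norm x)\<^sup>2 / (4 * c) = r / c" for c by (simp add: r_def)
  have 1: "((\<lambda>b. r / b) has_real_derivative - (r / b\<^sup>2)) (at b)"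
    using b by (auto intro!: derivative_eq_intros simp: power2_eq_square)
  have 2: "((\<lambda>b. b powr (- a)) has_real_derivative - a * b powr (- a - 1)) (at b)"
    using b by (auto intro!: derivative_eq_intros)
  have 3: "((\<lambda>b. poly p (r / b)) has_real_derivative poly (pderiv p) (r / b) * (- (r / b\<^sup>2))) (at b)"
    by (rule DERIV_chain2[OF poly_DERIV 1])
  have 4: "((\<lambda>b. exp (- (r / b))) has_real_derivative exp (- (r / b)) * (r / b\<^sup>2)) (at b)"
    using DERIV_chain2[OF DERIV_exp DERIV_minus[OF 1]] by simp
  have *: "((\<lambda>b. (4 * pi) powr (- (real DIM('a) / 2))
    * (b powr (- a) * (exp (- (r / b)) * poly p (r / b)))) has_real_derivative
      (4 * pi) powr (- (real DIM('a) / 2)) * ((- a * b powr (- a - 1))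
        * (exp (- (r / b)) * poly p (r / b)) +
       (exp (- (r / b)) * (r / b\<^sup>2) * poly p (r / b) + poly (pderiv p) (r / b) * (- (r / b\<^sup>2))
         * exp (- (r / b))) * b powr (- a))) (at b)"
    by (rule DERIV_cmult[OF DERIV_mult[OF 2 DERIV_mult[OF 4 3]]])
  have split: "b powr (- a) = b * b powr (- a - 1)"
    using b by (simp add: powr_diff)
  have P: "poly (heat_poly (real DIM('a) / 2) (Suc m)) (r / b) = (a - r / b) * poly p (r / b)
    + (r / b) * poly (pderiv p) (r / b)"
    by (simp add: p_def a_def algebra_simps)
  have e: "- (real DIM('a) / 2 + real (Suc m)) = - a - 1" by (simp add: a_def)
  have "(- a * b powr (- a - 1)) * (exp (- (r / b)) * poly p (r / b)) +
       (exp (- (r / b)) * (r / b\<^sup>2) * poly p (r / b) + poly (pderiv p) (r / b) * (- (r / b\<^sup>2))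
         * exp (- (r / b))) * b powr (- a)
      = - (b powr (- a - 1) * exp (- (r / b)) * ((a - r / b) * poly p (r / b) + (r / b)
        * poly (pderiv p) (r / b)))"
  proof -
    define v w where "v = exp (- (r / b))" and "w = b powr (- a - 1)"
    have q: "r / b\<^sup>2 = (r / b) / b" by (simp add: power2_eq_square)
    show ?thesis unfolding split v_def[symmetric] w_def[symmetric] q using b by (simp add: field_simps)
  qed
  then have "(4 * pi) powr (- (real DIM('a) / 2))
    * ((- a * b powr (- a - 1)) * (exp (- (r / b)) * poly p (r / b)) +
       (exp (- (r / b)) * (r / b\<^sup>2) * poly p (r / b) + poly (pderiv p) (r / b) * (- (r / b\<^sup>2))
         * exp (- (r / b))) * b powr (- a))
     = - heat_kernel_lap (Suc m) b x"
    unfolding heat_kernel_lap_def y P e by simp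
  moreover have "(\<lambda>b. heat_kernel_lap m b x)
    = (\<lambda>b. (4 * pi) powr (- (real DIM('a) / 2)) * (b powr (- a) * (exp (- (r / b)) * poly p (r / b))))"
    by (simp add: heat_kernel_lap_def y a_def p_def fun_eq_iff mult.assoc)
  ultimately show ?thesis using * by simp
qed

lemma poly_le_exp:
  fixes p :: "real poly" and \<epsilon> :: real
  assumes "\<epsilon> > 0"
  shows "\<exists>C\<ge>0. \<forall>y\<ge>0. \<bar>poly p y\<bar> \<le> C * exp (\<epsilon> * y)"
  using assms
proof (induction p arbitrary: \<epsilon>)
  case 0
  show ?case by (intro exI[of _ 0]) simp
next
  case (pCons a p)
  from pCons.IH[of "\<epsilon> / 2"] pCons.prems obtain C where C: "C \<ge> 0" "\<And>y. y \<ge> 0 \<Longrightarrow> \<bar>poly p y\<bar> \<le> C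
    * exp (\<epsilon> / 2 * y)"
    by auto
  show ?case
  proof (intro exI[of _ "\<bar>a\<bar> + 2 / \<epsilon> * C"] conjI allI impI)
    show "\<bar>a\<bar> + 2 / \<epsilon> * C \<ge> 0" using C pCons.prems by simp
    fix y :: real assume y: "y \<ge> 0"
    have "\<epsilon> / 2 * y \<le> exp (\<epsilon> / 2 * y)" using exp_ge_add_one_self[of "\<epsilon> / 2 * y"] by linarith
    then have y2: "y \<le> 2 / \<epsilon> * exp (\<epsilon> / 2 * y)" using pCons.prems by (simp add: field_simps)
    have "\<bar>poly (pCons a p) y\<bar> \<le> \<bar>a\<bar> + y * \<bar>poly p y\<bar>"
      using y by (simp add: abs_mult order.trans[OF abs_triangle_ineq])
    also have "\<dots> \<le> \<bar>a\<bar> * exp (\<epsilon> * y) + (2 / \<epsilon> * exp (\<epsilon> / 2 * y)) * (C * exp (\<epsilon> / 2 * y))"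
      using y y2 C pCons.prems by (intro add_mono mult_mono) (auto simp: mult_le_cancel_left1)
    also have "(2 / \<epsilon> * exp (\<epsilon> / 2 * y)) * (C * exp (\<epsilon> / 2 * y)) = 2 / \<epsilon> * C
      * (exp (\<epsilon> / 2 * y) * exp (\<epsilon> / 2 * y))"
      by (simp add: mult_ac)
    also have "exp (\<epsilon> / 2 * y) * exp (\<epsilon> / 2 * y) = exp (\<epsilon> * y)"
      by (simp flip: exp_add)
    finally show "\<bar>poly (pCons a p) y\<bar> \<le> (\<bar>a\<bar> + 2 / \<epsilon> * C) * exp (\<epsilon> * y)"
      by (simp add: algebra_simps)
  qed
qed

text \<open>Half of the Gaussian exponent pays for the polynomial.\<close>

lemma heat_kernel_lap_bound:
  "\<exists>C\<ge>0. \<forall>b>0. \<forall>x::'a::euclidean_space.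
      \<bar>heat_kernel_lap m b x\<bar> \<le> C * b powr (- (real DIM('a) / 2 + real m)) * exp (- ((norm x)\<^sup>2 / (8 * b)))"
proof -
  define d where "d = real DIM('a) / 2"
  obtain C where C: "C \<ge> 0" "\<And>y. y \<ge> 0 \<Longrightarrow> \<bar>poly (heat_poly d m) y\<bar> \<le> C * exp (1/2 * y)"
    using poly_le_exp[of "1/2" "heat_poly d m"] by auto
  show ?thesis
  proof (intro exI[of _ "(4 * pi) powr (- d) * C"] conjI allI impI)
    fix b :: real and x :: 'a assume b: "b > 0"
    define y where "y = (norm x)\<^sup>2 / (4 * b)"
    have "\<bar>heat_kernel_lap m b x\<bar> = (4 * pi) powr (- d) * b powr (- (d + real m))
      * (exp (- y) * \<bar>poly (heat_poly d m) y\<bar>)"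
      by (simp add: heat_kernel_lap_def abs_mult d_def y_def)
    also have "\<dots> \<le> (4 * pi) powr (- d) * b powr (- (d + real m)) * (exp (- y) * (C * exp (1/2 * y)))"
      using b C(2)[of y] by (intro mult_left_mono) (auto simp: y_def)
    also have "exp (- y) * (C * exp (1/2 * y)) = C * exp (- y + 1/2 * y)" by (simp only: exp_add mult_ac)
    also have "- y + 1/2 * y = - ((norm x)\<^sup>2 / (8 * b))" by (simp add: y_def)
    finally show "\<bar>heat_kernel_lap m b x\<bar> \<le> (4 * pi) powr (- d) * C
      * b powr (- (real DIM('a) / 2 + real m)) * exp (- ((norm x)\<^sup>2 / (8 * b)))"
      by (simp add: d_def mult_ac)
  qed (use C in auto)
qed

lemma nn_integral_gaussian:
  assumes c: "c > 0"
  shows "(\<integral>\<^sup>+ x. ennreal (exp (- ((norm (x::'a::euclidean_space))\<^sup>2 / c))) \<partial>lborel)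
    = ennreal ((pi * c) powr (real DIM('a) / 2))"
proof -
  define b where "b = c / 4"
  have b: "b > 0" using c by (simp add: b_def)
  have eq: "exp (- ((norm (x::'a))\<^sup>2 / c)) = (pi * c) powr (real DIM('a) / 2) * heat_kernel b x" for x
    using c by (simp add: heat_kernel_def b_def powr_minus_divide)
  show ?thesis unfolding eq
    using b by (subst ennreal_mult') (simp_all add: nn_integral_cmult heat_kernel_def[abs_def]
      nn_integral_heat_kernel[unfolded heat_kernel_def])
qed

lemma integrable_gaussian:
  assumes c: "c > 0"
  shows "integrable lborel (\<lambda>x::'a::euclidean_space. exp (- ((norm x)\<^sup>2 / c)))"
  using nn_integral_gaussian[OF c, where 'a='a] by (intro integrableI_bounded) auto

lemma integrable_heat_kernel_lap:
  assumes b: "b > 0"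
  shows "integrable lborel (heat_kernel_lap m b :: 'a::euclidean_space \<Rightarrow> real)"
proof -
  obtain C where C: "C \<ge> 0" "\<And>b (x::'a). b > 0 \<Longrightarrow>
      \<bar>heat_kernel_lap m b x\<bar> \<le> C * b powr (- (real DIM('a) / 2 + real m)) * exp (- ((norm x)\<^sup>2 / (8 * b)))"
    using heat_kernel_lap_bound[where 'a='a and m=m] by blast
  show ?thesis
  proof (rule Bochner_Integration.integrable_bound)
    show "integrable lborel (\<lambda>x::'a. C * b powr (- (real DIM('a) / 2 + real m))
      * exp (- ((norm x)\<^sup>2 / (8 * b))))"
      using b by (intro integrable_mult_right integrable_gaussian) auto
    show "AE x::'a in lborel. norm (heat_kernel_lap m b x)
      \<le> norm (C * b powr (- (real DIM('a) / 2 + real m)) * exp (- ((norm x)\<^sup>2 / (8 * b))))"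
      using C(2)[OF b] C(1) by (intro AE_I2) (simp add: abs_mult)
  qed simp
qed

text \<open>Induction on \<open>m\<close>: both sides are differentiated in \<open>b\<close>. Under the integral this is dominated
  convergence for difference quotients, with a wider Gaussian as majorant.\<close>

lemma fourier_heat_kernel_lap:
  fixes \<xi> :: "'a::euclidean_space"
  assumes b: "b > 0"
  shows "fourier_L1 (\<lambda>x. complex_of_real (heat_kernel_lap m b x)) \<xi> =
    complex_of_real ((norm \<xi>) ^ (2 * m) * exp (- (b * (norm \<xi>)\<^sup>2)))"
  using b
proof (induction m arbitrary: b)
  case 0
  then show ?case using fourier_heat_kernel(1)[of b \<xi>] by (simp add: heat_kernel_lap_0)
next
  case (Suc m)
  note b = \<open>b > 0\<close>
  define y where "y = (norm \<xi>)\<^sup>2"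
  define h where "h = (\<lambda>k::nat. b / real (Suc k))"
  have h: "h k > 0" "h k \<le> b" for k using b by (auto simp: h_def field_simps)
  have h0: "filterlim h (at 0) sequentially"
  proof -
    have "h \<longlonglongrightarrow> 0" unfolding h_def by (rule LIMSEQ_Suc[OF lim_const_over_n])
    then show ?thesis using h(1) by (auto simp: filterlim_at less_imp_neq[symmetric] intro!:
      always_eventually)
  qed
  obtain C where C: "C \<ge> 0" "\<And>b (x::'a). b > 0 \<Longrightarrow>
      \<bar>heat_kernel_lap (Suc m) b x\<bar> \<le> C * b powr (- (real DIM('a) / 2 + real (Suc m)))
        * exp (- ((norm x)\<^sup>2 / (8 * b)))"
    using heat_kernel_lap_bound[where 'a='a and m="Suc m"] by blast
  define s where "s = (\<lambda>k (x::'a). cis (- (\<xi> \<bullet> x))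
    * complex_of_real ((heat_kernel_lap m (b + h k) x - heat_kernel_lap m b x) / h k))"
  define w where "w = (\<lambda>x::'a. C * b powr (- (real DIM('a) / 2 + real (Suc m)))
    * exp (- ((norm x)\<^sup>2 / (16 * b))))"
  have "(\<lambda>k. integral\<^sup>L lborel (s k)) \<longlonglongrightarrow> (LINT x|lborel. cis (- (\<xi> \<bullet> x))
    * complex_of_real (- heat_kernel_lap (Suc m) b x))"
  proof (rule integral_dominated_convergence)
    show "integrable lborel w"
      unfolding w_def using b by (intro integrable_mult_right integrable_gaussian) auto
    show "AE x in lborel. (\<lambda>k. s k x) \<longlonglongrightarrow> cis (- (\<xi> \<bullet> x)) * complex_of_real (- heat_kernel_lap (Suc m) b x)"
    proof (rule AE_I2)
      fix x :: 'a
      have "(\<lambda>h. (heat_kernel_lap m (b + h) x - heat_kernel_lap m b x) / h) \<midarrow>0\<rightarrow>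
        - heat_kernel_lap (Suc m) b x"
        using DERIV_heat_kernel_lap[OF b, of m x] by (simp add: DERIV_def)
      from filterlim_compose[OF this h0]
      show "(\<lambda>k. s k x) \<longlonglongrightarrow> cis (- (\<xi> \<bullet> x)) * complex_of_real (- heat_kernel_lap (Suc m) b x)"
        unfolding s_def by (intro tendsto_intros)
    qed
    show "AE x in lborel. norm (s k x) \<le> w x" for k
    proof (rule AE_I2)
      fix x :: 'a
      have "\<exists>z>b. z < b + h k \<and> heat_kernel_lap m (b + h k) x - heat_kernel_lap m b x
        = (b + h k - b) * (- heat_kernel_lap (Suc m) z x)"
        using h(1)[of k] b by (intro MVT2 DERIV_heat_kernel_lap) auto
      then obtain z where z: "z > b" "z < b + h k"
        "heat_kernel_lap m (b + h k) x - heat_kernel_lap m b x = (b + h k - b)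
          * (- heat_kernel_lap (Suc m) z x)"
        by blast
      then have "norm (s k x) = \<bar>heat_kernel_lap (Suc m) z x\<bar>"
        using h(1)[of k] unfolding s_def z(3) by (simp add: norm_mult)
      also have "\<dots> \<le> C * z powr (- (real DIM('a) / 2 + real (Suc m))) * exp (- ((norm x)\<^sup>2 / (8 * z)))"
        using z b by (intro C) auto
      also have "\<dots> \<le> C * b powr (- (real DIM('a) / 2 + real (Suc m))) * exp (- ((norm x)\<^sup>2 / (16 * b)))"
      proof (intro mult_mono C powr_mono2')
        have "(norm x)\<^sup>2 / (16 * b) \<le> (norm x)\<^sup>2 / (8 * z)"
          using z b h(2)[of k] by (intro divide_left_mono) auto
        then show "exp (- ((norm x)\<^sup>2 / (8 * z))) \<le> exp (- ((norm x)\<^sup>2 / (16 * b)))" by simp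
      qed (use z b C in auto)
      finally show "norm (s k x) \<le> w x" by (simp add: w_def)
    qed
    show "s k \<in> borel_measurable lborel" for k
      unfolding s_def cis_conv_exp by measurable
    show "(\<lambda>x. cis (- (\<xi> \<bullet> x)) * complex_of_real (- heat_kernel_lap (Suc m) b x)) \<in> borel_measurable lborel"
      unfolding cis_conv_exp by measurable
  qed
  moreover have "integral\<^sup>L lborel (s k) = complex_of_real
    (((norm \<xi>) ^ (2 * m) * exp (- ((b + h k) * y)) - (norm \<xi>) ^ (2 * m) * exp (- (b * y))) / h k)" for k
  proof -
    have i: "integrable lborel (\<lambda>x. cis (- (\<xi> \<bullet> x)) * complex_of_real (heat_kernel_lap m c x))"
      if "c > 0" for c
    proof (rule Bochner_Integration.integrable_bound[OF
      integrable_heat_kernel_lap[OF that, of m, where 'a='a]])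
      show "(\<lambda>x. cis (- (\<xi> \<bullet> x)) * complex_of_real (heat_kernel_lap m c x)) \<in> borel_measurable lborel"
        unfolding cis_conv_exp by measurable
    qed (auto simp: norm_mult)
    have "s k = (\<lambda>x. (cis (- (\<xi> \<bullet> x)) * complex_of_real (heat_kernel_lap m (b + h k) x)
      - cis (- (\<xi> \<bullet> x)) * complex_of_real (heat_kernel_lap m b x)) / complex_of_real (h k))"
      by (simp add: s_def fun_eq_iff right_diff_distrib diff_divide_distrib)
    then have "integral\<^sup>L lborel (s k) = (fourier_L1
      (\<lambda>x. complex_of_real (heat_kernel_lap m (b + h k) x)) \<xi>
      - fourier_L1 (\<lambda>x. complex_of_real (heat_kernel_lap m b x)) \<xi>) / complex_of_real (h k)"
      using i[of "b + h k"] i[OF b] h(1)[of k] b by (simp add: fourier_L1_def)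
    then show ?thesis
      using Suc.IH[of "b + h k"] Suc.IH[OF b] h(1)[of k] b by (simp add: y_def)
  qed
  ultimately have lim1: "(\<lambda>k. complex_of_real
    (((norm \<xi>) ^ (2 * m) * exp (- ((b + h k) * y)) - (norm \<xi>) ^ (2 * m) * exp (- (b * y))) / h k))
      \<longlonglongrightarrow> (LINT x|lborel. cis (- (\<xi> \<bullet> x)) * complex_of_real (- heat_kernel_lap (Suc m) b x))" by simp
  have "((\<lambda>b. (norm \<xi>) ^ (2 * m) * exp (- (b * y))) has_real_derivative (norm \<xi>) ^ (2 * m)
    * (exp (- (b * y)) * (- y))) (at b)"
    by (auto intro!: derivative_eq_intros)
  then have "(\<lambda>h. ((norm \<xi>) ^ (2 * m) * exp (- ((b + h) * y)) - (norm \<xi>) ^ (2 * m)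
    * exp (- (b * y))) / h) \<midarrow>0\<rightarrow> (norm \<xi>) ^ (2 * m) * (exp (- (b * y)) * (- y))"
    by (simp add: DERIV_def)
  from tendsto_of_real[OF filterlim_compose[OF this h0], where 'a=complex]
  have "(LINT x|lborel. cis (- (\<xi> \<bullet> x)) * complex_of_real (- heat_kernel_lap (Suc m) b x))
    = complex_of_real ((norm \<xi>) ^ (2 * m) * (exp (- (b * y)) * (- y)))"
    using LIMSEQ_unique[OF lim1] by blast
  then show ?case
    by (simp add: fourier_L1_def y_def power_add power2_eq_square mult_ac)
qed

section \<open>Mixtures of heat kernels\<close>

lemma norm_integral_le_nn_integral:
  fixes f :: "'a \<Rightarrow> 'b::{banach, second_countable_topology}"
  shows "ennreal (norm (integral\<^sup>L M f)) \<le> (\<integral>\<^sup>+ x. ennreal (norm (f x)) \<partial>M)"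
  by (cases "integrable M f") (auto simp: integral_norm_bound_ennreal not_integrable_integral_eq)

text \<open>Densities for mixtures of the kernels \<open>(-\<Delta>)\<^sup>m k\<close>. The kernel of order \<open>m\<close> has \<open>L\<^sup>1\<close> norm of order
  \<open>b powr (-m)\<close>, so the power \<open>m - 1 - \<sigma>\<close> leaves \<open>b powr (-1 - \<sigma>)\<close>, integrable at infinity for
  \<open>\<sigma> > 0\<close>; the exponential factor makes small \<open>b\<close> harmless.\<close>

locale heat_density =
  fixes R :: "real \<Rightarrow> real" and m :: nat and \<sigma> l C :: real
  assumes R_meas [measurable]: "R \<in> borel_measurable borel"
    and R_nonneg: "\<And>b. b > 0 \<Longrightarrow> 0 \<le> R b"
    and R_le: "\<And>b. b > 0 \<Longrightarrow> R b \<le> C * b powr (real m - 1 - \<sigma>) * exp (- (l / b))"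
    and \<sigma>_pos: "\<sigma> > 0" and l_pos: "l > 0" and C_nonneg: "C \<ge> 0"
begin

lemma nn_integral_moment_le:
  assumes e: "e \<ge> 0" and A: "A \<ge> 0" and L: "L \<ge> 0"
  shows "(\<integral>\<^sup>+ b\<in>{0<..}. ennreal (R b * (A * b powr (- (real m + e)) * exp (- (L / b)))) \<partial>lborel)
    \<le> ennreal (C * A * (Gamma (\<sigma> + e) * (l + L) powr (- (\<sigma> + e))))"
proof -
  have "(\<integral>\<^sup>+ b\<in>{0<..}. ennreal (R b * (A * b powr (- (real m + e)) * exp (- (L / b)))) \<partial>lborel)
    \<le> (\<integral>\<^sup>+ b. ennreal (C * A) * (ennreal (b powr (- 1 - (\<sigma> + e)) * exp (- ((l + L) / b)))
      * indicator {0<..} b) \<partial>lborel)"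
  proof (intro nn_integral_mono)
    fix b :: real
    show "ennreal (R b * (A * b powr (- (real m + e)) * exp (- (L / b)))) * indicator {0<..} b
      \<le> ennreal (C * A) * (ennreal (b powr (- 1 - (\<sigma> + e)) * exp (- ((l + L) / b))) * indicator {0<..} b)"
    proof (cases "b > 0")
      case True
      have "R b * (A * b powr (- (real m + e)) * exp (- (L / b)))
        \<le> (C * b powr (real m - 1 - \<sigma>) * exp (- (l / b))) * (A * b powr (- (real m + e)) * exp (- (L / b)))"
        using A by (intro mult_right_mono R_le True) auto
      also have "\<dots> = C * A * ((b powr (real m - 1 - \<sigma>) * b powr (- (real m + e)))
        * (exp (- (l / b)) * exp (- (L / b))))"
        by (simp only: mult_ac)
      also have "\<dots> = C * A * (b powr ((real m - 1 - \<sigma>) + (- (real m + e))) * exp (- (l / b) + (- (L / b))))"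
        by (simp only: powr_add exp_add)
      also have "(real m - 1 - \<sigma>) + (- (real m + e)) = - 1 - (\<sigma> + e)" by simp
      also have "- (l / b) + (- (L / b)) = - ((l + L) / b)" by (simp add: add_divide_distrib)
      finally show ?thesis using True A C_nonneg by (simp add: ennreal_leI flip: ennreal_mult')
    qed auto
  qed
  also have "\<dots> = ennreal (C * A) * ennreal (Gamma (\<sigma> + e) * (l + L) powr (- (\<sigma> + e)))"
    using e L \<sigma>_pos l_pos by (subst nn_integral_cmult) (auto simp: nn_integral_inverse_gamma)
  also have "\<dots> = ennreal (C * A * (Gamma (\<sigma> + e) * (l + L) powr (- (\<sigma> + e))))"
    using A C_nonneg by (subst ennreal_mult'[symmetric]) auto
  finally show ?thesis .
qed

end

lemma square_integrable_bounded_L1: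
  fixes f :: "'a::euclidean_space \<Rightarrow> real"
  assumes f: "integrable lborel f" and B: "\<And>x. \<bar>f x\<bar> \<le> B"
  shows "square_integrable (\<lambda>x. complex_of_real (f x))"
proof -
  have [measurable]: "f \<in> borel_measurable borel" using borel_measurable_integrable[OF f] by simp
  have B0: "B \<ge> 0" using B[of 0] by linarith
  have "(\<integral>\<^sup>+ x. ennreal ((norm (complex_of_real (f x)))\<^sup>2) \<partial>lborel)
    \<le> (\<integral>\<^sup>+ x. ennreal B * ennreal (norm (f x)) \<partial>lborel)"
  proof (intro nn_integral_mono)
    fix x
    have "(norm (complex_of_real (f x)))\<^sup>2 = \<bar>f x\<bar> * \<bar>f x\<bar>"
      by (simp only: norm_of_real power2_eq_square)
    also have "\<dots> \<le> B * norm (f x)"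
      using B[of x] by (simp only: real_norm_def mult_right_mono abs_ge_zero)
    finally have "(norm (complex_of_real (f x)))\<^sup>2 \<le> B * norm (f x)" .
    then show "ennreal ((norm (complex_of_real (f x)))\<^sup>2) \<le> ennreal B * ennreal (norm (f x))"
      using B0 by (simp add: ennreal_leI flip: ennreal_mult')
  qed
  also have "\<dots> = ennreal B * (\<integral>\<^sup>+ x. ennreal (norm (f x)) \<partial>lborel)" by (rule nn_integral_cmult) simp
  also have "\<dots> < \<infinity>"
    using f by (auto simp: integrable_iff_bounded ennreal_mult_less_top)
  finally show ?thesis by (simp add: square_integrable_def)
qed

context heat_density
begin

text \<open>Stated for a general kernel, because it serves both sides of the Fourier transform:
  for \<open>(-\<Delta>)\<^sup>m k\<close> the exponents are \<open>e\<^sub>1 = n/2\<close>, \<open>e\<^sub>2 = 0\<close>, and for \<open>\<bar>\<xi>\<bar> ^ (2m) * exp (-b * \<bar>\<xi>\<bar>\<^sup>2)\<close> they are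
  exchanged. Mixtures are thus integrable and bounded, hence square integrable, on both sides, so that
  the \<open>L\<^sup>2\<close> transform is given by the Fourier integral.\<close>

lemma mixture_integrable:
  fixes k :: "real \<Rightarrow> 'a::euclidean_space \<Rightarrow> real"
  assumes k_meas [measurable]: "(\<lambda>(b, x). k b x) \<in> borel_measurable (borel \<Otimes>\<^sub>M borel)"
    and A: "A \<ge> 0" and e: "e\<^sub>1 \<ge> 0" "e\<^sub>2 \<ge> 0"
    and sup: "\<And>b x. b > 0 \<Longrightarrow> \<bar>k b x\<bar> \<le> A * b powr (- (real m + e\<^sub>1))"
    and L1: "\<And>b. b > 0 \<Longrightarrow> (\<integral>\<^sup>+ x. ennreal \<bar>k b x\<bar> \<partial>lborel) \<le> ennreal (A * b powr (- (real m + e\<^sub>2)))"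
  shows "integrable (lborel \<Otimes>\<^sub>M lborel) (\<lambda>(b, x). indicator {0<..} b * (R b * k b x))"
    and "integrable lborel (\<lambda>x. LINT b:{0<..}|lborel. R b * k b x)"
    and "\<bar>LINT b:{0<..}|lborel. R b * k b x\<bar> \<le> C * A * (Gamma (\<sigma> + e\<^sub>1) * l powr (- (\<sigma> + e\<^sub>1)))"
    and "square_integrable (\<lambda>x. complex_of_real (LINT b:{0<..}|lborel. R b * k b x))"
proof -
  have [measurable]: "(\<lambda>(b, x). indicat_real {0<..} b * (R b * k b x)) \<in> borel_measurable (borel \<Otimes>\<^sub>M borel)"
    by measurable
  show pair: "integrable (lborel \<Otimes>\<^sub>M lborel) (\<lambda>(b, x). indicator {0<..} b * (R b * k b x))"
  proof (rule integrableI_bounded)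
    have "(\<integral>\<^sup>+ z. ennreal (norm (case z of (b, x) \<Rightarrow> indicator {0<..} b * (R b * k b x)))
      \<partial>(lborel \<Otimes>\<^sub>M lborel))
      = (\<integral>\<^sup>+ b. \<integral>\<^sup>+ x. ennreal (norm (indicator {0<..} b * (R b * k b x))) \<partial>lborel \<partial>lborel)"
      by (subst lborel.nn_integral_fst[symmetric]) auto
    also have "\<dots> \<le> (\<integral>\<^sup>+ b\<in>{0<..}. ennreal (R b * (A * b powr (- (real m + e\<^sub>2)) * exp (- (0 / b))))
      \<partial>lborel)"
    proof (intro nn_integral_mono)
      fix b :: real
      show "(\<integral>\<^sup>+ x. ennreal (norm (indicator {0<..} b * (R b * k b x))) \<partial>lborel)
        \<le> ennreal (R b * (A * b powr (- (real m + e\<^sub>2)) * exp (- (0 / b)))) * indicator {0<..} b"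
      proof (cases "b > 0")
        case True
        have "(\<integral>\<^sup>+ x. ennreal (norm (indicator {0<..} b * (R b * k b x))) \<partial>lborel)
          = (\<integral>\<^sup>+ x. ennreal (R b) * ennreal \<bar>k b x\<bar> \<partial>lborel)"
          using True R_nonneg[OF True] by (intro nn_integral_cong) (simp add: abs_mult ennreal_mult')
        also have "\<dots> = ennreal (R b) * (\<integral>\<^sup>+ x. ennreal \<bar>k b x\<bar> \<partial>lborel)"
          by (rule nn_integral_cmult) simp
        also have "\<dots> \<le> ennreal (R b) * ennreal (A * b powr (- (real m + e\<^sub>2)))"
          by (intro mult_left_mono L1 True) auto
        finally show ?thesis using True R_nonneg[OF True] by (simp flip: ennreal_mult')
      qed auto
    qed
    also have "\<dots> < \<infinity>"
      using nn_integral_moment_le[OF e(2) A, of 0] by (auto simp: top.not_eq_extremum[symmetric] top_unique)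
    finally show "(\<integral>\<^sup>+ z. ennreal (norm (case z of (b, x) \<Rightarrow> indicator {0<..} b * (R b * k b x)))
      \<partial>(lborel \<Otimes>\<^sub>M lborel)) < \<infinity>" .
  qed auto
  show int: "integrable lborel (\<lambda>x. LINT b:{0<..}|lborel. R b * k b x)"
    using lborel_pair.integrable_snd[OF pair] by (simp add: set_lebesgue_integral_def)
  show bd: "\<bar>LINT b:{0<..}|lborel. R b * k b x\<bar> \<le> C * A * (Gamma (\<sigma> + e\<^sub>1) * l powr (- (\<sigma> + e\<^sub>1)))" for x
  proof -
    define M where "M = C * A * (Gamma (\<sigma> + e\<^sub>1) * l powr (- (\<sigma> + e\<^sub>1)))"
    have M: "M \<ge> 0" using A C_nonneg e \<sigma>_pos
      by (auto simp: M_def intro!: mult_nonneg_nonneg less_imp_le[OF Gamma_real_pos])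
    have "ennreal (norm (LINT b:{0<..}|lborel. R b * k b x))
      \<le> (\<integral>\<^sup>+ b. ennreal (norm (indicator {0<..} b *\<^sub>R (R b * k b x))) \<partial>lborel)"
      unfolding set_lebesgue_integral_def by (rule norm_integral_le_nn_integral)
    also have "\<dots> \<le> (\<integral>\<^sup>+ b\<in>{0<..}. ennreal (R b * (A * b powr (- (real m + e\<^sub>1)) * exp (- (0 / b))))
      \<partial>lborel)"
    proof (intro nn_integral_mono)
      fix b :: real
      show "ennreal (norm (indicator {0<..} b *\<^sub>R (R b * k b x)))
        \<le> ennreal (R b * (A * b powr (- (real m + e\<^sub>1)) * exp (- (0 / b)))) * indicator {0<..} b"
        using R_nonneg[of b] sup[of b x] by (cases "b > 0")
          (auto simp: abs_mult intro!: ennreal_leI mult_left_mono)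
    qed
    also have "\<dots> \<le> ennreal M"
      using nn_integral_moment_le[OF e(1) A, of 0] by (simp add: M_def)
    finally show ?thesis using M by (simp add: M_def)
  qed
  show "square_integrable (\<lambda>x. complex_of_real (LINT b:{0<..}|lborel. R b * k b x))"
    by (rule square_integrable_bounded_L1[OF int bd])
qed

end

definition heat_mix :: "(real \<Rightarrow> real) \<Rightarrow> nat \<Rightarrow> 'a::euclidean_space \<Rightarrow> real" where
  "heat_mix R m x = (LINT b:{0<..}|lborel. R b * heat_kernel_lap m b x)"

text \<open>The Fourier transform of \<open>heat_mix R m\<close> (lemma \<open>fourier_heat_mix\<close>).\<close>

definition laplace_mix :: "(real \<Rightarrow> real) \<Rightarrow> nat \<Rightarrow> 'a::euclidean_space \<Rightarrow> real" where
  "laplace_mix R m \<xi> = (LINT b:{0<..}|lborel. R b * ((norm \<xi>) ^ (2 * m) * exp (- (b * (norm \<xi>)\<^sup>2))))"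

context heat_density
begin

lemma
  shows heat_mix_pair_integrable:
      "integrable (lborel \<Otimes>\<^sub>M lborel) (\<lambda>(b, x::'a::euclidean_space). indicator {0<..} b
        * (R b * heat_kernel_lap m b x))"
    and heat_mix_integrable: "integrable lborel (heat_mix R m :: 'a \<Rightarrow> real)"
    and heat_mix_square_integrable: "square_integrable (\<lambda>x::'a. complex_of_real (heat_mix R m x))"
proof -
  define d where "d = real DIM('a) / 2"
  obtain C1 where C1: "C1 \<ge> 0" "\<And>b (x::'a). b > 0 \<Longrightarrow>
      \<bar>heat_kernel_lap m b x\<bar> \<le> C1 * b powr (- (d + real m)) * exp (- ((norm x)\<^sup>2 / (8 * b)))"
    using heat_kernel_lap_bound[where 'a='a and m=m] unfolding d_def by blast
  define A where "A = C1 * (8 * pi) powr d"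
  have d0: "d \<ge> 0" by (simp add: d_def)
  have "1 \<le> (8 * pi) powr d" using d0 pi_ge_two by (intro ge_one_powr_ge_zero) auto
  then have AC: "C1 \<le> A" "A \<ge> 0" using C1 by (auto simp: A_def mult_le_cancel_left1)
  have meas: "(\<lambda>(b, x::'a). heat_kernel_lap m b x) \<in> borel_measurable (borel \<Otimes>\<^sub>M borel)" by measurable
  have sup: "\<bar>heat_kernel_lap m b x\<bar> \<le> A * b powr (- (real m + d))" if "b > 0" for b and x :: 'a
  proof -
    have "\<bar>heat_kernel_lap m b x\<bar> \<le> C1 * b powr (- (d + real m)) * exp (- ((norm x)\<^sup>2 / (8 * b)))"
      by (rule C1(2)[OF that])
    also have "\<dots> \<le> A * b powr (- (d + real m)) * 1"
      using C1 AC that by (intro mult_mono) auto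
    finally show ?thesis by (simp add: add.commute)
  qed
  have L1: "(\<integral>\<^sup>+ x. ennreal \<bar>heat_kernel_lap m b (x::'a)\<bar> \<partial>lborel)
    \<le> ennreal (A * b powr (- (real m + 0)))" if "b > 0" for b
  proof -
    have "(\<integral>\<^sup>+ x. ennreal \<bar>heat_kernel_lap m b (x::'a)\<bar> \<partial>lborel)
      \<le> (\<integral>\<^sup>+ x. ennreal (C1 * b powr (- (d + real m)))
        * ennreal (exp (- ((norm (x::'a))\<^sup>2 / (8 * b)))) \<partial>lborel)"
      using C1 that by (intro nn_integral_mono) (auto intro!: ennreal_leI simp flip: ennreal_mult')
    also have "\<dots> = ennreal (C1 * b powr (- (d + real m))) * ennreal ((pi * (8 * b)) powr d)"
      using that by (subst nn_integral_cmult) (auto simp: nn_integral_gaussian d_def)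
    also have "\<dots> = ennreal (C1 * b powr (- (d + real m)) * (pi * (8 * b)) powr d)"
      using C1 by (subst ennreal_mult') auto
    also have "C1 * b powr (- (d + real m)) * (pi * (8 * b)) powr d = C1
      * ((8 * pi) powr d * (b powr (- (d + real m)) * b powr d))"
      using that by (simp add: powr_mult mult_ac)
    also have "\<dots> = A * b powr (- (real m + 0))"
      by (simp add: A_def flip: powr_add)
    finally show ?thesis .
  qed
  note mix = mixture_integrable[OF meas AC(2) d0 order_refl sup L1]
  show "integrable (lborel \<Otimes>\<^sub>M lborel) (\<lambda>(b, x::'a). indicator {0<..} b * (R b * heat_kernel_lap m b x))"
    by (rule mix(1))
  show "integrable lborel (heat_mix R m :: 'a \<Rightarrow> real)" using mix(2) by (simp add: heat_mix_def[abs_def])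
  show "square_integrable (\<lambda>x::'a. complex_of_real (heat_mix R m x))" using mix(4)
    by (simp add: heat_mix_def)
qed

lemma laplace_mix_square_integrable: "square_integrable
  (\<lambda>\<xi>::'a::euclidean_space. complex_of_real (laplace_mix R m \<xi>))"
proof -
  define d where "d = real DIM('a) / 2"
  obtain C1 where C1: "C1 \<ge> 0" "\<And>z::real. z \<ge> 0 \<Longrightarrow> \<bar>poly (monom 1 m) z\<bar> \<le> C1 * exp (1/2 * z)"
    using poly_le_exp[of "1/2" "monom 1 m"] by auto
  define A where "A = C1 * (2 * pi) powr d"
  have d0: "d \<ge> 0" by (simp add: d_def)
  have "1 \<le> (2 * pi) powr d" using d0 pi_ge_two by (intro ge_one_powr_ge_zero) auto
  then have AC: "C1 \<le> A" "A \<ge> 0" using C1 by (auto simp: A_def mult_le_cancel_left1)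
  have meas: "(\<lambda>(b, \<xi>::'a). (norm \<xi>) ^ (2 * m) * exp (- (b * (norm \<xi>)\<^sup>2))) \<in> borel_measurable
    (borel \<Otimes>\<^sub>M borel)" by measurable
  have le: "\<bar>(norm \<xi>) ^ (2 * m) * exp (- (b * (norm \<xi>)\<^sup>2))\<bar> \<le> C1 * b powr (- real m)
    * exp (- ((norm \<xi>)\<^sup>2 / (2 / b)))" if "b > 0" for b and \<xi> :: 'a
  proof -
    define z where "z = b * (norm \<xi>)\<^sup>2"
    have z: "z \<ge> 0" using that by (simp add: z_def)
    have "(norm \<xi>) ^ (2 * m) = b powr (- real m) * z ^ m"
      using that by (simp add: z_def power_mult_distrib powr_minus powr_realpow power_mult)
    then have "\<bar>(norm \<xi>) ^ (2 * m) * exp (- (b * (norm \<xi>)\<^sup>2))\<bar> = b powr (- real m) * (z ^ m * exp (- z))"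
      using z by (simp add: z_def[symmetric] abs_mult)
    also have "\<dots> \<le> b powr (- real m) * ((C1 * exp (1/2 * z)) * exp (- z))"
      using C1(2)[OF z] z by (intro mult_left_mono mult_right_mono) (auto simp: poly_monom)
    also have "\<dots> = C1 * b powr (- real m) * (exp (1/2 * z) * exp (- z))" by (simp only: mult_ac)
    also have "exp (1/2 * z) * exp (- z) = exp (- ((norm \<xi>)\<^sup>2 / (2 / b)))"
      unfolding exp_add[symmetric] by (simp add: z_def)
    finally show ?thesis .
  qed
  have sup: "\<bar>(norm \<xi>) ^ (2 * m) * exp (- (b * (norm \<xi>)\<^sup>2))\<bar> \<le> A * b powr (- (real m + 0))"
    if "b > 0" for b and \<xi> :: 'a
  proof -
    have "C1 * b powr (- real m) * exp (- ((norm \<xi>)\<^sup>2 / (2 / b))) \<le> A * b powr (- real m) * 1"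
      using C1 AC that by (intro mult_mono) auto
    with le[OF that, of \<xi>] show ?thesis by simp
  qed
  have L1: "(\<integral>\<^sup>+ \<xi>. ennreal \<bar>(norm (\<xi>::'a)) ^ (2 * m) * exp (- (b * (norm \<xi>)\<^sup>2))\<bar> \<partial>lborel)
    \<le> ennreal (A * b powr (- (real m + d)))" if "b > 0" for b
  proof -
    have "(\<integral>\<^sup>+ \<xi>. ennreal \<bar>(norm (\<xi>::'a)) ^ (2 * m) * exp (- (b * (norm \<xi>)\<^sup>2))\<bar> \<partial>lborel)
      \<le> (\<integral>\<^sup>+ \<xi>. ennreal (C1 * b powr (- real m)) * ennreal (exp (- ((norm (\<xi>::'a))\<^sup>2 / (2 / b)))) \<partial>lborel)"
    proof (rule nn_integral_mono)
      fix \<xi> :: 'a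
      show "ennreal \<bar>(norm \<xi>) ^ (2 * m) * exp (- (b * (norm \<xi>)\<^sup>2))\<bar>
        \<le> ennreal (C1 * b powr (- real m)) * ennreal (exp (- ((norm \<xi>)\<^sup>2 / (2 / b))))"
        using le[OF that, of \<xi>] C1 by (subst ennreal_mult'[symmetric]) (auto intro: ennreal_leI)
    qed
    also have "\<dots> = ennreal (C1 * b powr (- real m)) * ennreal ((pi * (2 / b)) powr d)"
      using that by (subst nn_integral_cmult) (auto simp: nn_integral_gaussian d_def simp del:
        divide_divide_eq_right)
    also have "\<dots> = ennreal (C1 * b powr (- real m) * (pi * (2 / b)) powr d)"
      using C1 by (subst ennreal_mult') auto
    also have "(pi * (2 / b)) powr d = (2 * pi) powr d * b powr (- d)"
      using that by (simp add: powr_mult powr_divide powr_minus field_simps)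
    also have "C1 * b powr (- real m) * ((2 * pi) powr d * b powr (- d)) = A
      * (b powr (- real m) * b powr (- d))"
      by (simp add: A_def mult_ac)
    also have "\<dots> = A * b powr (- (real m + d))"
      by (simp flip: powr_add)
    finally show ?thesis .
  qed
  show ?thesis using mixture_integrable(4)[OF meas AC(2) order_refl d0 sup L1]
    by (simp add: laplace_mix_def)
qed

lemma fourier_heat_mix:
  fixes \<xi> :: "'a::euclidean_space"
  shows "fourier_L1 (\<lambda>x. complex_of_real (heat_mix R m x)) \<xi> = complex_of_real (laplace_mix R m \<xi>)"
proof -
  define f where "f = (\<lambda>b (x::'a). cis (- (\<xi> \<bullet> x))
    * complex_of_real (indicator {0<..} b * (R b * heat_kernel_lap m b x)))"
  have int: "integrable (lborel \<Otimes>\<^sub>M lborel) (\<lambda>(b, x). f b x)"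
  proof (rule Bochner_Integration.integrable_bound[OF heat_mix_pair_integrable[where 'a='a]])
    show "(\<lambda>(b, x). f b x) \<in> borel_measurable (lborel \<Otimes>\<^sub>M lborel)"
      unfolding f_def cis_conv_exp by measurable
  qed (auto simp: f_def norm_mult)
  have "fourier_L1 (\<lambda>x. complex_of_real (heat_mix R m x)) \<xi> = (LINT x|lborel. LINT b|lborel. f b x)"
    unfolding fourier_L1_def f_def heat_mix_def set_lebesgue_integral_def
    by (simp del: of_real_mult)
  also have "\<dots> = (LINT b|lborel. LINT x|lborel. f b x)"
    by (rule lborel_pair.Fubini_integral[OF int])
  also have "\<dots> = (LINT b|lborel. complex_of_real
    (indicator {0<..} b *\<^sub>R (R b * ((norm \<xi>) ^ (2 * m) * exp (- (b * (norm \<xi>)\<^sup>2))))))"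
  proof (intro Bochner_Integration.integral_cong refl)
    fix b :: real
    have "(LINT x|lborel. f b x) = complex_of_real (indicator {0<..} b * R b)
      * fourier_L1 (\<lambda>x. complex_of_real (heat_kernel_lap m b x)) \<xi>"
      unfolding f_def fourier_L1_def by (subst integral_mult_right_zero[symmetric]) (simp add: mult_ac)
    then show "(LINT x|lborel. f b x) = complex_of_real
      (indicator {0<..} b *\<^sub>R (R b * ((norm \<xi>) ^ (2 * m) * exp (- (b * (norm \<xi>)\<^sup>2)))))"
      by (cases "b > 0") (auto simp: fourier_heat_kernel_lap)
  qed
  also have "\<dots> = complex_of_real (laplace_mix R m \<xi>)"
    unfolding laplace_mix_def set_lebesgue_integral_def by (rule integral_complex_of_real)
  finally show ?thesis .
qed

lemma has_fourier_heat_mix: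
  "has_fourier (\<lambda>x::'a::euclidean_space. complex_of_real (heat_mix R m x))
    (\<lambda>\<xi>. complex_of_real (laplace_mix R m \<xi>))"
  unfolding has_fourier_def tendsto_L2_def
proof (intro conjI exI[of _ "\<lambda>k x. complex_of_real (heat_mix R m x)"] allI)
  show "integrable lborel (\<lambda>x::'a. complex_of_real (heat_mix R m x))"
    by (intro integrable_of_real heat_mix_integrable)
qed (simp_all add: heat_mix_square_integrable laplace_mix_square_integrable fourier_heat_mix)

end

text \<open>The constant is uniform in the density, so that scaled families of densities can be inserted.\<close>

lemma heat_mix_bound:
  "\<exists>C'\<ge>0. \<forall>R C l. heat_density R m \<sigma> l C \<longrightarrow>
     (\<forall>x::'a::euclidean_space. \<bar>heat_mix R m x\<bar> \<le> C * C'
       * (l + (norm x)\<^sup>2 / 8) powr (- (\<sigma> + real DIM('a) / 2)))"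
proof -
  define d where "d = real DIM('a) / 2"
  have d: "d \<ge> 0" by (simp add: d_def)
  obtain A where A: "A \<ge> 0" "\<And>b (x::'a). b > 0 \<Longrightarrow>
      \<bar>heat_kernel_lap m b x\<bar> \<le> A * b powr (- (d + real m)) * exp (- ((norm x)\<^sup>2 / (8 * b)))"
    using heat_kernel_lap_bound[where 'a='a and m=m] unfolding d_def by blast
  have "\<bar>heat_mix R m x\<bar> \<le> C * (A * \<bar>Gamma (\<sigma> + d)\<bar>) * (l + (norm x)\<^sup>2 / 8) powr (- (\<sigma> + d))"
    if "heat_density R m \<sigma> l C" for R C l and x :: 'a
  proof -
    interpret heat_density R m \<sigma> l C by fact
    define L where "L = (norm x)\<^sup>2 / 8"
    have "ennreal \<bar>heat_mix R m x\<bar> \<le> (\<integral>\<^sup>+ b. ennreal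
      (norm (indicator {0<..} b *\<^sub>R (R b * heat_kernel_lap m b x))) \<partial>lborel)"
      unfolding heat_mix_def set_lebesgue_integral_def real_norm_def[symmetric]
        by (rule norm_integral_le_nn_integral)
    also have "\<dots> \<le> (\<integral>\<^sup>+ b\<in>{0<..}. ennreal (R b * (A * b powr (- (real m + d)) * exp (- (L / b)))) \<partial>lborel)"
    proof (rule nn_integral_mono)
      fix b :: real
      show "ennreal (norm (indicator {0<..} b *\<^sub>R (R b * heat_kernel_lap m b x)))
        \<le> ennreal (R b * (A * b powr (- (real m + d)) * exp (- (L / b)))) * indicator {0<..} b"
        using A(2)[of b x] R_nonneg[of b]
        by (cases "b > 0") (auto simp: abs_mult L_def add.commute intro!: ennreal_leI mult_left_mono)
    qed
    also have "\<dots> \<le> ennreal (C * A * (Gamma (\<sigma> + d) * (l + L) powr (- (\<sigma> + d))))"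
      by (rule nn_integral_moment_le) (auto simp: A d L_def)
    finally have "\<bar>heat_mix R m x\<bar> \<le> C * A * (Gamma (\<sigma> + d) * (l + L) powr (- (\<sigma> + d)))"
      using A C_nonneg d \<sigma>_pos by (subst (asm) ennreal_le_iff)
        (auto intro!: mult_nonneg_nonneg less_imp_le[OF Gamma_real_pos])
    also have "\<dots> = C * (A * \<bar>Gamma (\<sigma> + d)\<bar>) * (l + L) powr (- (\<sigma> + d))"
      using d \<sigma>_pos by (simp add: less_imp_le[OF Gamma_real_pos])
    finally show ?thesis by (simp add: L_def)
  qed
  then show ?thesis using A unfolding d_def by (intro exI[of _ "A * \<bar>Gamma (\<sigma> + d)\<bar>"]) (auto simp: d_def)
qed

section \<open>Fractional Laplacians of powers of the bracket_power\<close>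

text \<open>A power of the bracket at length scale \<open>sqrt \<mu>\<close>; the factor 4 matches the exponent
  \<open>\<bar>x\<bar>\<^sup>2/(4b)\<close> of the heat kernel.\<close>

definition bracket_power :: "real \<Rightarrow> real \<Rightarrow> 'a::euclidean_space \<Rightarrow> real" where
  "bracket_power r \<mu> x = (1 + (norm x)\<^sup>2 / (4 * \<mu>)) powr r"

text \<open>The normalisation for which the mixture with \<open>bracket_density\<close> is exactly the bracket power with
  value 1 at the origin.\<close>

definition bracket_const :: "real \<Rightarrow> real \<Rightarrow> real \<Rightarrow> real" where
  "bracket_const d \<beta> \<mu> = \<mu> powr (d + \<beta>) * (4 * pi) powr d / Gamma (d + \<beta>)"

definition bracket_density :: "real \<Rightarrow> real \<Rightarrow> real \<Rightarrow> real \<Rightarrow> real" where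
  "bracket_density d \<beta> \<mu> b = bracket_const d \<beta> \<mu> * b powr (- 1 - \<beta>) * exp (- (\<mu> / b))"

lemma bracket_const_nonneg: "d \<ge> 0 \<Longrightarrow> \<beta> > 0 \<Longrightarrow> bracket_const d \<beta> \<mu> \<ge> 0"
  by (auto simp: bracket_const_def intro!: mult_nonneg_nonneg divide_nonneg_pos Gamma_real_pos)

lemma bracket_density_meas [measurable]: "bracket_density d \<beta> \<mu> \<in> borel_measurable borel"
  unfolding bracket_density_def[abs_def] by measurable

lemma heat_density_bracket:
  assumes "d \<ge> 0" "\<beta> > 0" "\<mu> > 0"
  shows "heat_density (bracket_density d \<beta> \<mu>) 0 \<beta> \<mu> (bracket_const d \<beta> \<mu>)"
  using assms bracket_const_nonneg[of d \<beta> \<mu>] by unfold_locales (auto simp: bracket_density_def)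

text \<open>The two exponentials combine to \<open>exp (-(\<mu> + \<bar>x\<bar>\<^sup>2/4)/b)\<close>, and the integral over \<open>b\<close> is the inverse
  Gamma integral.\<close>

lemma heat_mix_bracket:
  fixes x :: "'a::euclidean_space"
  assumes \<beta>: "\<beta> > 0" and \<mu>: "\<mu> > 0" and d: "d = real DIM('a) / 2"
  shows "heat_mix (bracket_density d \<beta> \<mu>) 0 x = bracket_power (- (d + \<beta>)) \<mu> x"
proof -
  define A \<kappa> where "A = \<mu> + (norm x)\<^sup>2 / 4" and "\<kappa> = d + \<beta>"
  have A: "A > 0" using \<mu> by (simp add: A_def add_pos_nonneg)
  have \<kappa>: "\<kappa> > 0" using \<beta> d by (simp add: \<kappa>_def add_nonneg_pos)
  define c where "c = \<mu> powr \<kappa> / Gamma \<kappa>"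
  have c: "c \<ge> 0" using \<kappa> by (simp add: c_def Gamma_real_pos less_imp_le)
  have eq: "bracket_density d \<beta> \<mu> b * heat_kernel_lap 0 b x = c
    * (b powr (- 1 - \<kappa>) * exp (- (A / b)))" if "b > 0" for b
  proof -
    have "bracket_density d \<beta> \<mu> b * heat_kernel_lap 0 b x
      = c * ((4 * pi) powr d * (4 * pi) powr (- d)) * (b powr (- 1 - \<beta>) * b powr (- d))
        * (exp (- (\<mu> / b)) * exp (- ((norm x)\<^sup>2 / (4 * b))))"
      by (simp add: bracket_density_def bracket_const_def heat_kernel_lap_def c_def \<kappa>_def d)
    also have "\<dots> = c * (b powr (- 1 - \<kappa>) * exp (- (A / b)))"
      by (simp add: A_def \<kappa>_def add_divide_distrib algebra_simps flip: powr_add exp_add)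
    finally show ?thesis .
  qed
  have "heat_mix (bracket_density d \<beta> \<mu>) 0 x
    = (LINT b|lborel. c * (indicator {0<..} b * (b powr (- 1 - \<kappa>) * exp (- (A / b)))))"
    unfolding heat_mix_def set_lebesgue_integral_def
  proof (intro Bochner_Integration.integral_cong refl)
    fix b :: real
    show "indicator {0<..} b *\<^sub>R (bracket_density d \<beta> \<mu> b * heat_kernel_lap 0 b x) =
        c * (indicator {0<..} b * (b powr (- 1 - \<kappa>) * exp (- (A / b))))"
      using eq[of b] by (cases "b > 0") auto
  qed
  also have "\<dots> = c * (LINT b|lborel. indicator {0<..} b * (b powr (- 1 - \<kappa>) * exp (- (A / b))))" by simp
  also have "(LINT b|lborel. indicator {0<..} b * (b powr (- 1 - \<kappa>) * exp (- (A / b))))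
    = enn2real (\<integral>\<^sup>+ b. ennreal (indicator {0<..} b * (b powr (- 1 - \<kappa>) * exp (- (A / b)))) \<partial>lborel)"
    by (rule integral_eq_nn_integral) auto
  also have "(\<integral>\<^sup>+ b. ennreal (indicator {0<..} b * (b powr (- 1 - \<kappa>) * exp (- (A / b)))) \<partial>lborel)
    = ennreal (Gamma \<kappa> * A powr (- \<kappa>))"
    unfolding nn_integral_inverse_gamma[OF \<kappa> A, symmetric]
    by (intro nn_integral_cong) (auto simp: indicator_def)
  also have "enn2real \<dots> = Gamma \<kappa> * A powr (- \<kappa>)"
    using \<kappa> by (simp add: Gamma_real_pos less_imp_le)
  also have "c * (Gamma \<kappa> * A powr (- \<kappa>)) = \<mu> powr \<kappa> * A powr (- \<kappa>)"
    using Gamma_real_pos[OF \<kappa>] by (simp add: c_def)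
  also have "\<dots> = bracket_power (- (d + \<beta>)) \<mu> x"
  proof -
    have "A = \<mu> * (1 + (norm x)\<^sup>2 / (4 * \<mu>))" using \<mu> by (simp add: A_def field_simps)
    then have "A powr (- \<kappa>) = \<mu> powr (- \<kappa>) * (1 + (norm x)\<^sup>2 / (4 * \<mu>)) powr (- \<kappa>)"
      using \<mu> by (simp only: powr_mult)
    then show ?thesis
      using \<mu> by (simp add: bracket_power_def \<kappa>_def[symmetric] powr_minus)
  qed
  finally show ?thesis .
qed

text \<open>The Riemann-Liouville integral of order \<open>s\<close> of a function on the positive half-line.\<close>

definition frac_integral :: "real \<Rightarrow> (real \<Rightarrow> real) \<Rightarrow> real \<Rightarrow> real" where
  "frac_integral s \<rho> b = (LINT t|lborel. (if 0 < t \<and> t < b then (b - t) powr (s - 1) * \<rho> t else 0))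
    / Gamma s"

lemma frac_integral_meas [measurable]:
  assumes [measurable]: "\<rho> \<in> borel_measurable borel"
  shows "frac_integral s \<rho> \<in> borel_measurable borel"
  unfolding frac_integral_def[abs_def] by measurable

text \<open>For \<open>s \<ge> 1\<close> the kernel \<open>(b - t) powr (s - 1)\<close> is at most \<open>b powr (s - 1)\<close>. Splitting
  \<open>exp (-\<mu>/t)\<close> into two equal factors, one of them at most \<open>exp (-(\<mu>/2)/b)\<close>, leaves a Gamma integral.\<close>

lemma frac_integral_bracket_density:
  assumes d: "d \<ge> 0" and \<beta>: "\<beta> > 0" and \<mu>: "\<mu> > 0" and s: "s \<ge> 1" and b: "b > 0"
  shows "integrable lborel (\<lambda>t. if 0 < t \<and> t < b then (b - t) powr (s - 1)
    * bracket_density d \<beta> \<mu> t else 0)" (is "integrable _ ?f")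
    and "0 \<le> frac_integral s (bracket_density d \<beta> \<mu>) b"
    and "frac_integral s (bracket_density d \<beta> \<mu>) b \<le>
      bracket_const d \<beta> \<mu> * Gamma \<beta> * (\<mu> / 2) powr (- \<beta>) / Gamma s * b powr (s - 1) * exp (- (\<mu> / 2 / b))"
proof -
  define Z where "Z = bracket_const d \<beta> \<mu>"
  have Z: "Z \<ge> 0" using bracket_const_nonneg[OF d \<beta>] by (simp add: Z_def)
  define K where "K = Z * b powr (s - 1) * exp (- (\<mu> / 2 / b))"
  have K: "K \<ge> 0" using Z by (simp add: K_def)
  have f0: "?f t \<ge> 0" for t using Z by (simp add: bracket_density_def Z_def)
  have "(\<integral>\<^sup>+ t. ennreal (?f t) \<partial>lborel) \<le> (\<integral>\<^sup>+ t. ennreal K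
    * (ennreal (t powr (- 1 - \<beta>) * exp (- (\<mu> / 2 / t))) * indicator {0<..} t) \<partial>lborel)"
  proof (rule nn_integral_mono)
    fix t :: real
    show "ennreal (?f t) \<le> ennreal K * (ennreal (t powr (- 1 - \<beta>) * exp (- (\<mu> / 2 / t)))
      * indicator {0<..} t)"
    proof (cases "0 < t \<and> t < b")
      case True
      have "exp (- (\<mu> / t)) = exp (- (\<mu> / 2 / t)) * exp (- (\<mu> / 2 / t))"
        by (simp flip: exp_add)
      also have "\<dots> \<le> exp (- (\<mu> / 2 / b)) * exp (- (\<mu> / 2 / t))"
      proof (intro mult_right_mono)
        have "\<mu> / 2 / b \<le> \<mu> / 2 / t" using True \<mu> by (intro divide_left_mono) auto
        then show "exp (- (\<mu> / 2 / t)) \<le> exp (- (\<mu> / 2 / b))" by simp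
      qed simp
      finally have e: "exp (- (\<mu> / t)) \<le> exp (- (\<mu> / 2 / b)) * exp (- (\<mu> / 2 / t))" .
      have p: "(b - t) powr (s - 1) \<le> b powr (s - 1)" using True s by (intro powr_mono2) auto
      have "?f t = (b - t) powr (s - 1) * (Z * t powr (- 1 - \<beta>) * exp (- (\<mu> / t)))"
        using True by (simp add: bracket_density_def Z_def)
      also have "\<dots> \<le> b powr (s - 1) * (Z * t powr (- 1 - \<beta>) * (exp (- (\<mu> / 2 / b)) * exp (- (\<mu> / 2 / t))))"
        using e p Z by (intro mult_mono mult_left_mono) auto
      also have "\<dots> = K * (t powr (- 1 - \<beta>) * exp (- (\<mu> / 2 / t)))" by (simp only: K_def mult_ac)
      finally have "?f t \<le> K * (t powr (- 1 - \<beta>) * exp (- (\<mu> / 2 / t)))" .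
      then have "ennreal (?f t) \<le> ennreal (K * (t powr (- 1 - \<beta>) * exp (- (\<mu> / 2 / t))))"
        by (rule ennreal_leI)
      also have "\<dots> = ennreal K * ennreal (t powr (- 1 - \<beta>) * exp (- (\<mu> / 2 / t)))"
        using K by (rule ennreal_mult')
      finally show ?thesis using True by simp
    qed auto
  qed
  also have "\<dots> = ennreal K * ennreal (Gamma \<beta> * (\<mu> / 2) powr (- \<beta>))"
    using nn_integral_inverse_gamma[OF \<beta>, of "\<mu> / 2"] \<mu> by (subst nn_integral_cmult) auto
  also have "\<dots> = ennreal (K * (Gamma \<beta> * (\<mu> / 2) powr (- \<beta>)))" using K by (simp only: ennreal_mult')
  finally have le: "(\<integral>\<^sup>+ t. ennreal (?f t) \<partial>lborel) \<le> ennreal (K * (Gamma \<beta> * (\<mu> / 2) powr (- \<beta>)))" .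
  show int: "integrable lborel ?f"
  proof (rule integrableI_bounded)
    have "(\<integral>\<^sup>+ t. ennreal (norm (?f t)) \<partial>lborel) = (\<integral>\<^sup>+ t. ennreal (?f t) \<partial>lborel)"
      using f0 by (intro nn_integral_cong) (simp add: abs_of_nonneg del: if_split)
    also have "\<dots> < \<infinity>" using le by (auto simp: top.not_eq_extremum[symmetric] top_unique)
    finally show "(\<integral>\<^sup>+ t. ennreal (norm (?f t)) \<partial>lborel) < \<infinity>" .
  qed simp
  have s0: "Gamma s > 0" using s by (intro Gamma_real_pos) auto
  show "0 \<le> frac_integral s (bracket_density d \<beta> \<mu>) b"
    unfolding frac_integral_def using f0 s0 by
      (intro divide_nonneg_pos Bochner_Integration.integral_nonneg) auto
  have "ennreal (integral\<^sup>L lborel ?f) \<le> ennreal (K * (Gamma \<beta> * (\<mu> / 2) powr (- \<beta>)))"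
    using le nn_integral_eq_integral[OF int] f0 by simp
  then have "integral\<^sup>L lborel ?f \<le> K * (Gamma \<beta> * (\<mu> / 2) powr (- \<beta>))"
    using K \<beta> by (subst (asm) ennreal_le_iff)
      (auto intro!: mult_nonneg_nonneg less_imp_le[OF Gamma_real_pos])
  then have "frac_integral s (bracket_density d \<beta> \<mu>) b \<le> K * (Gamma \<beta> * (\<mu> / 2) powr (- \<beta>)) / Gamma s"
    unfolding frac_integral_def using s0 by (intro divide_right_mono) auto
  then show "frac_integral s (bracket_density d \<beta> \<mu>) b \<le>
      bracket_const d \<beta> \<mu> * Gamma \<beta> * (\<mu> / 2) powr (- \<beta>) / Gamma s * b powr (s - 1) * exp (- (\<mu> / 2 / b))"
    by (simp add: K_def Z_def mult_ac)
qed

text \<open>The Laplace transform turns fractional integration of order \<open>s\<close> into multiplication by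
  \<open>y powr (-s)\<close>: by Tonelli, and after the shift \<open>b = t + \<tau>\<close>, the integral factorises.\<close>

lemma laplace_frac_integral:
  assumes d: "d \<ge> 0" and \<beta>: "\<beta> > 0" and \<mu>: "\<mu> > 0" and s: "s \<ge> 1" and y: "y > 0"
  defines "\<rho> \<equiv> bracket_density d \<beta> \<mu>"
  shows "(LINT b:{0<..}|lborel. frac_integral s \<rho> b * exp (- (b * y))) = y powr (- s)
    * (LINT t:{0<..}|lborel. \<rho> t * exp (- (t * y)))"
proof -
  have \<rho>0: "\<rho> t \<ge> 0" for t using bracket_const_nonneg[OF d \<beta>] by (simp add: \<rho>_def bracket_density_def)
  have [measurable]: "\<rho> \<in> borel_measurable borel" by (simp add: \<rho>_def)
  have s0: "Gamma s > 0" using s by (intro Gamma_real_pos) auto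
  define g where "g = (\<lambda>t b::real. if 0 < t \<and> t < b then (b - t) powr (s - 1) else 0)"
  have [measurable]: "(\<lambda>(t, b). g t b) \<in> borel_measurable (borel \<Otimes>\<^sub>M borel)" unfolding g_def by measurable
  have [measurable]: "g t \<in> borel_measurable borel" for t unfolding g_def by measurable
  have g0: "g t b \<ge> 0" for t b by (simp add: g_def)
  have fi: "ennreal (indicator {0<..} b * (frac_integral s \<rho> b * exp (- (b * y)))) =
      (\<integral>\<^sup>+ t. ennreal (g t b * (\<rho> t * exp (- (b * y)) / Gamma s)) \<partial>lborel)" for b
  proof (cases "b > 0")
    case True
    have "ennreal (LINT t|lborel. (if 0 < t \<and> t < b then (b - t) powr (s - 1) * \<rho> t else 0)) =
       (\<integral>\<^sup>+ t. ennreal (if 0 < t \<and> t < b then (b - t) powr (s - 1) * \<rho> t else 0) \<partial>lborel)"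
      using frac_integral_bracket_density(1)[OF d \<beta> \<mu> s True, folded \<rho>_def] \<rho>0
      by (intro nn_integral_eq_integral[symmetric]) auto
    then have "ennreal (exp (- (b * y)) / Gamma s
      * (LINT t|lborel. (if 0 < t \<and> t < b then (b - t) powr (s - 1) * \<rho> t else 0)))
      = ennreal (exp (- (b * y)) / Gamma s) * (\<integral>\<^sup>+ t. ennreal
        (if 0 < t \<and> t < b then (b - t) powr (s - 1) * \<rho> t else 0) \<partial>lborel)"
      using s0 by (subst ennreal_mult') auto
    also have "\<dots> = (\<integral>\<^sup>+ t. ennreal (exp (- (b * y)) / Gamma s)
      * ennreal (if 0 < t \<and> t < b then (b - t) powr (s - 1) * \<rho> t else 0) \<partial>lborel)"
      by (rule nn_integral_cmult[symmetric]) simp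
    also have "\<dots> = (\<integral>\<^sup>+ t. ennreal (g t b * (\<rho> t * exp (- (b * y)) / Gamma s)) \<partial>lborel)"
      using s0 by (intro nn_integral_cong) (auto simp: g_def mult_ac simp flip: ennreal_mult')
    finally show ?thesis using True by (simp add: frac_integral_def mult_ac)
  next
    case False
    then have "g t b = 0" for t by (auto simp: g_def)
    with False show ?thesis by simp
  qed
  have inner: "(\<integral>\<^sup>+ b. ennreal (g t b * exp (- (b * y))) \<partial>lborel)
    = ennreal (Gamma s * y powr (- s) * exp (- (t * y))) * indicator {0<..} t" for t
  proof (cases "t > 0")
    case True
    have "(\<integral>\<^sup>+ b. ennreal (g t b * exp (- (b * y))) \<partial>lborel) = ennreal \<bar>1\<bar>
      * (\<integral>\<^sup>+ b. ennreal (g t (t + 1 * b) * exp (- ((t + 1 * b) * y))) \<partial>lborel)"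
      by (rule nn_integral_real_affine) simp_all
    also have "\<dots> = (\<integral>\<^sup>+ b. ennreal (exp (- (t * y)))
      * (ennreal (b powr (s - 1) * exp (- (y * b))) * indicator {0<..} b) \<partial>lborel)"
      using True by (simp, intro nn_integral_cong)
        (auto simp: g_def indicator_def exp_add[symmetric] algebra_simps simp flip: ennreal_mult')
    also have "\<dots> = ennreal (exp (- (t * y))) * ennreal (Gamma s * y powr (- s))"
      using s y by (subst nn_integral_cmult) (auto simp: nn_integral_gamma_exp)
    finally show ?thesis using True by (simp add: mult_ac flip: ennreal_mult')
  next
    case False
    then have "g t b = 0" for b by (auto simp: g_def)
    with False show ?thesis by simp
  qed
  have "(\<integral>\<^sup>+ b. ennreal (indicator {0<..} b * (frac_integral s \<rho> b * exp (- (b * y)))) \<partial>lborel)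
      = (\<integral>\<^sup>+ b. \<integral>\<^sup>+ t. ennreal (g t b * (\<rho> t * exp (- (b * y)) / Gamma s)) \<partial>lborel \<partial>lborel)"
    by (simp only: fi)
  also have "\<dots> = (\<integral>\<^sup>+ t. \<integral>\<^sup>+ b. ennreal (g t b * (\<rho> t * exp (- (b * y)) / Gamma s)) \<partial>lborel \<partial>lborel)"
    by (rule lborel_pair.Fubini') measurable
  also have "\<dots> = (\<integral>\<^sup>+ t. ennreal (\<rho> t / Gamma s)
    * (\<integral>\<^sup>+ b. ennreal (g t b * exp (- (b * y))) \<partial>lborel) \<partial>lborel)"
  proof (rule nn_integral_cong)
    fix t :: real
    have "(\<integral>\<^sup>+ b. ennreal (g t b * (\<rho> t * exp (- (b * y)) / Gamma s)) \<partial>lborel)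
      = (\<integral>\<^sup>+ b. ennreal (\<rho> t / Gamma s) * ennreal (g t b * exp (- (b * y))) \<partial>lborel)"
      using \<rho>0[of t] s0 g0 by (intro nn_integral_cong) (simp add: mult_ac flip: ennreal_mult')
    also have "\<dots> = ennreal (\<rho> t / Gamma s) * (\<integral>\<^sup>+ b. ennreal (g t b * exp (- (b * y))) \<partial>lborel)"
      by (rule nn_integral_cmult) measurable
    finally show "(\<integral>\<^sup>+ b. ennreal (g t b * (\<rho> t * exp (- (b * y)) / Gamma s)) \<partial>lborel)
      = ennreal (\<rho> t / Gamma s) * (\<integral>\<^sup>+ b. ennreal (g t b * exp (- (b * y))) \<partial>lborel)" .
  qed
  also have "\<dots> = (\<integral>\<^sup>+ t. ennreal (y powr (- s))
    * ennreal (indicator {0<..} t * (\<rho> t * exp (- (t * y)))) \<partial>lborel)"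
    unfolding inner using \<rho>0 s0 by (intro nn_integral_cong)
      (auto simp: indicator_def mult_ac simp flip: ennreal_mult')
  also have "\<dots> = ennreal (y powr (- s)) * (\<integral>\<^sup>+ t. ennreal
    (indicator {0<..} t * (\<rho> t * exp (- (t * y)))) \<partial>lborel)"
    by (rule nn_integral_cmult) measurable
  finally have eq: "(\<integral>\<^sup>+ b. ennreal (indicator {0<..} b * (frac_integral s \<rho> b * exp (- (b * y)))) \<partial>lborel)
      = ennreal (y powr (- s)) * (\<integral>\<^sup>+ t. ennreal (indicator {0<..} t * (\<rho> t * exp (- (t * y)))) \<partial>lborel)" .
  have fi0: "indicator {0<..} b * (frac_integral s \<rho> b * exp (- (b * y))) \<ge> 0" for b
    using frac_integral_bracket_density(2)[OF d \<beta> \<mu> s, of b] by (cases "b > 0") (auto simp: \<rho>_def)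
  have "(LINT b|lborel. indicator {0<..} b * (frac_integral s \<rho> b * exp (- (b * y)))) = y powr (- s)
    * (LINT t|lborel. indicator {0<..} t * (\<rho> t * exp (- (t * y))))"
    using fi0 \<rho>0 by (subst (1 2) integral_eq_nn_integral) (auto simp: eq enn2real_mult)
  then show ?thesis by (simp add: set_lebesgue_integral_def)
qed

text \<open>The function \<open>g\<close> is the mixture of \<open>(-\<Delta>)\<^sup>m k\<close> with the fractional integral of order \<open>m - \<sigma>\<close> of the
  bracket density. Its tail is that of the bracket power with \<open>\<sigma>\<close> in place of \<open>\<beta>\<close>, and the factor
  \<open>\<mu> powr (-\<sigma>)\<close> is the one dictated by scaling.\<close>

lemma frac_laplacian_bracket:
  assumes \<beta>: "\<beta> > 0" and \<sigma>: "\<sigma> > 0"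
  shows "\<exists>C\<ge>0. \<forall>\<mu>>0. \<exists>g. has_frac_laplacian \<sigma>
    (bracket_power (- (real DIM('a) / 2 + \<beta>)) \<mu> :: 'a::euclidean_space \<Rightarrow> real) g \<and>
    (\<forall>x. \<bar>g x\<bar> \<le> C * \<mu> powr (- \<sigma>) * bracket_power (- (real DIM('a) / 2 + \<sigma>)) \<mu> x)"
proof -
  define d where "d = real DIM('a) / 2"
  have d: "d \<ge> 0" by (simp add: d_def)
  \<comment> \<open>One order more than needed for \<open>m > \<sigma>\<close>: then \<open>s \<ge> 1\<close>, so that the kernel of the
    fractional integral is bounded.\<close>
  define m where "m = nat \<lceil>\<sigma> + 1\<rceil>"
  define s where "s = real m - \<sigma>"
  have s: "s \<ge> 1" using \<sigma> by (simp add: s_def m_def)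
  have m: "m \<ge> 1" using \<sigma> by (simp add: m_def) linarith
  obtain C' where C': "C' \<ge> 0" "\<And>R C l (x::'a). heat_density R m \<sigma> l C \<Longrightarrow>
     \<bar>heat_mix R m x\<bar> \<le> C * C' * (l + (norm x)\<^sup>2 / 8) powr (- (\<sigma> + d))"
    using heat_mix_bound[of m \<sigma>, where 'a='a] unfolding d_def by blast
  define C where "C = (4 * pi) powr d / Gamma (d + \<beta>) * Gamma \<beta> * 2 powr \<beta> / Gamma s * C' * 2 powr (\<sigma> + d)"
  show ?thesis
  proof (intro exI[of _ C] conjI allI impI)
    show "C \<ge> 0"
      using C' s \<beta> d by (auto simp: C_def intro!: mult_nonneg_nonneg divide_nonneg_nonneg
        less_imp_le[OF Gamma_real_pos])
    fix \<mu> :: real assume \<mu>: "\<mu> > 0"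
    define \<rho> where "\<rho> = bracket_density d \<beta> \<mu>"
    define R where "R = frac_integral s \<rho>"
    define D where "D = bracket_const d \<beta> \<mu> * Gamma \<beta> * (\<mu> / 2) powr (- \<beta>) / Gamma s"
    interpret \<rho>: heat_density \<rho> 0 \<beta> \<mu> "bracket_const d \<beta> \<mu>"
      unfolding \<rho>_def by (rule heat_density_bracket[OF d \<beta> \<mu>])
    interpret R: heat_density R m \<sigma> "\<mu> / 2" D
    proof
      show "R \<in> borel_measurable borel" unfolding R_def by measurable
      show "D \<ge> 0" using bracket_const_nonneg[OF d \<beta>, of \<mu>] s \<beta>
        by (auto simp: D_def intro!: mult_nonneg_nonneg divide_nonneg_nonneg less_imp_le[OF Gamma_real_pos])
      fix b :: real assume b: "b > 0"
      show "0 \<le> R b" unfolding R_def \<rho>_def by (rule frac_integral_bracket_density(2)[OF d \<beta> \<mu> s b])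
      show "R b \<le> D * b powr (real m - 1 - \<sigma>) * exp (- (\<mu> / 2 / b))"
      proof -
        have "real m - 1 - \<sigma> = s - 1" by (simp add: s_def)
        then show ?thesis
          using frac_integral_bracket_density(3)[OF d \<beta> \<mu> s b] by (simp only: R_def \<rho>_def D_def)
      qed
    qed (use \<sigma> \<mu> in auto)
    have eq: "bracket_power (- (d + \<beta>)) \<mu> = (heat_mix \<rho> 0 :: 'a \<Rightarrow> real)"
      unfolding \<rho>_def using heat_mix_bracket[OF \<beta> \<mu> d_def] by auto
    have lap: "laplace_mix R m \<xi> = norm \<xi> powr (2 * \<sigma>) * laplace_mix \<rho> 0 \<xi>" for \<xi> :: 'a
    proof (cases "\<xi> = 0")
      case True
      then show ?thesis using m by (simp add: laplace_mix_def set_lebesgue_integral_def)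
    next
      case False
      define y where "y = (norm \<xi>)\<^sup>2"
      have y: "y > 0" using False by (simp add: y_def)
      have "laplace_mix R m \<xi> = y ^ m * (LINT b:{0<..}|lborel. R b * exp (- (b * y)))"
      proof -
        have "R b * ((norm \<xi>) ^ (2 * m) * exp (- (b * (norm \<xi>)\<^sup>2))) = y ^ m * (R b * exp (- (b * y)))" for b
          by (simp add: y_def power_mult)
        then show ?thesis unfolding laplace_mix_def by (simp only: set_integral_mult_right)
      qed
      also have "\<dots> = y ^ m * (y powr (- s) * (LINT t:{0<..}|lborel. \<rho> t * exp (- (t * y))))"
        unfolding R_def \<rho>_def laplace_frac_integral[OF d \<beta> \<mu> s y] ..
      also have "\<dots> = (y powr (real m) * y powr (- s)) * laplace_mix \<rho> 0 \<xi>"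
        using y by (simp add: powr_realpow laplace_mix_def y_def)
      also have "y powr (real m) * y powr (- s) = y powr \<sigma>" by (simp add: s_def flip: powr_add)
      also have "\<dots> = norm \<xi> powr (2 * \<sigma>)"
        using False by (simp add: y_def powr_powr flip: powr_numeral)
      finally show ?thesis .
    qed
    have frac: "has_frac_laplacian \<sigma> (bracket_power (- (d + \<beta>)) \<mu> :: 'a \<Rightarrow> real) (heat_mix R m)"
      unfolding has_frac_laplacian_def eq using \<sigma> \<rho>.has_fourier_heat_mix[where 'a='a]
        R.has_fourier_heat_mix[where 'a='a]
      by (auto simp: lap)
    show "\<exists>g. has_frac_laplacian \<sigma> (bracket_power (- (real DIM('a) / 2 + \<beta>)) \<mu> :: 'a \<Rightarrow> real) g \<and>
        (\<forall>x. \<bar>g x\<bar> \<le> C * \<mu> powr (- \<sigma>) * bracket_power (- (real DIM('a) / 2 + \<sigma>)) \<mu> x)"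
      unfolding d_def[symmetric]
    proof (intro exI[of _ "heat_mix R m"] conjI frac allI)
      fix x :: 'a
      define q where "q = 1 + (norm x)\<^sup>2 / (4 * \<mu>)"
      have "\<bar>heat_mix R m x\<bar> \<le> D * C' * (\<mu> / 2 + (norm x)\<^sup>2 / 8) powr (- (\<sigma> + d))"
        by (rule C'(2)) unfold_locales
      also have "\<mu> / 2 + (norm x)\<^sup>2 / 8 = (\<mu> / 2) * q"
        using \<mu> by (simp add: q_def field_simps)
      also have "((\<mu> / 2) * q) powr (- (\<sigma> + d)) = (\<mu> powr (- (\<sigma> + d)) * 2 powr (\<sigma> + d))
        * q powr (- (\<sigma> + d))"
      proof -
        have "(\<mu> / 2) powr (- e) = \<mu> powr (- e) * 2 powr e" for e
          using \<mu> by (simp add: powr_divide powr_minus_divide)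
        then show ?thesis by (simp only: powr_mult)
      qed
      also have "D = (4 * pi) powr d / Gamma (d + \<beta>) * Gamma \<beta> * 2 powr \<beta> / Gamma s
        * (\<mu> powr (d + \<beta>) * \<mu> powr (- \<beta>))"
        using \<mu> by (simp add: D_def bracket_const_def powr_divide powr_minus_divide mult_ac)
      also have "\<mu> powr (d + \<beta>) * \<mu> powr (- \<beta>) = \<mu> powr d" by (simp flip: powr_add)
      also have "(4 * pi) powr d / Gamma (d + \<beta>) * Gamma \<beta> * 2 powr \<beta> / Gamma s * \<mu> powr d * C' *
          (\<mu> powr (- (\<sigma> + d)) * 2 powr (\<sigma> + d) * q powr (- (\<sigma> + d)))
        = C * (\<mu> powr d * \<mu> powr (- (\<sigma> + d))) * q powr (- (\<sigma> + d))"
        by (simp add: C_def)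
      also have "\<mu> powr d * \<mu> powr (- (\<sigma> + d)) = \<mu> powr (- \<sigma>)" by (simp flip: powr_add)
      finally show "\<bar>heat_mix R m x\<bar> \<le> C * \<mu> powr (- \<sigma>) * bracket_power (- (d + \<sigma>)) \<mu> x"
        by (simp add: bracket_power_def q_def add.commute)
    qed
  qed
qed

section \<open>Smoothness, Laplacians and membership in the test class\<close>

lemma C_k_Suc_imp: "C_k (Suc k) f \<Longrightarrow> C_k k f"
proof (induction k arbitrary: f)
  case 0
  then show ?case by (auto intro: differentiable_imp_continuous_on)
next
  case (Suc k)
  then show ?case by simp
qed

lemma partial_deriv_eqI: "(f has_derivative f') (at x) \<Longrightarrow> partial_deriv b f x = f' b"
  unfolding partial_deriv_def by (simp add: frechet_derivative_at[symmetric])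

text \<open>The class \<open>C_k\<close> is defined through iterated partial derivatives, so closure under sums and products
  has to be derived; with constants and coordinates it covers all derivatives of bracket powers.\<close>

lemma C_k_add: "C_k k f \<Longrightarrow> C_k k g \<Longrightarrow> C_k k (\<lambda>x. f x + g x)"
proof (induction k arbitrary: f g)
  case (Suc k)
  then have d: "(f has_derivative frechet_derivative f (at x)) (at x)"
    "(g has_derivative frechet_derivative g (at x)) (at x)" for x
    by (auto simp: differentiable_on_def frechet_derivative_works)
  have "partial_deriv b (\<lambda>x. f x + g x) = (\<lambda>x. partial_deriv b f x + partial_deriv b g x)" for b
    using partial_deriv_eqI[OF has_derivative_add[OF d]] by (auto simp: partial_deriv_def)
  with Suc show ?case by (auto intro: differentiable_on_add)
qed (auto intro: continuous_intros)

lemma C_k_mult: "C_k k f \<Longrightarrow> C_k k g \<Longrightarrow> C_k k (\<lambda>x. f x * g x)"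
proof (induction k arbitrary: f g)
  case (Suc k)
  then have d: "(f has_derivative frechet_derivative f (at x)) (at x)"
    "(g has_derivative frechet_derivative g (at x)) (at x)" for x
    by (auto simp: differentiable_on_def frechet_derivative_works)
  have "partial_deriv b (\<lambda>x. f x * g x) = (\<lambda>x. f x * partial_deriv b g x + partial_deriv b f x * g x)" for b
    using partial_deriv_eqI[OF has_derivative_mult[OF d]] by (auto simp: partial_deriv_def)
  with Suc.IH Suc.prems C_k_Suc_imp[OF Suc.prems(1)] C_k_Suc_imp[OF Suc.prems(2)] show ?case
    by (auto intro!: differentiable_on_mult C_k_add)
qed (auto intro: continuous_intros)

lemma C_k_const: "C_k k (\<lambda>x::'a::euclidean_space. c)"
proof (induction k arbitrary: c)
  case (Suc k)
  have "partial_deriv b (\<lambda>x. c) = (\<lambda>x. 0)" for b :: 'a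
    by (auto intro!: partial_deriv_eqI derivative_eq_intros)
  with Suc show ?case by auto
qed auto

lemma C_k_inner: "C_k k (\<lambda>x::'a::euclidean_space. x \<bullet> b)"
proof (cases k)
  case (Suc k)
  have "partial_deriv b' (\<lambda>x. x \<bullet> b) = (\<lambda>x. b' \<bullet> b)" for b' :: 'a
    by (auto intro!: partial_deriv_eqI derivative_eq_intros)
  moreover have "(\<lambda>x. x \<bullet> b) differentiable_on UNIV"
  proof -
    have "((\<lambda>x::'a. x \<bullet> b) has_derivative (\<lambda>h. h \<bullet> b)) (at x)" for x
      by (auto intro!: derivative_eq_intros)
    then show ?thesis by (auto simp: differentiable_on_def differentiable_def)
  qed
  ultimately show ?thesis using Suc by (simp add: C_k_const)
qed (auto intro: continuous_intros)

lemma bracket_nonneg: "bracket_power r \<mu> x \<ge> 0"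
  by (simp add: bracket_power_def)

context
  fixes \<mu> :: real assumes \<mu>: "\<mu> > 0"
begin

lemma bracket_base_pos: "1 + (norm x)\<^sup>2 / (4 * \<mu>) > 0"
  using \<mu> by (intro add_pos_nonneg) auto

lemma has_derivative_bracket:
  fixes x :: "'a::euclidean_space"
  shows "(bracket_power r \<mu> has_derivative (\<lambda>h. r / (2 * \<mu>) * (x \<bullet> h) * bracket_power (r - 1) \<mu> x)) (at x)"
proof -
  have "((\<lambda>x::'a. (1 + (x \<bullet> x) / (4 * \<mu>)) powr r) has_derivative
     (\<lambda>h. (1 + (x \<bullet> x) / (4 * \<mu>)) powr r * (0 * ln (1 + (x \<bullet> x) / (4 * \<mu>)) + (2 * (x \<bullet> h) / (4 * \<mu>))
       * r / (1 + (x \<bullet> x) / (4 * \<mu>))))) (at x)"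
    using bracket_base_pos[of x] \<mu> by (auto intro!: derivative_eq_intros simp: dot_square_norm
      inner_commute)
  moreover have "(1 + (x \<bullet> x) / (4 * \<mu>)) powr r
    * (0 * ln (1 + (x \<bullet> x) / (4 * \<mu>)) + (2 * (x \<bullet> h) / (4 * \<mu>)) * r / (1 + (x \<bullet> x) / (4 * \<mu>)))
     = r / (2 * \<mu>) * (x \<bullet> h) * bracket_power (r - 1) \<mu> x" for h
    using bracket_base_pos[of x] by (simp add: bracket_power_def dot_square_norm powr_diff)
  ultimately show ?thesis by (simp add: bracket_power_def[abs_def] dot_square_norm)
qed

lemma partial_deriv_bracket: "partial_deriv b (bracket_power r \<mu>)
  = (\<lambda>x. r / (2 * \<mu>) * (x \<bullet> b) * bracket_power (r - 1) \<mu> x)"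
  by (intro ext partial_deriv_eqI has_derivative_bracket)

lemma smooth_bracket: "smooth (bracket_power r \<mu> :: 'a::euclidean_space \<Rightarrow> real)"
proof -
  have "C_k k (bracket_power r \<mu> :: 'a \<Rightarrow> real)" for k
  proof (induction k arbitrary: r)
    case 0
    then show ?case
      using has_derivative_continuous[OF has_derivative_bracket]
        by (auto simp: continuous_on_eq_continuous_within)
  next
    case (Suc k)
    show ?case
      unfolding C_k.simps partial_deriv_bracket
    proof (intro conjI ballI C_k_mult C_k_const C_k_inner Suc.IH)
      show "bracket_power r \<mu> differentiable_on (UNIV :: 'a set)"
        unfolding differentiable_on_def differentiable_def using has_derivative_bracket by blast
    qed
  qed
  then show ?thesis by (simp add: smooth_def)
qed

lemma bracket_pos: "bracket_power r \<mu> x > 0"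
  using bracket_base_pos[of x] by (simp add: bracket_power_def)

lemma bracket_mono: "r \<le> s \<Longrightarrow> bracket_power r \<mu> x \<le> bracket_power s \<mu> x"
  unfolding bracket_power_def using \<mu> by (intro powr_mono) auto

lemma bracket_le_1: "r \<le> 0 \<Longrightarrow> bracket_power r \<mu> x \<le> 1"
  using bracket_mono[of r 0 x] bracket_base_pos[of x] by (simp add: bracket_power_def)

text \<open>The terms with \<open>(x \<bullet> b)\<^sup>2\<close> add up to \<open>\<bar>x\<bar>\<^sup>2\<close>, which is absorbed by \<open>\<bar>x\<bar>\<^sup>2 = 4\<mu> * (w - 1)\<close> for
  \<open>w = 1 + \<bar>x\<bar>\<^sup>2/(4\<mu>)\<close>. So the Laplacian stays within the span of the bracket powers and can be iterated.\<close>

lemma laplacian_bracket: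
  "laplacian (bracket_power r \<mu> :: 'a::euclidean_space \<Rightarrow> real) =
    (\<lambda>x. (r * (real DIM('a) / 2 + (r - 1)) / \<mu>) * bracket_power (r - 1) \<mu> x + (- (r * (r - 1) / \<mu>))
      * bracket_power (r - 2) \<mu> x)"
proof
  fix x :: 'a
  define W1 W2 where "W1 = bracket_power (r - 1) \<mu> x" and "W2 = bracket_power (r - 2) \<mu> x"
  have sq: "(norm x)\<^sup>2 * W2 = 4 * \<mu> * (W1 - W2)"
  proof -
    have "W1 = (1 + (norm x)\<^sup>2 / (4 * \<mu>)) powr (1 + (r - 2))" by (simp add: W1_def bracket_power_def)
    also have "\<dots> = (1 + (norm x)\<^sup>2 / (4 * \<mu>)) * W2"
      using bracket_base_pos[of x] by (subst powr_add) (simp add: W2_def bracket_power_def)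
    finally show ?thesis using \<mu> by (simp add: field_simps)
  qed
  have pd: "partial_deriv b (partial_deriv b (bracket_power r \<mu>)) x =
      r / (2 * \<mu>) * W1 + (r / (2 * \<mu>)) * ((r - 1) / (2 * \<mu>) * W2) * (x \<bullet> b)\<^sup>2" if b: "b \<in> Basis" for b
  proof -
    have "((\<lambda>x. r / (2 * \<mu>) * (x \<bullet> b) * bracket_power (r - 1) \<mu> x) has_derivative
       (\<lambda>h. r / (2 * \<mu>) * (x \<bullet> b) * ((r - 1) / (2 * \<mu>) * (x \<bullet> h) * bracket_power (r - 1 - 1) \<mu> x)
         + (r / (2 * \<mu>) * (h \<bullet> b)) * bracket_power (r - 1) \<mu> x)) (at x)"
      by (intro has_derivative_mult has_derivative_bracket has_derivative_mult_right
        has_derivative_inner_left has_derivative_ident)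
    then have "partial_deriv b (partial_deriv b (bracket_power r \<mu>)) x =
       r / (2 * \<mu>) * (x \<bullet> b) * ((r - 1) / (2 * \<mu>) * (x \<bullet> b) * bracket_power (r - 1 - 1) \<mu> x)
         + (r / (2 * \<mu>) * (b \<bullet> b)) * bracket_power (r - 1) \<mu> x"
      unfolding partial_deriv_bracket by (rule partial_deriv_eqI)
    then show ?thesis using b by (simp add: W1_def W2_def power2_eq_square mult_ac)
  qed
  have norm_sum: "(\<Sum>b\<in>Basis. (x \<bullet> b)\<^sup>2) = (norm x)\<^sup>2"
    by (simp add: norm_eq_sqrt_inner euclidean_inner[of x x] power2_eq_square sum_nonneg)
  have "laplacian (bracket_power r \<mu>) x = real DIM('a) * (r / (2 * \<mu>) * W1) + (r / (2 * \<mu>))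
    * ((r - 1) / (2 * \<mu>) * W2) * (norm x)\<^sup>2"
    unfolding laplacian_def norm_sum[symmetric] sum_distrib_left
      by (simp add: pd sum.distrib del: times_divide_eq_right times_divide_eq_left)
  also have "(r / (2 * \<mu>)) * ((r - 1) / (2 * \<mu>) * W2) * (norm x)\<^sup>2 = (r / (2 * \<mu>))
    * ((r - 1) / (2 * \<mu>)) * ((norm x)\<^sup>2 * W2)"
    by (simp add: mult_ac)
  also have "real DIM('a) * (r / (2 * \<mu>) * W1) + \<dots> =
     (r * (real DIM('a) / 2 + (r - 1)) / \<mu>) * W1 + (- (r * (r - 1) / \<mu>)) * W2"
    unfolding sq using \<mu> by (simp add: field_simps)
  finally show "laplacian (bracket_power r \<mu>) x = (r * (real DIM('a) / 2 + (r - 1)) / \<mu>)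
    * bracket_power (r - 1) \<mu> x + (- (r * (r - 1) / \<mu>)) * bracket_power (r - 2) \<mu> x"
    by (simp add: W1_def W2_def)
qed

lemma laplacian_lincomb_bracket:
  "laplacian (\<lambda>x. a * bracket_power r \<mu> x + b * bracket_power s \<mu> x) y = a
    * laplacian (bracket_power r \<mu>) y + b * laplacian (bracket_power s \<mu>) (y::'a::euclidean_space)"
proof -
  have 1: "partial_deriv e (\<lambda>x. a * bracket_power r \<mu> x + b * bracket_power s \<mu> x)
    = (\<lambda>x. a * partial_deriv e (bracket_power r \<mu>) x + b * partial_deriv e (bracket_power s \<mu>) x)"
    for e :: 'a
    unfolding partial_deriv_bracket
    by (intro ext partial_deriv_eqI has_derivative_add has_derivative_mult_right has_derivative_bracket)
  have sm: "partial_deriv e (bracket_power r \<mu>) differentiable (at y)" if "e \<in> Basis" for e r and y :: 'a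
  proof -
    have "C_k (Suc (Suc 0)) (bracket_power r \<mu> :: 'a \<Rightarrow> real)" using smooth_bracket
      by (auto simp: smooth_def simp del: C_k.simps)
    then show ?thesis using that by (auto simp: differentiable_on_def)
  qed
  have 2: "partial_deriv e (\<lambda>x. a * partial_deriv e (bracket_power r \<mu>) x + b
    * partial_deriv e (bracket_power s \<mu>) x) y
      = a * partial_deriv e (partial_deriv e (bracket_power r \<mu>)) y + b
        * partial_deriv e (partial_deriv e (bracket_power s \<mu>)) y" if e: "e \<in> Basis" for e :: 'a
    unfolding partial_deriv_def[of e "partial_deriv e (bracket_power r \<mu>)"]
      partial_deriv_def[of e "partial_deriv e (bracket_power s \<mu>)"]
    using sm[OF e] by (intro partial_deriv_eqI has_derivative_add has_derivative_mult_right)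
      (auto simp: frechet_derivative_works)
  show ?thesis unfolding laplacian_def by (simp add: 1 2 sum.distrib sum_distrib_left)
qed

end

lemma laplacian_bracket_bound:
  "\<exists>C\<ge>0. \<forall>\<mu>>0. \<forall>x::'a::euclidean_space. \<bar>laplacian (bracket_power r \<mu>) x\<bar> \<le> C * \<mu> powr (-1)
    * bracket_power (r - 1) \<mu> x"
proof (intro exI[of _ "\<bar>r * (real DIM('a) / 2 + (r - 1))\<bar> + \<bar>r * (r - 1)\<bar>"] conjI allI impI)
  fix \<mu> :: real and x :: 'a assume \<mu>: "\<mu> > 0"
  define c1 c2 where "c1 = r * (real DIM('a) / 2 + (r - 1))" and "c2 = r * (r - 1)"
  have p: "bracket_power (r - 1) \<mu> x > 0" "bracket_power (r - 2) \<mu> x > 0" "bracket_power (r - 2) \<mu> x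
    \<le> bracket_power (r - 1) \<mu> x"
    by (auto intro!: bracket_pos bracket_mono \<mu>)
  have "\<bar>laplacian (bracket_power r \<mu>) x\<bar> \<le> \<bar>c1 / \<mu> * bracket_power (r - 1) \<mu> x\<bar> + \<bar>(- (c2 / \<mu>))
    * bracket_power (r - 2) \<mu> x\<bar>"
    unfolding laplacian_bracket[OF \<mu>] c1_def c2_def by (rule abs_triangle_ineq)
  also have "\<dots> = \<bar>c1\<bar> / \<mu> * bracket_power (r - 1) \<mu> x + \<bar>c2\<bar> / \<mu> * bracket_power (r - 2) \<mu> x"
    using p \<mu> by (simp add: abs_mult)
  also have "\<dots> \<le> \<bar>c1\<bar> / \<mu> * bracket_power (r - 1) \<mu> x + \<bar>c2\<bar> / \<mu> * bracket_power (r - 1) \<mu> x"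
    using p \<mu> by (intro add_left_mono mult_left_mono) auto
  also have "\<dots> = (\<bar>c1\<bar> + \<bar>c2\<bar>) * \<mu> powr (-1) * bracket_power (r - 1) \<mu> x"
    using \<mu> by (simp add: powr_minus_divide field_simps)
  finally show "\<bar>laplacian (bracket_power r \<mu>) x\<bar>
    \<le> (\<bar>r * (real DIM('a) / 2 + (r - 1))\<bar> + \<bar>r * (r - 1)\<bar>) * \<mu> powr (-1) * bracket_power (r - 1) \<mu> x"
    by (simp add: c1_def c2_def)
qed auto

lemma bilaplacian_bracket_bound:
  "\<exists>C\<ge>0. \<forall>\<mu>>0. \<forall>x::'a::euclidean_space. \<bar>laplacian (laplacian (bracket_power r \<mu>)) x\<bar> \<le> C
    * \<mu> powr (-2) * bracket_power r \<mu> x"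
proof -
  define c1 c2 where "c1 = r * (real DIM('a) / 2 + (r - 1))" and "c2 = r * (r - 1)"
  obtain A B where A: "A \<ge> 0" "\<And>\<mu> (x::'a). \<mu> > 0 \<Longrightarrow> \<bar>laplacian (bracket_power (r - 1) \<mu>) x\<bar> \<le> A
    * \<mu> powr (-1) * bracket_power (r - 1 - 1) \<mu> x"
    and B: "B \<ge> 0" "\<And>\<mu> (x::'a). \<mu> > 0 \<Longrightarrow> \<bar>laplacian (bracket_power (r - 2) \<mu>) x\<bar> \<le> B * \<mu> powr (-1)
      * bracket_power (r - 2 - 1) \<mu> x"
    using laplacian_bracket_bound[of "r - 1", where 'a='a]
      laplacian_bracket_bound[of "r - 2", where 'a='a] by blast
  show ?thesis
  proof (intro exI[of _ "\<bar>c1\<bar> * A + \<bar>c2\<bar> * B"] conjI allI impI)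
    fix \<mu> :: real and x :: 'a assume \<mu>: "\<mu> > 0"
    have p: "bracket_power r \<mu> x > 0" by (auto intro!: bracket_pos \<mu>)
    have m: "\<mu> powr (-1) = 1 / \<mu>" "\<mu> powr (-2) = 1 / \<mu> * (1 / \<mu>)"
      using \<mu> by (simp_all add: powr_minus_divide powr_numeral power2_eq_square)
    have a: "\<bar>laplacian (bracket_power (r - 1) \<mu>) x\<bar> \<le> A * \<mu> powr (-1) * bracket_power r \<mu> x"
      using bracket_mono[OF \<mu>, of "r - 1 - 1" r x] A(1)
        by (intro order.trans[OF A(2)[OF \<mu>]] mult_left_mono) auto
    have b: "\<bar>laplacian (bracket_power (r - 2) \<mu>) x\<bar> \<le> B * \<mu> powr (-1) * bracket_power r \<mu> x"
      using bracket_mono[OF \<mu>, of "r - 2 - 1" r x] B(1)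
        by (intro order.trans[OF B(2)[OF \<mu>]] mult_left_mono) auto
    have "\<bar>laplacian (laplacian (bracket_power r \<mu>)) x\<bar> \<le> \<bar>c1 / \<mu>
      * laplacian (bracket_power (r - 1) \<mu>) x\<bar> + \<bar>(- (c2 / \<mu>)) * laplacian (bracket_power (r - 2) \<mu>) x\<bar>"
      unfolding laplacian_bracket[OF \<mu>, of r] laplacian_lincomb_bracket[OF \<mu>] c1_def c2_def
        by (rule abs_triangle_ineq)
    also have "\<dots> = \<bar>c1\<bar> / \<mu> * \<bar>laplacian (bracket_power (r - 1) \<mu>) x\<bar> + \<bar>c2\<bar> / \<mu>
      * \<bar>laplacian (bracket_power (r - 2) \<mu>) x\<bar>"
      using \<mu> by (simp add: abs_mult)
    also have "\<dots> \<le> \<bar>c1\<bar> / \<mu> * (A * \<mu> powr (-1) * bracket_power r \<mu> x) + \<bar>c2\<bar> / \<mu>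
      * (B * \<mu> powr (-1) * bracket_power r \<mu> x)"
      using \<mu> a b by (intro add_mono mult_left_mono) auto
    also have "\<dots> = (\<bar>c1\<bar> * A + \<bar>c2\<bar> * B) * \<mu> powr (-2) * bracket_power r \<mu> x"
      unfolding m by (simp add: algebra_simps)
    finally show "\<bar>laplacian (laplacian (bracket_power r \<mu>)) x\<bar> \<le> (\<bar>c1\<bar> * A + \<bar>c2\<bar> * B)
      * \<mu> powr (-2) * bracket_power r \<mu> x" .
  qed (use A B in auto)
qed

lemma japanese_bracket_bound:
  fixes x :: "'a::euclidean_space"
  assumes \<mu>: "\<mu> > 0" and r: "0 \<le> q" "q / 2 \<le> r"
  shows "japanese_bracket x powr q * bracket_power (- r) \<mu> x \<le> (1 + 4 * \<mu>) powr (q / 2)"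
proof -
  define z where "z = (norm x)\<^sup>2"
  have z: "z \<ge> 0" by (simp add: z_def)
  have w: "1 + z / (4 * \<mu>) > 0" using z \<mu> by (intro add_pos_nonneg) auto
  have "japanese_bracket x powr q = (1 + z) powr (q / 2)"
    using z by (simp add: japanese_bracket_def z_def powr_half_sqrt[symmetric] powr_powr)
  moreover have "bracket_power (- r) \<mu> x \<le> (1 + z / (4 * \<mu>)) powr (- (q / 2))"
    unfolding bracket_power_def z_def using \<mu> r by (intro powr_mono) auto
  ultimately have "japanese_bracket x powr q * bracket_power (- r) \<mu> x \<le> (1 + z) powr (q / 2)
    * (1 + z / (4 * \<mu>)) powr (- (q / 2))"
    by (simp add: mult_left_mono)
  also have "\<dots> = ((1 + z) / (1 + z / (4 * \<mu>))) powr (q / 2)"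
    using z w by (simp add: powr_divide powr_minus_divide)
  also have "\<dots> \<le> (1 + 4 * \<mu>) powr (q / 2)"
  proof (intro powr_mono2)
    have "(1 + 4 * \<mu>) * (1 + z / (4 * \<mu>)) = 1 + z + (4 * \<mu> + z / (4 * \<mu>))" using \<mu>
      by (simp add: field_simps)
    moreover have "\<dots> \<ge> 1 + z" using \<mu> z by simp
    ultimately show "(1 + z) / (1 + z / (4 * \<mu>)) \<le> 1 + 4 * \<mu>"
      using w by (simp add: pos_divide_le_eq)
  qed (use z w r in auto)
  finally show ?thesis .
qed

text \<open>Every \<open>\<sigma>\<close> that occurs in the definition of the test class satisfies \<open>\<sigma> \<ge> \<theta>\<close>, so \<open>(-\<Delta>)\<^sup>\<sigma> \<phi>\<close>, with tail
  \<open>\<bar>x\<bar> powr (-n - 2\<sigma>)\<close>, decays fast enough.\<close>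

lemma bracket_test_function:
  fixes \<theta> \<beta> :: real
  assumes \<theta>: "0 \<le> \<theta>" "\<theta> < 1" and \<beta>: "\<beta> > 0" "\<theta> \<le> \<beta>" and \<mu>: "\<mu> > 0"
  shows "(bracket_power (- (real DIM('a) / 2 + \<beta>)) \<mu> :: 'a::euclidean_space \<Rightarrow> real) \<in> test_functions \<theta>"
proof -
  define d where "d = real DIM('a) / 2"
  have d: "d \<ge> 0" by (simp add: d_def)
  define q where "q = decay_exponent TYPE('a) \<theta>"
  have q: "q / 2 = d + \<theta>" by (simp add: q_def decay_exponent_def d_def)
  have q0: "0 \<le> q" using \<theta> by (simp add: q_def decay_exponent_def)
  have bd: "bounded (range (\<lambda>x::'a. japanese_bracket x powr q * g x))"
    if g: "\<And>x. \<bar>g x\<bar> \<le> K * bracket_power (- r) \<mu> x" and K: "K \<ge> 0" and r: "d + \<theta> \<le> r" for g K r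
  proof (rule boundedI)
    fix y assume "y \<in> range (\<lambda>x::'a. japanese_bracket x powr q * g x)"
    then obtain x :: 'a where y: "y = japanese_bracket x powr q * g x" by auto
    have "norm y = japanese_bracket x powr q * \<bar>g x\<bar>" by (simp add: y abs_mult)
    also have "\<dots> \<le> japanese_bracket x powr q * (K * bracket_power (- r) \<mu> x)"
      by (intro mult_left_mono g) simp
    also have "\<dots> = K * (japanese_bracket x powr q * bracket_power (- r) \<mu> x)" by simp
    also have "\<dots> \<le> K * (1 + 4 * \<mu>) powr (q / 2)"
      using r by (intro mult_left_mono japanese_bracket_bound \<mu> q0 K) (simp add: q)
    finally show "norm y \<le> K * (1 + 4 * \<mu>) powr (q / 2)" .
  qed
  have frac: "\<exists>g. has_frac_laplacian \<sigma> (bracket_power (- (d + \<beta>)) \<mu> :: 'a \<Rightarrow> real) g \<and>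
      bounded (range (\<lambda>x. japanese_bracket x powr q * g x))"
    if \<sigma>: "\<sigma> > 0" "\<sigma> \<in> \<int> \<or> \<sigma> - of_int \<lfloor>\<sigma>\<rfloor> \<in> {\<theta>..<1}" for \<sigma>
  proof -
    have "\<theta> \<le> \<sigma>"
    proof (cases "\<sigma> \<in> \<int>")
      case True
      then obtain k where "\<sigma> = of_int k" by (auto elim: Ints_cases)
      with \<sigma>(1) have "\<sigma> \<ge> 1" by simp
      then show ?thesis using \<theta> by simp
    next
      case False
      with \<sigma> have "\<theta> \<le> \<sigma> - of_int \<lfloor>\<sigma>\<rfloor>" "0 \<le> \<lfloor>\<sigma>\<rfloor>" by auto
      then show ?thesis by (smt (verit) of_int_0_le_iff)
    qed
    moreover obtain C g where "C \<ge> 0" "has_frac_laplacian \<sigma> (bracket_power (- (d + \<beta>)) \<mu> :: 'a \<Rightarrow> real) g"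
      "\<And>x. \<bar>g x\<bar> \<le> C * \<mu> powr (- \<sigma>) * bracket_power (- (d + \<sigma>)) \<mu> x"
      using frac_laplacian_bracket[OF \<beta>(1) \<sigma>(1), where 'a='a] \<mu> unfolding d_def by blast
    ultimately show ?thesis using bd[of g "C * \<mu> powr (- \<sigma>)" "d + \<sigma>"] by auto
  qed
  have "bounded (range (\<lambda>x::'a. japanese_bracket x powr q * bracket_power (- (d + \<beta>)) \<mu> x))"
    using \<beta> by (intro bd[of _ 1 "d + \<beta>"]) (auto simp: bracket_nonneg)
  then show ?thesis
    using frac smooth_bracket[OF \<mu>] by (simp add: test_functions_def Let_def flip: q_def d_def)
qed

lemma bracket_eq_heat_mix:
  assumes "\<beta> > 0" "\<mu> > 0"
  shows "bracket_power (- (real DIM('a) / 2 + \<beta>)) \<mu>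
    = (heat_mix (bracket_density (real DIM('a) / 2) \<beta> \<mu>) 0 :: 'a::euclidean_space \<Rightarrow> real)"
  by (rule ext, rule heat_mix_bracket[OF assms refl, symmetric])

text \<open>The integral of a mixture is its Fourier transform at 0, which is the integral of the density.\<close>

lemma nn_integral_bracket:
  assumes \<beta>: "\<beta> > 0" and \<mu>: "\<mu> > 0"
  shows "(\<integral>\<^sup>+ x. ennreal (bracket_power (- (real DIM('a) / 2 + \<beta>)) \<mu> (x::'a::euclidean_space)) \<partial>lborel)
    = ennreal ((4 * pi) powr (real DIM('a) / 2) * Gamma \<beta> / Gamma (real DIM('a) / 2 + \<beta>)
      * \<mu> powr (real DIM('a) / 2))"
proof -
  define d where "d = real DIM('a) / 2"
  have d: "d \<ge> 0" by (simp add: d_def)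
  interpret heat_density "bracket_density d \<beta> \<mu>" 0 \<beta> \<mu> "bracket_const d \<beta> \<mu>"
    by (rule heat_density_bracket[OF d \<beta> \<mu>])
  have eq: "bracket_power (- (d + \<beta>)) \<mu> = (heat_mix (bracket_density d \<beta> \<mu>) 0 :: 'a \<Rightarrow> real)"
    unfolding d_def by (rule bracket_eq_heat_mix[OF \<beta> \<mu>])
  have "(\<integral>\<^sup>+ x. ennreal (bracket_power (- (d + \<beta>)) \<mu> (x::'a)) \<partial>lborel)
    = ennreal (LINT x|lborel. bracket_power (- (d + \<beta>)) \<mu> (x::'a))"
    using heat_mix_integrable[where 'a='a, folded eq]
      by (intro nn_integral_eq_integral) (auto simp: bracket_nonneg)
  also have "(LINT x|lborel. bracket_power (- (d + \<beta>)) \<mu> (x::'a))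
    = laplace_mix (bracket_density d \<beta> \<mu>) 0 (0::'a)"
  proof -
    have "complex_of_real (LINT x|lborel. bracket_power (- (d + \<beta>)) \<mu> (x::'a))
      = complex_of_real (laplace_mix (bracket_density d \<beta> \<mu>) 0 (0::'a))"
      unfolding fourier_heat_mix[symmetric] fourier_L1_def eq by simp
    then show ?thesis by (simp only: of_real_eq_iff)
  qed
  also have "\<dots> = (LINT b|lborel. indicator {0<..} b * bracket_density d \<beta> \<mu> b)"
    by (simp add: laplace_mix_def set_lebesgue_integral_def)
  also have "\<dots> = enn2real (\<integral>\<^sup>+ b. ennreal (bracket_const d \<beta> \<mu>)
    * (ennreal (b powr (- 1 - \<beta>) * exp (- (\<mu> / b))) * indicator {0<..} b) \<partial>lborel)"
  proof (subst integral_eq_nn_integral)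
    show "AE b in lborel. 0 \<le> indicator {0<..} b * bracket_density d \<beta> \<mu> b"
      using bracket_const_nonneg[OF d \<beta>] by (auto simp: bracket_density_def)
    show "enn2real (\<integral>\<^sup>+ b. ennreal (indicator {0<..} b * bracket_density d \<beta> \<mu> b) \<partial>lborel)
      = enn2real (\<integral>\<^sup>+ b. ennreal (bracket_const d \<beta> \<mu>)
        * (ennreal (b powr (- 1 - \<beta>) * exp (- (\<mu> / b))) * indicator {0<..} b) \<partial>lborel)"
      using bracket_const_nonneg[OF d \<beta>]
      by (intro arg_cong[of _ _ enn2real] nn_integral_cong)
        (auto simp: bracket_density_def indicator_def mult.assoc simp flip: ennreal_mult')
  qed simp
  also have "\<dots> = bracket_const d \<beta> \<mu> * (Gamma \<beta> * \<mu> powr (- \<beta>))"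
    using bracket_const_nonneg[OF d \<beta>] Gamma_real_pos[OF \<beta>]
    by (subst nn_integral_cmult) (auto simp: nn_integral_inverse_gamma \<beta> \<mu> enn2real_mult less_imp_le)
  also have "\<dots> = (4 * pi) powr d * Gamma \<beta> / Gamma (d + \<beta>) * \<mu> powr d"
    using \<mu> by (simp add: bracket_const_def powr_add powr_minus_divide)
  finally show ?thesis by (simp add: d_def)
qed

lemma bracket_meas [measurable]: "bracket_power r \<mu> \<in> borel_measurable borel"
  unfolding bracket_power_def[abs_def] by measurable

text \<open>The test functions with all bounds that enter the energy estimate. Each is relative to \<open>\<phi>\<close> itself,
  with the power of \<open>\<mu>\<close> that scaling predicts.\<close>

lemma test_function_family:
  fixes \<theta> :: real
  assumes \<theta>: "0 \<le> \<theta>" "\<theta> < 1"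
  shows "\<exists>\<kappa>>0. \<exists>C\<ge>0. \<forall>\<mu>>0.
    (bracket_power (- \<kappa>) \<mu> :: 'a::euclidean_space \<Rightarrow> real) \<in> test_functions \<theta> \<and>
    (\<exists>g. has_frac_laplacian \<theta> (bracket_power (- \<kappa>) \<mu> :: 'a \<Rightarrow> real) g \<and>
        (\<forall>x. \<bar>g x\<bar> \<le> C * \<mu> powr (- \<theta>) * bracket_power (- \<kappa>) \<mu> x)) \<and>
    (\<forall>x::'a. \<bar>laplacian (bracket_power (- \<kappa>) \<mu>) x\<bar> \<le> C * \<mu> powr (-1) * bracket_power (- \<kappa>) \<mu> x) \<and>
    (\<forall>x::'a. \<bar>laplacian (laplacian (bracket_power (- \<kappa>) \<mu>)) x\<bar> \<le> C * \<mu> powr (-2)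
      * bracket_power (- \<kappa>) \<mu> x) \<and>
    (\<integral>\<^sup>+ x. ennreal (bracket_power (- \<kappa>) \<mu> (x::'a)) \<partial>lborel) \<le> ennreal (C * \<mu> powr (real DIM('a) / 2))"
proof -
  \<comment> \<open>For \<open>\<theta> = 0\<close> the operator \<open>(-\<Delta>)\<^sup>\<theta>\<close> is the identity and any \<open>\<beta> > 0\<close> works.
    The value \<open>\<beta> = 0\<close> would give a test function that is not integrable.\<close>
  define \<beta> where "\<beta> = (if \<theta> = 0 then 1 else \<theta>)"
  have \<beta>: "\<beta> > 0" "\<theta> \<le> \<beta>" using \<theta> by (auto simp: \<beta>_def)
  define d where "d = real DIM('a) / 2"
  define \<kappa> where "\<kappa> = d + \<beta>"
  have \<kappa>: "\<kappa> > 0" using \<beta> by (simp add: \<kappa>_def d_def add_nonneg_pos)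
  obtain C1 where C1: "C1 \<ge> 0" "\<And>\<mu> (x::'a). \<mu> > 0 \<Longrightarrow> \<bar>laplacian (bracket_power (- \<kappa>) \<mu>) x\<bar> \<le> C1
    * \<mu> powr (-1) * bracket_power (- \<kappa> - 1) \<mu> x"
    using laplacian_bracket_bound[of "- \<kappa>", where 'a='a] by blast
  obtain C2 where C2: "C2 \<ge> 0" "\<And>\<mu> (x::'a). \<mu> > 0
    \<Longrightarrow> \<bar>laplacian (laplacian (bracket_power (- \<kappa>) \<mu>)) x\<bar> \<le> C2 * \<mu> powr (-2) * bracket_power (- \<kappa>) \<mu> x"
    using bilaplacian_bracket_bound[of "- \<kappa>", where 'a='a] by blast
  have "\<exists>C\<ge>0. \<forall>\<mu>>0. \<exists>g. has_frac_laplacian \<theta> (bracket_power (- \<kappa>) \<mu> :: 'a \<Rightarrow> real) g \<and>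
        (\<forall>x. \<bar>g x\<bar> \<le> C * \<mu> powr (- \<theta>) * bracket_power (- \<kappa>) \<mu> x)"
  proof (cases "\<theta> = 0")
    case True
    then show ?thesis
      by (intro exI[of _ 1]) (auto simp: has_frac_laplacian_def bracket_nonneg)
  next
    case False
    then show ?thesis
      using frac_laplacian_bracket[OF \<beta>(1), of \<theta>, where 'a='a] \<theta> by (simp add: \<beta>_def \<kappa>_def d_def)
  qed
  then obtain C3 where C3: "C3 \<ge> 0" "\<And>\<mu>. \<mu> > 0
    \<Longrightarrow> \<exists>g. has_frac_laplacian \<theta> (bracket_power (- \<kappa>) \<mu> :: 'a \<Rightarrow> real) g \<and>
        (\<forall>x. \<bar>g x\<bar> \<le> C3 * \<mu> powr (- \<theta>) * bracket_power (- \<kappa>) \<mu> x)" by blast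
  define C4 where "C4 = (4 * pi) powr d * Gamma \<beta> / Gamma \<kappa>"
  have C4: "C4 \<ge> 0" using \<beta> \<kappa> by (auto simp: C4_def intro!: divide_nonneg_nonneg mult_nonneg_nonneg
    less_imp_le[OF Gamma_real_pos])
  define C where "C = C1 + C2 + C3 + C4"
  have C: "C \<ge> 0" "C1 \<le> C" "C2 \<le> C" "C3 \<le> C" "C4 \<le> C" using C1 C2 C3 C4 by (auto simp: C_def)
  show ?thesis
  proof (rule exI[of _ \<kappa>], rule conjI[OF \<kappa>], rule exI[of _ C], intro conjI allI impI)
    fix \<mu> :: real assume \<mu>: "\<mu> > 0"
    have p: "bracket_power (- \<kappa>) \<mu> x > 0" for x :: 'a by (rule bracket_pos[OF \<mu>])
    show "(bracket_power (- \<kappa>) \<mu> :: 'a \<Rightarrow> real) \<in> test_functions \<theta>"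
      unfolding \<kappa>_def d_def by (rule bracket_test_function[OF \<theta> \<beta> \<mu>])
    obtain g where g: "has_frac_laplacian \<theta> (bracket_power (- \<kappa>) \<mu> :: 'a \<Rightarrow> real) g"
        "\<And>x. \<bar>g x\<bar> \<le> C3 * \<mu> powr (- \<theta>) * bracket_power (- \<kappa>) \<mu> x" using C3(2)[OF \<mu>] by blast
    have "C3 * \<mu> powr (- \<theta>) * bracket_power (- \<kappa>) \<mu> x \<le> C * \<mu> powr (- \<theta>) * bracket_power (- \<kappa>) \<mu> x"
      for x :: 'a
      using p[of x] C by (intro mult_right_mono) auto
    with g show "\<exists>g. has_frac_laplacian \<theta> (bracket_power (- \<kappa>) \<mu> :: 'a \<Rightarrow> real) g \<and>
        (\<forall>x. \<bar>g x\<bar> \<le> C * \<mu> powr (- \<theta>) * bracket_power (- \<kappa>) \<mu> x)" by (meson order.trans)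
    show "(\<integral>\<^sup>+ x. ennreal (bracket_power (- \<kappa>) \<mu> (x::'a)) \<partial>lborel)
      \<le> ennreal (C * \<mu> powr (real DIM('a) / 2))"
      using nn_integral_bracket[OF \<beta>(1) \<mu>, where 'a='a, folded d_def, folded \<kappa>_def, folded C4_def] C
      by (auto simp: d_def intro!: ennreal_leI mult_right_mono)
  next
    fix \<mu> :: real and x :: 'a assume \<mu>: "\<mu> > 0"
    have p: "bracket_power (- \<kappa>) \<mu> x > 0" by (rule bracket_pos[OF \<mu>])
    have "\<bar>laplacian (bracket_power (- \<kappa>) \<mu>) x\<bar> \<le> C1 * \<mu> powr (-1) * bracket_power (- \<kappa> - 1) \<mu> x"
      by (rule C1(2)[OF \<mu>])
    also have "\<dots> \<le> C * \<mu> powr (-1) * bracket_power (- \<kappa>) \<mu> x"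
      using C C1 bracket_pos[OF \<mu>, of "- \<kappa> - 1" x] by (intro mult_mono bracket_mono[OF \<mu>]) auto
    finally show "\<bar>laplacian (bracket_power (- \<kappa>) \<mu>) x\<bar> \<le> C * \<mu> powr (-1) * bracket_power (- \<kappa>) \<mu> x" .
    have "\<bar>laplacian (laplacian (bracket_power (- \<kappa>) \<mu>)) x\<bar> \<le> C2 * \<mu> powr (-2)
      * bracket_power (- \<kappa>) \<mu> x" by (rule C2(2)[OF \<mu>])
    also have "\<dots> \<le> C * \<mu> powr (-2) * bracket_power (- \<kappa>) \<mu> x"
      using C p by (intro mult_right_mono) auto
    finally show "\<bar>laplacian (laplacian (bracket_power (- \<kappa>) \<mu>)) x\<bar> \<le> C * \<mu> powr (-2)
      * bracket_power (- \<kappa>) \<mu> x" .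
  qed (use \<kappa> C in auto)
qed

section \<open>The cutoff in time and the memory term\<close>

definition time_weight :: "real \<Rightarrow> real \<Rightarrow> real" where
  "time_weight T t = 1 - (t / T)\<^sup>2"

lemma time_weight_meas [measurable]: "time_weight T \<in> borel_measurable borel"
  unfolding time_weight_def[abs_def] by measurable

lemma time_weight_bounds: "T > 0 \<Longrightarrow> t \<in> {0..T} \<Longrightarrow> 0 \<le> time_weight T t \<and> time_weight T t \<le> 1"
  unfolding time_weight_def by (auto intro!: power_le_one)

lemma DERIV_time_weight: "T \<noteq> 0 \<Longrightarrow> (time_weight T has_real_derivative - (2 * t / T\<^sup>2)) (at t within S)"
  unfolding time_weight_def[abs_def] by (auto intro!: derivative_eq_intros simp: power2_eq_square)

text \<open>The cutoff is even in \<open>t\<close>, so its derivative vanishes at 0. This removes one of the data terms, and it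
  is what makes the damping term carry a factor \<open>t/T\<close>, hence small at any fixed time for large \<open>T\<close>.\<close>

definition cutoff where "cutoff T N t = time_weight T t ^ N"
definition cutoff' where "cutoff' T N t = - (2 * real N / T * (t / T)) * time_weight T t ^ (N - 1)"
definition cutoff'' where "cutoff'' T N t = - (2 * real N / T\<^sup>2) * time_weight T t ^ (N - 1)
   + 4 * real N * real (N - 1) / T\<^sup>2 * (t / T)\<^sup>2 * time_weight T t ^ (N - 2)"

lemma cutoff_C2:
  assumes T: "T > 0" and N: "N \<ge> 2"
  shows "C2_on_interval T (cutoff T N) (cutoff' T N) (cutoff'' T N)"
    and "cutoff T N 0 = 1" "cutoff T N T = 0" "cutoff' T N T = 0" "cutoff' T N 0 = 0"
proof -
  have 1: "(cutoff T N has_real_derivative cutoff' T N t) (at t within {0..T})" for t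
    unfolding cutoff_def[abs_def] cutoff'_def
    using T by (auto intro!: derivative_eq_intros DERIV_time_weight simp: power2_eq_square)
  have 2: "(cutoff' T N has_real_derivative cutoff'' T N t) (at t within {0..T})" for t
  proof -
    have "N - 1 - Suc 0 = N - 2" by simp
    then show ?thesis
      unfolding cutoff'_def[abs_def] cutoff''_def
      using T by (auto intro!: derivative_eq_intros DERIV_time_weight simp: power2_eq_square field_simps)
  qed
  have 3: "continuous_on {0..T} (cutoff'' T N)"
    unfolding cutoff''_def[abs_def] time_weight_def[abs_def] using T by (intro continuous_intros) auto
  show "C2_on_interval T (cutoff T N) (cutoff' T N) (cutoff'' T N)"
    unfolding C2_on_interval_def using 1 2 3 by blast
  show "cutoff T N 0 = 1" "cutoff T N T = 0" "cutoff' T N T = 0" "cutoff' T N 0 = 0"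
    using T N by (auto simp: cutoff_def cutoff'_def time_weight_def)
qed

lemma cutoff_bounds:
  assumes T: "T > 0" and N: "N \<ge> 2" and t: "t \<in> {0..T}"
  shows "\<bar>cutoff T N t\<bar> \<le> time_weight T t ^ (N - 2)"
    and "\<bar>cutoff' T N t\<bar> \<le> (2 * real N + 4 * real N ^ 2) / T * (t / T) * time_weight T t ^ (N - 2)"
    and "\<bar>cutoff'' T N t\<bar> \<le> (2 * real N + 4 * real N ^ 2) / T\<^sup>2 * time_weight T t ^ (N - 2)"
proof -
  have z: "0 \<le> time_weight T t" "time_weight T t \<le> 1" using time_weight_bounds[OF T t] by auto
  have tT: "0 \<le> t / T" "t / T \<le> 1" using t T by auto
  have tT2: "(t / T)\<^sup>2 \<le> 1" using tT by (intro power_le_one) auto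
  have p: "time_weight T t ^ N \<le> time_weight T t ^ (N - 2)" "time_weight T t ^ (N - 1)
    \<le> time_weight T t ^ (N - 2)"
    using z by (auto intro!: power_decreasing)
  show "\<bar>cutoff T N t\<bar> \<le> time_weight T t ^ (N - 2)" using p z by (simp add: cutoff_def)
  have "\<bar>cutoff' T N t\<bar> = 2 * real N / T * (t / T) * time_weight T t ^ (N - 1)"
    using z t T by (simp add: cutoff'_def abs_mult)
  also have "\<dots> \<le> (2 * real N + 4 * real N ^ 2) / T * (t / T) * time_weight T t ^ (N - 2)"
    using z tT T t p by (intro mult_mono divide_right_mono mult_nonneg_nonneg divide_nonneg_pos) auto
  finally show "\<bar>cutoff' T N t\<bar> \<le> (2 * real N + 4 * real N ^ 2) / T * (t / T) * time_weight T t ^ (N - 2)" .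
  have "\<bar>cutoff'' T N t\<bar> \<le> \<bar>- (2 * real N / T\<^sup>2) * time_weight T t ^ (N - 1)\<bar> + \<bar>4 * real N
    * real (N - 1) / T\<^sup>2 * (t / T)\<^sup>2 * time_weight T t ^ (N - 2)\<bar>"
    unfolding cutoff''_def by (rule abs_triangle_ineq)
  also have "\<dots> = 2 * real N / T\<^sup>2 * time_weight T t ^ (N - 1) + 4 * real N * real (N - 1) / T\<^sup>2
    * (t / T)\<^sup>2 * time_weight T t ^ (N - 2)"
    using z by (simp add: abs_mult)
  also have "\<dots> \<le> 2 * real N / T\<^sup>2 * time_weight T t ^ (N - 2) + 4 * real N * real N / T\<^sup>2 * 1
    * time_weight T t ^ (N - 2)"
    using z p tT2 by (intro add_mono mult_mono divide_right_mono) auto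
  also have "\<dots> = (2 * real N + 4 * real N ^ 2) / T\<^sup>2 * time_weight T t ^ (N - 2)"
    by (simp add: power2_eq_square add_divide_distrib distrib_right)
  finally show "\<bar>cutoff'' T N t\<bar> \<le> (2 * real N + 4 * real N ^ 2) / T\<^sup>2 * time_weight T t ^ (N - 2)" .
qed

text \<open>The integral over the first half of the interval from \<open>s\<close> to \<open>T\<close> suffices: there the kernel is at least
  \<open>T powr (-\<gamma>)\<close> and the cutoff at least \<open>((1 - s/T)/2) ^ N\<close>.\<close>

lemma memory_cutoff_lower_bound:
  assumes T: "T > 0" and \<gamma>: "0 \<le> \<gamma>" and s: "s \<in> {0..T}"
  shows "ennreal ((1/4) ^ (N + 1) * T powr (1 - \<gamma>) * time_weight T s ^ (N + 1))
    \<le> (\<integral>\<^sup>+ t. ennreal ((if s \<le> t \<and> t \<le> T then 1 else 0) * (t - s) powr (- \<gamma>) * cutoff T N t) \<partial>lborel)"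
proof -
  define r where "r = 1 - s / T"
  have r: "0 \<le> r" "r \<le> 1" using s T by (auto simp: r_def)
  have Ts: "T - s = T * r" using T by (simp add: r_def field_simps)
  have zs: "time_weight T s \<le> 2 * r"
  proof -
    have "time_weight T s = r * (1 + s / T)"
      by (simp add: time_weight_def r_def power2_eq_square algebra_simps)
    also have "\<dots> \<le> r * 2" using r s T by (intro mult_left_mono) auto
    finally show ?thesis by simp
  qed
  define K where "K = T powr (- \<gamma>) * (r / 2) ^ N"
  have K: "K \<ge> 0" using r by (simp add: K_def)
  have "(1/4) ^ (N + 1) * T powr (1 - \<gamma>) * time_weight T s ^ (N + 1) = T powr (1 - \<gamma>)
    * (time_weight T s / 4) ^ (N + 1)"
    by (simp add: power_divide)
  also have "\<dots> \<le> T powr (1 - \<gamma>) * (r / 2) ^ (N + 1)"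
    using zs time_weight_bounds[OF T s] by (intro mult_left_mono power_mono) auto
  also have "\<dots> = K * (T * r / 2)" using T by (simp add: K_def powr_diff powr_minus_divide)
  finally have "ennreal ((1/4) ^ (N + 1) * T powr (1 - \<gamma>) * time_weight T s ^ (N + 1))
    \<le> ennreal (K * (T * r / 2))"
    by (rule ennreal_leI)
  also have "\<dots> = ennreal K * emeasure lborel {s<..<s + T * r / 2}"
    using K T r by (subst emeasure_lborel_Ioo) (auto simp flip: ennreal_mult')
  also have "\<dots> = (\<integral>\<^sup>+ t. ennreal K * indicator {s<..<s + T * r / 2} t \<partial>lborel)"
    by (subst nn_integral_cmult_indicator) auto
  also have "\<dots> \<le> (\<integral>\<^sup>+ t. ennreal ((if s \<le> t \<and> t \<le> T then 1 else 0) * (t - s) powr (- \<gamma>)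
    * cutoff T N t) \<partial>lborel)"
  proof (rule nn_integral_mono)
    fix t :: real
    show "ennreal K * indicator {s<..<s + T * r / 2} t
      \<le> ennreal ((if s \<le> t \<and> t \<le> T then 1 else 0) * (t - s) powr (- \<gamma>) * cutoff T N t)"
    proof (cases "t \<in> {s<..<s + T * r / 2}")
      case True
      have tT: "t \<le> T" "t - s \<le> T" using True Ts s r T by (auto simp: field_simps)
      have "r / 2 \<le> 1 - t / T" using True T by (simp add: r_def field_simps)
      also have "1 - t / T \<le> time_weight T t"
      proof -
        have "(t / T) * (t / T) \<le> (t / T) * 1" using True tT s T by (intro mult_left_mono) auto
        then show ?thesis by (simp add: time_weight_def power2_eq_square)
      qed
      finally have "(r / 2) ^ N \<le> cutoff T N t" unfolding cutoff_def using r by (intro power_mono) auto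
      moreover have "T powr (- \<gamma>) \<le> (t - s) powr (- \<gamma>)"
        using True tT \<gamma> by (intro powr_mono2') auto
      ultimately have "K \<le> (t - s) powr (- \<gamma>) * cutoff T N t"
        unfolding K_def using r by (intro mult_mono) auto
      then show ?thesis using True tT by (auto intro!: ennreal_leI)
    qed auto
  qed
  finally show ?thesis .
qed

lemma space_time_integral_le:
  fixes h :: "real \<times> 'a::euclidean_space \<Rightarrow> real"
  assumes [measurable]: "h \<in> borel_measurable (borel \<Otimes>\<^sub>M borel)" "\<phi> \<in> borel_measurable borel" "e
    \<in> borel_measurable borel"
    and \<eta>: "\<And>t. t \<in> {0..T} \<Longrightarrow> \<bar>\<eta> t\<bar> \<le> e t" and w: "\<And>x. \<bar>w x\<bar> \<le> k * \<phi> x" and k: "k \<ge> 0"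
  shows "ennreal \<bar>space_time_integral T \<eta> (\<lambda>t x. h (t, x)) w\<bar>
    \<le> (\<integral>\<^sup>+ z. ennreal (indicator {0..T} (fst z) * (k * e (fst z)) * (\<bar>h z\<bar> * \<phi> (snd z)))
      \<partial>(lborel \<Otimes>\<^sub>M lborel))"
proof -
  have "ennreal \<bar>space_time_integral T \<eta> (\<lambda>t x. h (t, x)) w\<bar>
     \<le> (\<integral>\<^sup>+ t. ennreal (norm (indicator {0..T} t *\<^sub>R (\<eta> t * (LINT x|lborel. h (t, x) * w x)))) \<partial>lborel)"
    unfolding space_time_integral_def set_lebesgue_integral_def real_norm_def[symmetric]
    by (rule norm_integral_le_nn_integral)
  also have "\<dots> \<le> (\<integral>\<^sup>+ t. \<integral>\<^sup>+ x. ennreal (indicator {0..T} t * (k * e t) * (\<bar>h (t, x)\<bar> * \<phi> x))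
    \<partial>lborel \<partial>lborel)"
  proof (rule nn_integral_mono)
    fix t :: real
    show "ennreal (norm (indicator {0..T} t *\<^sub>R (\<eta> t * (LINT x|lborel. h (t, x) * w x))))
      \<le> (\<integral>\<^sup>+ x. ennreal (indicator {0..T} t * (k * e t) * (\<bar>h (t, x)\<bar> * \<phi> x)) \<partial>lborel)"
    proof (cases "t \<in> {0..T}")
      case True
      have e0: "0 \<le> e t" using \<eta>[OF True] by linarith
      have "ennreal (norm (LINT x|lborel. h (t, x) * w x))
        \<le> (\<integral>\<^sup>+ x. ennreal (norm (h (t, x) * w x)) \<partial>lborel)"
        by (rule norm_integral_le_nn_integral)
      also have "\<dots> \<le> (\<integral>\<^sup>+ x. ennreal (k * (\<bar>h (t, x)\<bar> * \<phi> x)) \<partial>lborel)"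
      proof (rule nn_integral_mono)
        fix x
        have "norm (h (t, x) * w x) \<le> \<bar>h (t, x)\<bar> * (k * \<phi> x)" using w[of x]
          by (simp add: abs_mult mult_left_mono)
        then show "ennreal (norm (h (t, x) * w x)) \<le> ennreal (k * (\<bar>h (t, x)\<bar> * \<phi> x))"
          by (intro ennreal_leI) (simp add: mult_ac)
      qed
      finally have *: "ennreal (norm (LINT x|lborel. h (t, x) * w x))
        \<le> (\<integral>\<^sup>+ x. ennreal (k * (\<bar>h (t, x)\<bar> * \<phi> x)) \<partial>lborel)" .
      have "ennreal (norm (indicator {0..T} t *\<^sub>R (\<eta> t * (LINT x|lborel. h (t, x) * w x))))
        = ennreal \<bar>\<eta> t\<bar> * ennreal (norm (LINT x|lborel. h (t, x) * w x))"
        using True by (simp add: abs_mult ennreal_mult')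
      also have "\<dots> \<le> ennreal (e t) * (\<integral>\<^sup>+ x. ennreal (k * (\<bar>h (t, x)\<bar> * \<phi> x)) \<partial>lborel)"
        using \<eta>[OF True] by (intro mult_mono * ennreal_leI) auto
      also have "\<dots> = (\<integral>\<^sup>+ x. ennreal (e t) * ennreal (k * (\<bar>h (t, x)\<bar> * \<phi> x)) \<partial>lborel)"
        by (rule nn_integral_cmult[symmetric]) measurable
      also have "\<dots> = (\<integral>\<^sup>+ x. ennreal (indicator {0..T} t * (k * e t) * (\<bar>h (t, x)\<bar> * \<phi> x)) \<partial>lborel)"
        using True e0 by (intro nn_integral_cong) (simp add: mult_ac flip: ennreal_mult')
      finally show ?thesis .
    qed simp
  qed
  also have "\<dots> = (\<integral>\<^sup>+ z. ennreal (indicator {0..T} (fst z) * (k * e (fst z)) * (\<bar>h z\<bar> * \<phi> (snd z)))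
    \<partial>(lborel \<Otimes>\<^sub>M lborel))"
    by (subst lborel.nn_integral_fst[symmetric]) simp_all
  finally show ?thesis .
qed

text \<open>All integrands are nonnegative and the convergence assumptions turn the Bochner integrals into
  nonnegative integrals, so Tonelli moves the memory kernel from \<open>u\<close> to the cutoff.\<close>

lemma space_time_integral_memory_ge:
  fixes h :: "real \<times> 'a::euclidean_space \<Rightarrow> real" and p \<gamma> :: real
  defines "u \<equiv> (\<lambda>t x. h (t, x))"
  assumes [measurable]: "h \<in> borel_measurable (borel \<Otimes>\<^sub>M borel)" "\<phi> \<in> borel_measurable borel"
    and \<phi>: "\<And>x. \<phi> x \<ge> 0" and T: "T > 0" and \<gamma>: "0 \<le> \<gamma>"
    and mem: "memory_converges \<gamma> p T u"
    and conv: "space_time_converges T (cutoff T N) (memory_term \<gamma> p u) \<phi>"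
  shows "ennreal ((1/4) ^ (N + 1) * T powr (1 - \<gamma>)) *
     (\<integral>\<^sup>+ z. ennreal (indicator {0..T} (fst z) * time_weight T (fst z) ^ (N + 1)
       * (\<bar>h z\<bar> powr p * \<phi> (snd z))) \<partial>(lborel \<Otimes>\<^sub>M lborel))
    \<le> ennreal (space_time_integral T (cutoff T N) (memory_term \<gamma> p u) \<phi>)"
proof -
  define c where "c = (1/4) ^ (N + 1) * T powr (1 - \<gamma>)"
  have c: "c \<ge> 0" by (simp add: c_def)
  define \<psi> where "\<psi> = cutoff T N"
  have [measurable]: "\<psi> \<in> borel_measurable borel" unfolding \<psi>_def cutoff_def[abs_def] by measurable
  have \<psi>: "\<psi> t \<ge> 0" if "t \<in> {0..T}" for t using time_weight_bounds[OF T that]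
    by (simp add: \<psi>_def cutoff_def)
  define k where "k = (\<lambda>t s::real. (if 0 \<le> s \<and> s \<le> t \<and> t \<le> T then 1 else 0) * (t - s) powr (- \<gamma>) * \<psi> t)"
  have [measurable]: "(\<lambda>(t, s). k t s) \<in> borel_measurable (borel \<Otimes>\<^sub>M borel)" unfolding k_def by measurable
  have k: "k t s \<ge> 0" for t s using \<psi>[of t] by (auto simp: k_def)
  define f where "f = (\<lambda>s x. \<bar>h (s, x)\<bar> powr p * \<phi> x)"
  have f: "f s x \<ge> 0" for s x using \<phi> by (simp add: f_def)
  define F where "F = memory_term \<gamma> p u"
  have F0: "F t x \<ge> 0" for t x
    unfolding F_def memory_term_def set_lebesgue_integral_def
      by (intro Bochner_Integration.integral_nonneg) auto
  have "ennreal (space_time_integral T \<psi> F \<phi>)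
    = (\<integral>\<^sup>+ t. ennreal (indicator {0..T} t *\<^sub>R (\<psi> t * (LINT x|lborel. F t x * \<phi> x))) \<partial>lborel)"
    unfolding space_time_integral_def set_lebesgue_integral_def
  proof (rule nn_integral_eq_integral[symmetric])
    show "integrable lborel (\<lambda>t. indicator {0..T} t *\<^sub>R (\<psi> t * (LINT x|lborel. F t x * \<phi> x)))"
      using conv by (simp add: space_time_converges_def set_integrable_def F_def \<psi>_def)
    show "AE t in lborel. 0 \<le> indicator {0..T} t *\<^sub>R (\<psi> t * (LINT x|lborel. F t x * \<phi> x))"
    proof (rule AE_I2)
      fix t
      have "(LINT x|lborel. F t x * \<phi> x) \<ge> 0" using F0 \<phi> by (intro Bochner_Integration.integral_nonneg) auto
      then show "0 \<le> indicator {0..T} t *\<^sub>R (\<psi> t * (LINT x|lborel. F t x * \<phi> x))"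
        using \<psi>[of t] by (cases "t \<in> {0..T}") auto
    qed
  qed
  also have "\<dots> = (\<integral>\<^sup>+ t. \<integral>\<^sup>+ x. \<integral>\<^sup>+ s. ennreal (k t s * f s x) \<partial>lborel \<partial>lborel \<partial>lborel)"
  proof (rule nn_integral_cong_AE)
    have "AE t in lborel. t \<in> {0..T} \<longrightarrow> integrable lborel (\<lambda>x. F t x * \<phi> x)"
      using conv by (simp add: space_time_converges_def F_def)
    moreover have "AE t in lborel. t \<in> {0..T} \<longrightarrow> (AE x in lborel.
        set_integrable lborel {0..t} (\<lambda>s. (t - s) powr (- \<gamma>) * \<bar>u s x\<bar> powr p))"
      using mem by (simp add: memory_converges_def)
    ultimately show "AE t in lborel. ennreal (indicator {0..T} t *\<^sub>R (\<psi> t * (LINT x|lborel. F t x * \<phi> x)))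
       = (\<integral>\<^sup>+ x. \<integral>\<^sup>+ s. ennreal (k t s * f s x) \<partial>lborel \<partial>lborel)"
    proof eventually_elim
      fix t assume A: "t \<in> {0..T} \<longrightarrow> integrable lborel (\<lambda>x. F t x * \<phi> x)"
        "t \<in> {0..T} \<longrightarrow> (AE x in lborel. set_integrable lborel {0..t}
          (\<lambda>s. (t - s) powr (- \<gamma>) * \<bar>u s x\<bar> powr p))"
      show "ennreal (indicator {0..T} t *\<^sub>R (\<psi> t * (LINT x|lborel. F t x * \<phi> x)))
       = (\<integral>\<^sup>+ x. \<integral>\<^sup>+ s. ennreal (k t s * f s x) \<partial>lborel \<partial>lborel)"
      proof (cases "t \<in> {0..T}")
        case True
        have "ennreal (indicator {0..T} t *\<^sub>R (\<psi> t * (LINT x|lborel. F t x * \<phi> x))) = ennreal (\<psi> t)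
          * ennreal (LINT x|lborel. F t x * \<phi> x)"
          using True \<psi>[OF True] by (simp add: ennreal_mult')
        also have "ennreal (LINT x|lborel. F t x * \<phi> x) = (\<integral>\<^sup>+ x. ennreal (F t x * \<phi> x) \<partial>lborel)"
          using A(1) True F0 \<phi> by (intro nn_integral_eq_integral[symmetric]) auto
        also have "\<dots> = (\<integral>\<^sup>+ x. \<integral>\<^sup>+ s. ennreal (indicator {0..t} s * ((t - s) powr (- \<gamma>) * f s x))
          \<partial>lborel \<partial>lborel)"
        proof (rule nn_integral_cong_AE)
          have "AE x in lborel. set_integrable lborel {0..t}
            (\<lambda>s. (t - s) powr (- \<gamma>) * \<bar>u s x\<bar> powr p)" using A(2) True by simp
          then show "AE x in lborel. ennreal (F t x * \<phi> x)
            = (\<integral>\<^sup>+ s. ennreal (indicator {0..t} s * ((t - s) powr (- \<gamma>) * f s x)) \<partial>lborel)"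
          proof eventually_elim
            fix x assume "set_integrable lborel {0..t} (\<lambda>s. (t - s) powr (- \<gamma>) * \<bar>u s x\<bar> powr p)"
            then have "ennreal (F t x) = (\<integral>\<^sup>+ s. ennreal
              (indicator {0..t} s *\<^sub>R ((t - s) powr (- \<gamma>) * \<bar>u s x\<bar> powr p)) \<partial>lborel)"
              unfolding F_def memory_term_def set_lebesgue_integral_def set_integrable_def
              by (intro nn_integral_eq_integral[symmetric]) auto
            then have "ennreal (F t x * \<phi> x) = (\<integral>\<^sup>+ s. ennreal
              (indicator {0..t} s *\<^sub>R ((t - s) powr (- \<gamma>) * \<bar>u s x\<bar> powr p)) \<partial>lborel) * ennreal (\<phi> x)"
              using F0[of t x] by (simp add: ennreal_mult')
            also have "\<dots> = (\<integral>\<^sup>+ s. ennreal (indicator {0..t} s *\<^sub>R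
              ((t - s) powr (- \<gamma>) * \<bar>u s x\<bar> powr p)) * ennreal (\<phi> x) \<partial>lborel)"
              unfolding u_def by (rule nn_integral_multc[symmetric]) measurable
            also have "\<dots> = (\<integral>\<^sup>+ s. ennreal (indicator {0..t} s * ((t - s) powr (- \<gamma>) * f s x)) \<partial>lborel)"
              using \<phi>[of x] by (intro nn_integral_cong) (simp add: f_def u_def mult_ac flip: ennreal_mult'')
            finally show "ennreal (F t x * \<phi> x) = (\<integral>\<^sup>+ s. ennreal
              (indicator {0..t} s * ((t - s) powr (- \<gamma>) * f s x)) \<partial>lborel)" .
          qed
        qed
        also have "ennreal (\<psi> t) * \<dots> = (\<integral>\<^sup>+ x. ennreal (\<psi> t)
          * (\<integral>\<^sup>+ s. ennreal (indicator {0..t} s * ((t - s) powr (- \<gamma>) * f s x)) \<partial>lborel) \<partial>lborel)"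
          unfolding f_def by (rule nn_integral_cmult[symmetric]) measurable
        also have "\<dots> = (\<integral>\<^sup>+ x. \<integral>\<^sup>+ s. ennreal (k t s * f s x) \<partial>lborel \<partial>lborel)"
        proof (rule nn_integral_cong)
          fix x
          have "ennreal (\<psi> t) * (\<integral>\<^sup>+ s. ennreal (indicator {0..t} s * ((t - s) powr (- \<gamma>) * f s x)) \<partial>lborel)
            = (\<integral>\<^sup>+ s. ennreal (\<psi> t) * ennreal (indicator {0..t} s * ((t - s) powr (- \<gamma>) * f s x)) \<partial>lborel)"
            unfolding f_def by (rule nn_integral_cmult[symmetric]) measurable
          also have "\<dots> = (\<integral>\<^sup>+ s. ennreal (k t s * f s x) \<partial>lborel)"
            using True \<psi>[OF True] by (intro nn_integral_cong)
              (auto simp: k_def indicator_def mult_ac simp flip: ennreal_mult')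
          finally show "ennreal (\<psi> t) * (\<integral>\<^sup>+ s. ennreal
            (indicator {0..t} s * ((t - s) powr (- \<gamma>) * f s x)) \<partial>lborel)
            = (\<integral>\<^sup>+ s. ennreal (k t s * f s x) \<partial>lborel)" .
        qed
        finally show ?thesis .
      next
        case False
        then have "k t s = 0" for s by (auto simp: k_def)
        with False show ?thesis by simp
      qed
    qed
  qed
  also have "\<dots> = (\<integral>\<^sup>+ x. \<integral>\<^sup>+ t. \<integral>\<^sup>+ s. ennreal (k t s * f s x) \<partial>lborel \<partial>lborel \<partial>lborel)"
    unfolding f_def by (rule lborel_pair.Fubini') measurable
  also have "\<dots> = (\<integral>\<^sup>+ x. \<integral>\<^sup>+ s. \<integral>\<^sup>+ t. ennreal (k t s * f s x) \<partial>lborel \<partial>lborel \<partial>lborel)"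
    unfolding f_def by (intro nn_integral_cong lborel_pair.Fubini') measurable
  also have "\<dots> \<ge> (\<integral>\<^sup>+ x. \<integral>\<^sup>+ s. ennreal c * ennreal
    (indicator {0..T} s * time_weight T s ^ (N + 1) * f s x) \<partial>lborel \<partial>lborel)"
  proof (intro nn_integral_mono)
    fix x s
    show "ennreal c * ennreal (indicator {0..T} s * time_weight T s ^ (N + 1) * f s x)
      \<le> (\<integral>\<^sup>+ t. ennreal (k t s * f s x) \<partial>lborel)"
    proof (cases "s \<in> {0..T}")
      case True
      have "ennreal c * ennreal (indicator {0..T} s * time_weight T s ^ (N + 1) * f s x)
        = ennreal (c * time_weight T s ^ (N + 1)) * ennreal (f s x)"
        using True c time_weight_bounds[OF T True] f[of s x] by (simp add: mult.assoc flip: ennreal_mult')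
      also have "\<dots> \<le> (\<integral>\<^sup>+ t. ennreal (k t s) \<partial>lborel) * ennreal (f s x)"
      proof (intro mult_right_mono)
        show "ennreal (c * time_weight T s ^ (N + 1)) \<le> (\<integral>\<^sup>+ t. ennreal (k t s) \<partial>lborel)"
          using memory_cutoff_lower_bound[OF T \<gamma> True, of N] True by (simp add: c_def k_def \<psi>_def)
      qed simp
      also have "\<dots> = (\<integral>\<^sup>+ t. ennreal (k t s) * ennreal (f s x) \<partial>lborel)"
        by (rule nn_integral_multc[symmetric]) measurable
      also have "\<dots> = (\<integral>\<^sup>+ t. ennreal (k t s * f s x) \<partial>lborel)"
        using k f[of s x] by (simp add: ennreal_mult')
      finally show ?thesis .
    qed simp
  qed
  finally have le: "(\<integral>\<^sup>+ x. \<integral>\<^sup>+ s. ennreal c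
    * ennreal (indicator {0..T} s * time_weight T s ^ (N + 1) * f s x) \<partial>lborel \<partial>lborel)
     \<le> ennreal (space_time_integral T \<psi> F \<phi>)" .
  have "(\<integral>\<^sup>+ x. \<integral>\<^sup>+ s. ennreal c * ennreal (indicator {0..T} s * time_weight T s ^ (N + 1) * f s x)
    \<partial>lborel \<partial>lborel)
    = (\<integral>\<^sup>+ s. \<integral>\<^sup>+ x. ennreal c * ennreal (indicator {0..T} s * time_weight T s ^ (N + 1) * f s x)
      \<partial>lborel \<partial>lborel)"
    unfolding f_def by (rule lborel_pair.Fubini') measurable
  also have "\<dots> = (\<integral>\<^sup>+ z. ennreal c * ennreal
    (indicator {0..T} (fst z) * time_weight T (fst z) ^ (N + 1) * (\<bar>h z\<bar> powr p * \<phi> (snd z)))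
    \<partial>(lborel \<Otimes>\<^sub>M lborel))"
    unfolding f_def by (subst lborel.nn_integral_fst[symmetric]) simp_all
  also have "\<dots> = ennreal c * (\<integral>\<^sup>+ z. ennreal
    (indicator {0..T} (fst z) * time_weight T (fst z) ^ (N + 1) * (\<bar>h z\<bar> powr p * \<phi> (snd z)))
    \<partial>(lborel \<Otimes>\<^sub>M lborel))"
    by (rule nn_integral_cmult) measurable
  finally show ?thesis using le by (simp add: c_def \<psi>_def F_def)
qed

section \<open>The energy estimate for one test function\<close>

text \<open>Used to replace \<open>u\<close> by a function that is Borel measurable on the whole of space-time; measurability is
  known for nonnegative times only.\<close>

lemma weak_solution_on_cong:
  assumes eq: "\<And>t. t \<ge> 0 \<Longrightarrow> u t = v t" and u: "weak_solution_on \<theta> \<gamma> p u0 u1 T u"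
  shows "weak_solution_on \<theta> \<gamma> p u0 u1 T v"
proof -
  have mt: "memory_term \<gamma> p u = memory_term \<gamma> p v"
    unfolding memory_term_def[abs_def] by (intro ext set_lebesgue_integral_cong) (auto simp: eq)
  have mc: "memory_converges \<gamma> p T u = memory_converges \<gamma> p T v"
  proof -
    have "set_integrable lborel {0..t} (\<lambda>s. (t - s) powr (- \<gamma>) * \<bar>u s x\<bar> powr p)
      = set_integrable lborel {0..t} (\<lambda>s. (t - s) powr (- \<gamma>) * \<bar>v s x\<bar> powr p)" for t x
      by (intro set_integrable_cong) (auto simp: eq)
    then show ?thesis by (simp add: memory_converges_def)
  qed
  have si: "space_time_integral T \<eta> u w = space_time_integral T \<eta> v w" for \<eta> w
    unfolding space_time_integral_def by (intro set_lebesgue_integral_cong) (auto simp: eq)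
  have sc: "space_time_converges T \<eta> u w = space_time_converges T \<eta> v w" for \<eta> w
  proof -
    have "set_integrable lborel {0..T} (\<lambda>t. \<eta> t * (LINT x|lborel. u t x * w x))
      = set_integrable lborel {0..T} (\<lambda>t. \<eta> t * (LINT x|lborel. v t x * w x))"
      by (intro set_integrable_cong) (auto simp: eq)
    moreover have "(t \<in> {0..T} \<longrightarrow> integrable lborel (\<lambda>x. u t x * w x))
      = (t \<in> {0..T} \<longrightarrow> integrable lborel (\<lambda>x. v t x * w x))" for t
      by (auto simp: eq)
    ultimately show ?thesis unfolding space_time_converges_def by simp
  qed
  show ?thesis using u unfolding weak_solution_on_def mt mc si sc .
qed

text \<open>Young's inequality without the optimal constants: one of the two terms already dominates, depending
  on which side of \<open>S = \<epsilon> * y powr (p - 1)\<close> the point lies.\<close>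

lemma young_ineq:
  fixes y S \<epsilon> p :: real
  assumes y: "y \<ge> 0" and S: "S \<ge> 0" and \<epsilon>: "\<epsilon> > 0" and p: "p > 1"
  shows "y * S \<le> \<epsilon> * y powr p + \<epsilon> powr (- (1 / (p - 1))) * S powr (p / (p - 1))"
proof (cases "S \<le> \<epsilon> * y powr (p - 1)")
  case True
  have "y * S \<le> y * (\<epsilon> * y powr (p - 1))" using True y by (rule mult_left_mono)
  also have "\<dots> = \<epsilon> * y powr p" using y p by (cases "y = 0") (auto simp: powr_diff)
  finally show ?thesis using S by (simp add: add_increasing2)
next
  case False
  then have Spos: "S > 0" using \<epsilon> by (smt (verit) mult_nonneg_nonneg powr_ge_zero)
  have "y powr (p - 1) \<le> S / \<epsilon>" using False \<epsilon> by (simp add: pos_le_divide_eq mult.commute)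
  then have "(y powr (p - 1)) powr (1 / (p - 1)) \<le> (S / \<epsilon>) powr (1 / (p - 1))"
    using p by (intro powr_mono2) auto
  then have "y \<le> (S / \<epsilon>) powr (1 / (p - 1))" using p y by (simp add: powr_powr)
  then have "y * S \<le> (S / \<epsilon>) powr (1 / (p - 1)) * S" using S by (rule mult_right_mono)
  also have "\<dots> = \<epsilon> powr (- (1 / (p - 1))) * (S powr (1 / (p - 1)) * S powr 1)"
    using Spos \<epsilon> by (simp add: powr_divide powr_minus_divide)
  also have "S powr (1 / (p - 1)) * S powr 1 = S powr (p / (p - 1))"
  proof -
    have "1 / (p - 1) + 1 = p / (p - 1)" using p by (simp add: field_simps)
    then show ?thesis by (simp only: powr_add[symmetric])
  qed
  finally show ?thesis using y \<epsilon> by (simp add: add_increasing)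
qed

text \<open>The exponent \<open>N + 1\<close> is the one that the memory term produces from a cutoff of order \<open>N\<close>. The
  additional weight \<open>a\<close> is \<open>1\<close> or \<open>(t/T) powr p\<close>.\<close>

definition space_time_energy :: "real \<Rightarrow> nat \<Rightarrow> real \<Rightarrow> (real \<times> 'a::euclidean_space \<Rightarrow> real) \<Rightarrow>
  ('a \<Rightarrow> real) \<Rightarrow> (real \<Rightarrow> real) \<Rightarrow> ennreal" where
  "space_time_energy T N p h \<phi> a = (\<integral>\<^sup>+ z. ennreal
    (indicator {0..T} (fst z) * (a (fst z) * time_weight T (fst z) ^ (N + 1))
    * (\<bar>h z\<bar> powr p * \<phi> (snd z))) \<partial>(lborel \<Otimes>\<^sub>M lborel))"

lemma late_energy_le:
  fixes h :: "real \<times> 'a::euclidean_space \<Rightarrow> real"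
  assumes T: "T > 0" and p: "p > 0" and \<phi>: "\<And>x. 0 \<le> \<phi> x"
  shows "space_time_energy T N p h \<phi> (\<lambda>t. (t / T) powr p) \<le> space_time_energy T N p h \<phi> (\<lambda>_. 1)"
  unfolding space_time_energy_def
proof (intro nn_integral_mono ennreal_leI)
  fix z :: "real \<times> 'a"
  show "indicator {0..T} (fst z) * ((fst z / T) powr p * time_weight T (fst z) ^ (N + 1))
    * (\<bar>h z\<bar> powr p * \<phi> (snd z))
    \<le> indicator {0..T} (fst z) * (1 * time_weight T (fst z) ^ (N + 1)) * (\<bar>h z\<bar> powr p * \<phi> (snd z))"
  proof (cases "fst z \<in> {0..T}")
    case True
    have "(fst z / T) powr p \<le> 1" using True T p by (intro powr_le1) auto
    then show ?thesis
      using True time_weight_bounds[OF T True] \<phi>[of "snd z"] by (intro mult_right_mono mult_left_mono) auto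
  qed simp
qed

text \<open>The weak identity with absolute values. The energy is finite because the memory term in the identity
  is; this is what permits absorbing it later.\<close>

lemma weak_solution_inequality:
  fixes h :: "real \<times> 'a::euclidean_space \<Rightarrow> real" and p \<gamma> :: real
  assumes h [measurable]: "h \<in> borel_measurable (borel \<Otimes>\<^sub>M borel)"
    and \<phi>m [measurable]: "\<phi> \<in> borel_measurable borel"
    and \<phi>: "\<And>x. 0 \<le> \<phi> x" "\<And>x. \<phi> x \<le> 1" and T: "T > 0" and \<gamma>: "0 \<le> \<gamma>" and N: "N \<ge> 2"
    and sol: "weak_solution_on \<theta> \<gamma> p u0 u1 T (\<lambda>t x. h (t, x))"
    and test: "\<phi> \<in> test_functions \<theta>" "has_frac_laplacian \<theta> \<phi> g"
    and C1: "C1 \<ge> 0" "\<And>x. \<bar>g x\<bar> \<le> C1 * \<phi> x"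
    and C2: "C2 \<ge> 0" "\<And>x. \<bar>laplacian \<phi> x\<bar> \<le> C2 * \<phi> x"
    and C3: "C3 \<ge> 0" "\<And>x. \<bar>laplacian (laplacian \<phi>) x\<bar> \<le> C3 * \<phi> x"
    and data: "integrable lborel u0" "integrable lborel u1"
  defines "B \<equiv> 2 * real N + 4 * real N ^ 2"
  shows "ennreal ((1/4) ^ (N + 1) * T powr (1 - \<gamma>)) * space_time_energy T N p h \<phi> (\<lambda>_. 1) \<le>
     (\<integral>\<^sup>+ z. ennreal (indicator {0..T} (fst z)
       * (((C2 + C3 + B / T\<^sup>2 * (1 + C2)) + fst z / T * (B / T * C1))
       * time_weight T (fst z) ^ (N - 2)) * (\<bar>h z\<bar> * \<phi> (snd z))) \<partial>(lborel \<Otimes>\<^sub>M lborel))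
     + ennreal (C1 * (LINT x|lborel. \<bar>u0 x\<bar>) + (1 + C2) * (LINT x|lborel. \<bar>u1 x\<bar>))"
    and "space_time_energy T N p h \<phi> (\<lambda>_. 1) < \<infinity>"
proof -
  define u where "u = (\<lambda>t x. h (t, x))"
  define \<psi> \<psi>' \<psi>'' where "\<psi> = cutoff T N" and "\<psi>' = cutoff' T N" and "\<psi>'' = cutoff'' T N"
  have B: "B \<ge> 0" by (simp add: B_def)
  note \<psi> = cutoff_C2[OF T N, folded \<psi>_def \<psi>'_def \<psi>''_def]
  let ?I = "space_time_integral T"
  let ?L = "?I \<psi> (memory_term \<gamma> p u) \<phi>"
  have all: "memory_converges \<gamma> p T u \<and>
        space_time_converges T \<psi> (memory_term \<gamma> p u) \<phi> \<and>
        integrable lborel (\<lambda>x. u0 x * g x) \<and> integrable lborel (\<lambda>x. u1 x * \<phi> x) \<and>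
        integrable lborel (\<lambda>x. u1 x * (- laplacian \<phi> x)) \<and>
        ?L = ?I \<psi> u (\<lambda>x. - laplacian \<phi> x) + ?I \<psi> u (laplacian (laplacian \<phi>)) - ?I \<psi>' u g
          + ?I \<psi>'' u \<phi> + ?I \<psi>'' u (\<lambda>x. - laplacian \<phi> x)
          - (LINT x|lborel. u0 x * g x) - (LINT x|lborel. u1 x * \<phi> x)
            - (LINT x|lborel. u1 x * (- laplacian \<phi> x))
          + \<psi>' 0 * ((LINT x|lborel. u0 x * \<phi> x) + (LINT x|lborel. u0 x * (- laplacian \<phi> x)))"
    using sol[folded u_def] \<psi> test unfolding weak_solution_on_def by blast
  define D where "D = C1 * (LINT x|lborel. \<bar>u0 x\<bar>) + (1 + C2) * (LINT x|lborel. \<bar>u1 x\<bar>)"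
  have data_le: "\<bar>LINT x|lborel. v x * w x\<bar> \<le> k * (LINT x|lborel. \<bar>v x\<bar>)"
    if v: "integrable lborel v" and vw: "integrable lborel (\<lambda>x. v x * w x)"
      and w: "\<And>x. \<bar>w x\<bar> \<le> k * \<phi> x" and k: "k \<ge> 0" for v w k
  proof -
    have "\<bar>LINT x|lborel. v x * w x\<bar> \<le> (LINT x|lborel. \<bar>v x * w x\<bar>)" by (rule integral_abs_bound)
    also have "\<dots> \<le> (LINT x|lborel. k * \<bar>v x\<bar>)"
    proof (rule integral_mono)
      fix x
      have "\<bar>w x\<bar> \<le> k" using w[of x] \<phi>(2)[of x] k by (meson mult_left_le order.trans)
      then show "\<bar>v x * w x\<bar> \<le> k * \<bar>v x\<bar>" using mult_left_mono[of "\<bar>w x\<bar>" k "\<bar>v x\<bar>"]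
        by (simp add: abs_mult mult.commute)
    qed (use v vw in auto)
    finally show ?thesis by simp
  qed
  have d0: "\<bar>LINT x|lborel. u0 x * g x\<bar> \<le> C1 * (LINT x|lborel. \<bar>u0 x\<bar>)"
    using all C1 by (intro data_le data) auto
  have d1: "\<bar>LINT x|lborel. u1 x * \<phi> x\<bar> \<le> 1 * (LINT x|lborel. \<bar>u1 x\<bar>)"
    using all \<phi> by (intro data_le data) auto
  have d2: "\<bar>LINT x|lborel. u1 x * (- laplacian \<phi> x)\<bar> \<le> C2 * (LINT x|lborel. \<bar>u1 x\<bar>)"
    using all C2 by (intro data_le data) auto
  have D0: "D \<ge> 0" using C1 C2 by (auto simp: D_def intro!: add_nonneg_nonneg mult_nonneg_nonneg
    Bochner_Integration.integral_nonneg)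
  define a1 a2 a3 a4 a5 where "a1 = \<bar>?I \<psi> u (\<lambda>x. - laplacian \<phi> x)\<bar>"
    and "a2 = \<bar>?I \<psi> u (laplacian (laplacian \<phi>))\<bar>"
    and "a3 = \<bar>?I \<psi>' u g\<bar>" and "a4 = \<bar>?I \<psi>'' u \<phi>\<bar>" and "a5 = \<bar>?I \<psi>'' u (\<lambda>x. - laplacian \<phi> x)\<bar>"
  have "?L \<le> a1 + a2 + a3 + a4 + a5 + D"
    using all d0 d1 d2 \<psi>(5) unfolding a1_def a2_def a3_def a4_def a5_def D_def by (simp add: distrib_right)
  then have "ennreal ?L \<le> ennreal (a1 + a2 + a3 + a4 + a5 + D)" by (rule ennreal_leI)
  also have "\<dots> = ennreal a1 + ennreal a2 + ennreal a3 + ennreal a4 + ennreal a5 + ennreal D"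
    using D0 by (simp add: a1_def a2_def a3_def a4_def a5_def)
  finally have L_le: "ennreal ?L \<le> ennreal a1 + ennreal a2 + ennreal a3 + ennreal a4 + ennreal a5
    + ennreal D" .
  define Q where "Q = (\<lambda>e. \<integral>\<^sup>+ z. ennreal (indicator {0..T} (fst z) * e (fst z)
    * (\<bar>h z\<bar> * \<phi> (snd z))) \<partial>(lborel \<Otimes>\<^sub>M lborel))"
  define e0 e1 e2 where "e0 = (\<lambda>t. time_weight T t ^ (N - 2))"
    and "e1 = (\<lambda>t. B / T * (t / T) * time_weight T t ^ (N - 2))"
    and "e2 = (\<lambda>t. B / T\<^sup>2 * time_weight T t ^ (N - 2))"
  have e0m [measurable]: "e0 \<in> borel_measurable borel" "e1 \<in> borel_measurable borel" "e2
    \<in> borel_measurable borel"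
    by (simp_all add: e0_def e1_def e2_def)
  have eb: "\<bar>\<psi> t\<bar> \<le> e0 t" "\<bar>\<psi>' t\<bar> \<le> e1 t" "\<bar>\<psi>'' t\<bar> \<le> e2 t" if "t \<in> {0..T}" for t
    using cutoff_bounds[OF T N that] by (simp_all add: \<psi>_def \<psi>'_def \<psi>''_def e0_def e1_def e2_def B_def)
  have e_nonneg: "0 \<le> e0 t" "0 \<le> e1 t" "0 \<le> e2 t" if "t \<in> {0..T}" for t using eb[OF that] by linarith+
  have Q1: "ennreal a1 \<le> Q (\<lambda>t. C2 * e0 t)" unfolding a1_def Q_def u_def using C2
    by (intro space_time_integral_le eb h \<phi>m e0m) auto
  have Q2: "ennreal a2 \<le> Q (\<lambda>t. C3 * e0 t)" unfolding a2_def Q_def u_def using C3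
    by (intro space_time_integral_le eb h \<phi>m e0m) auto
  have Q3: "ennreal a3 \<le> Q (\<lambda>t. C1 * e1 t)" unfolding a3_def Q_def u_def using C1
    by (intro space_time_integral_le eb h \<phi>m e0m) auto
  have Q4: "ennreal a4 \<le> Q (\<lambda>t. 1 * e2 t)" unfolding a4_def Q_def u_def using \<phi>
    by (intro space_time_integral_le eb h \<phi>m e0m) auto
  have Q5: "ennreal a5 \<le> Q (\<lambda>t. C2 * e2 t)" unfolding a5_def Q_def u_def using C2
    by (intro space_time_integral_le eb h \<phi>m e0m) auto
  have Q_add: "Q e + Q e' = Q (\<lambda>t. e t + e' t)"
    if [measurable]: "e \<in> borel_measurable borel" "e' \<in> borel_measurable borel"
      and nn: "\<And>t. t \<in> {0..T} \<Longrightarrow> 0 \<le> e t" "\<And>t. t \<in> {0..T} \<Longrightarrow> 0 \<le> e' t" for e e'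
  proof -
    have "Q e + Q e' = (\<integral>\<^sup>+ z. ennreal (indicator {0..T} (fst z) * e (fst z) * (\<bar>h z\<bar> * \<phi> (snd z)))
      + ennreal (indicator {0..T} (fst z) * e' (fst z) * (\<bar>h z\<bar> * \<phi> (snd z))) \<partial>(lborel \<Otimes>\<^sub>M lborel))"
      unfolding Q_def by (rule nn_integral_add[symmetric]) measurable
    also have "\<dots> = Q (\<lambda>t. e t + e' t)"
      unfolding Q_def
    proof (rule nn_integral_cong)
      fix z
      show "ennreal (indicator {0..T} (fst z) * e (fst z) * (\<bar>h z\<bar> * \<phi> (snd z)))
        + ennreal (indicator {0..T} (fst z) * e' (fst z) * (\<bar>h z\<bar> * \<phi> (snd z)))
        = ennreal (indicator {0..T} (fst z) * (e (fst z) + e' (fst z)) * (\<bar>h z\<bar> * \<phi> (snd z)))"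
        using nn[of "fst z"] \<phi>(1)[of "snd z"] by (cases "fst z \<in> {0..T}") (simp_all add: distrib_right)
    qed
    finally show ?thesis .
  qed
  have "ennreal ?L \<le> Q (\<lambda>t. C2 * e0 t) + Q (\<lambda>t. C3 * e0 t) + Q (\<lambda>t. C1 * e1 t) + Q (\<lambda>t. 1 * e2 t)
    + Q (\<lambda>t. C2 * e2 t) + ennreal D"
    using L_le Q1 Q2 Q3 Q4 Q5 by (meson add_mono order.trans order_refl)
  also have "Q (\<lambda>t. C2 * e0 t) + Q (\<lambda>t. C3 * e0 t) + Q (\<lambda>t. C1 * e1 t) + Q (\<lambda>t. 1 * e2 t)
    + Q (\<lambda>t. C2 * e2 t)
     = Q (\<lambda>t. C2 * e0 t + C3 * e0 t + C1 * e1 t + 1 * e2 t + C2 * e2 t)"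
  proof -
    note nn = add_nonneg_nonneg mult_nonneg_nonneg e_nonneg C1(1) C2(1) C3(1) zero_le_one
    have "Q (\<lambda>t. C2 * e0 t) + Q (\<lambda>t. C3 * e0 t) = Q (\<lambda>t. C2 * e0 t + C3 * e0 t)"
      by (intro Q_add nn) auto
    moreover have "\<dots> + Q (\<lambda>t. C1 * e1 t) = Q (\<lambda>t. C2 * e0 t + C3 * e0 t + C1 * e1 t)"
      by (intro Q_add nn) auto
    moreover have "\<dots> + Q (\<lambda>t. 1 * e2 t) = Q (\<lambda>t. C2 * e0 t + C3 * e0 t + C1 * e1 t + 1 * e2 t)"
      by (intro Q_add nn) auto
    moreover have "\<dots> + Q (\<lambda>t. C2 * e2 t) = Q (\<lambda>t. C2 * e0 t + C3 * e0 t + C1 * e1 t + 1 * e2 t + C2 * e2 t)"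
      by (intro Q_add nn) auto
    ultimately show ?thesis by (simp only:)
  qed
  also have "(\<lambda>t. C2 * e0 t + C3 * e0 t + C1 * e1 t + 1 * e2 t + C2 * e2 t)
     = (\<lambda>t. ((C2 + C3 + B / T\<^sup>2 * (1 + C2)) + t / T * (B / T * C1)) * time_weight T t ^ (N - 2))"
    by (simp add: e0_def e1_def e2_def fun_eq_iff algebra_simps add_divide_distrib)
  finally have L2: "ennreal ?L \<le> Q (\<lambda>t. ((C2 + C3 + B / T\<^sup>2 * (1 + C2)) + t / T * (B / T * C1))
    * time_weight T t ^ (N - 2)) + ennreal D" .
  have mem: "ennreal ((1/4) ^ (N + 1) * T powr (1 - \<gamma>)) * space_time_energy T N p h \<phi> (\<lambda>_. 1) \<le> ennreal ?L"
    unfolding space_time_energy_def u_def \<psi>_def mult_1 using all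
    by (intro space_time_integral_memory_ge h \<phi>m \<phi> T \<gamma>) (auto simp: u_def \<psi>_def)
  from order.trans[OF mem L2]
  show "ennreal ((1/4) ^ (N + 1) * T powr (1 - \<gamma>)) * space_time_energy T N p h \<phi> (\<lambda>_. 1) \<le>
     (\<integral>\<^sup>+ z. ennreal (indicator {0..T} (fst z)
       * (((C2 + C3 + B / T\<^sup>2 * (1 + C2)) + fst z / T * (B / T * C1))
       * time_weight T (fst z) ^ (N - 2)) * (\<bar>h z\<bar> * \<phi> (snd z))) \<partial>(lborel \<Otimes>\<^sub>M lborel))
     + ennreal (C1 * (LINT x|lborel. \<bar>u0 x\<bar>) + (1 + C2) * (LINT x|lborel. \<bar>u1 x\<bar>))"
    by (simp only: Q_def D_def)
  have "(1/4) ^ (N + 1) * T powr (1 - \<gamma>) > 0" using T by simp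
  with mem show "space_time_energy T N p h \<phi> (\<lambda>_. 1) < \<infinity>"
    by (metis ennreal_eq_0_iff ennreal_less_top ennreal_mult_eq_top_iff infinity_ennreal_def leD
      top.not_eq_extremum)
qed

text \<open>The two contributions to the coefficient, with and without the factor \<open>t/T\<close>, are treated by Young's
  inequality separately: the first with the small parameter \<open>c\<close>, so that it can be absorbed, the second
  with a free parameter \<open>\<tau>\<close>.\<close>

lemma weak_energy_estimate:
  fixes h :: "real \<times> 'a::euclidean_space \<Rightarrow> real" and p \<gamma> :: real
  assumes h [measurable]: "h \<in> borel_measurable (borel \<Otimes>\<^sub>M borel)"
    and \<phi>m [measurable]: "\<phi> \<in> borel_measurable borel"
    and \<phi>: "\<And>x. 0 \<le> \<phi> x" "\<And>x. \<phi> x \<le> 1" and T: "T > 0" and \<gamma>: "0 \<le> \<gamma>"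
      and N: "N \<ge> 2" "real (N + 1) / p \<le> real (N - 2)" and p: "p > 1"
    and sol: "weak_solution_on \<theta> \<gamma> p u0 u1 T (\<lambda>t x. h (t, x))"
    and test: "\<phi> \<in> test_functions \<theta>" "has_frac_laplacian \<theta> \<phi> g"
    and C1: "C1 \<ge> 0" "\<And>x. \<bar>g x\<bar> \<le> C1 * \<phi> x"
    and C2: "C2 \<ge> 0" "\<And>x. \<bar>laplacian \<phi> x\<bar> \<le> C2 * \<phi> x"
    and C3: "C3 \<ge> 0" "\<And>x. \<bar>laplacian (laplacian \<phi>) x\<bar> \<le> C3 * \<phi> x"
    and data: "integrable lborel u0" "integrable lborel u1"
    and M: "(\<integral>\<^sup>+ x. ennreal (\<phi> x) \<partial>lborel) \<le> ennreal M" "M \<ge> 0"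
    and \<tau>: "\<tau> > 0"
  defines "B \<equiv> 2 * real N + 4 * real N ^ 2" and "p' \<equiv> p / (p - 1)"
  defines "c \<equiv> (1/4) ^ (N + 1) / (2::real)"
  shows "ennreal c * space_time_energy T N p h \<phi> (\<lambda>_. 1) \<le>
     ennreal \<tau> * space_time_energy T N p h \<phi> (\<lambda>t. (t / T) powr p) +
     ennreal (T powr (1 - (1 - \<gamma>) * p') * M * (c powr (- (1 / (p - 1)))
       * (C2 + C3 + B / T\<^sup>2 * (1 + C2)) powr p' + \<tau> powr (- (1 / (p - 1))) * (B / T * C1) powr p')
       + T powr (- (1 - \<gamma>)) * (C1 * (LINT x|lborel. \<bar>u0 x\<bar>) + (1 + C2) * (LINT x|lborel. \<bar>u1 x\<bar>)))"
proof -
  define G where "G = T powr (1 - \<gamma>)"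
  have G: "G > 0" using T by (simp add: G_def)
  define E1 E2 where "E1 = C2 + C3 + B / T\<^sup>2 * (1 + C2)" and "E2 = B / T * C1"
  have E: "E1 \<ge> 0" "E2 \<ge> 0" using C1 C2 C3 T by (auto simp: E1_def E2_def B_def)
  have c: "c > 0" by (simp add: c_def)
  define K where "K = (c * G) powr (- (1 / (p - 1))) * E1 powr p' + (\<tau> * G) powr (- (1 / (p - 1)))
    * E2 powr p'"
  have K: "K \<ge> 0" by (simp add: K_def)
  define D where "D = C1 * (LINT x|lborel. \<bar>u0 x\<bar>) + (1 + C2) * (LINT x|lborel. \<bar>u1 x\<bar>)"
  have D0: "D \<ge> 0" using C1 C2 by (auto simp: D_def intro!: add_nonneg_nonneg mult_nonneg_nonneg
    Bochner_Integration.integral_nonneg)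
  let ?P = "(lborel \<Otimes>\<^sub>M lborel) :: (real \<times> 'a) measure"
  let ?X = "space_time_energy T N p h \<phi> (\<lambda>_. 1)" and ?Y = "space_time_energy T N p h \<phi> (\<lambda>t. (t / T) powr p)"
  note weak = weak_solution_inequality[OF h \<phi>m \<phi> T \<gamma> N(1) sol test C1 C2 C3 data, folded B_def,
    folded E1_def E2_def, folded D_def G_def]
  have point: "indicator {0..T} (fst z) * ((E1 + fst z / T * E2) * time_weight T (fst z) ^ (N - 2))
    * (\<bar>h z\<bar> * \<phi> (snd z))
     \<le> c * G * (indicator {0..T} (fst z) * (1 * time_weight T (fst z) ^ (N + 1))
       * (\<bar>h z\<bar> powr p * \<phi> (snd z)))
      + \<tau> * G * (indicator {0..T} (fst z) * ((fst z / T) powr p * time_weight T (fst z) ^ (N + 1))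
        * (\<bar>h z\<bar> powr p * \<phi> (snd z)))
      + K * (indicator {0..T} (fst z) * \<phi> (snd z))" for z
  proof (cases "fst z \<in> {0..T}")
    case True
    define t y w where "t = fst z / T" and "y = \<bar>h z\<bar>" and "w = time_weight T (fst z)"
    have t: "t \<ge> 0" using True T by (simp add: t_def)
    have w: "0 \<le> w" "w \<le> 1" using time_weight_bounds[OF T True] by (auto simp: w_def)
    have y: "y \<ge> 0" by (simp add: y_def)
    define v where "v = w powr (real (N + 1) / p)"
    have v: "v \<ge> 0" "v powr p = w ^ (N + 1)"
    proof -
      have "v powr p = w powr real (N + 1)" using p by (simp add: v_def powr_powr)
      also have "\<dots> = w ^ (N + 1)" using w by (intro powr_realpow') auto
      finally show "v powr p = w ^ (N + 1)" .
    qed (simp add: v_def)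
    \<comment> \<open>The second derivative of the cutoff vanishes at \<open>T\<close> only to order \<open>N - 2\<close>; the lower
    bound on \<open>N\<close> makes this enough.\<close>
    have wv: "w ^ (N - 2) \<le> v"
    proof (cases "w = 0")
      case True
      have "N \<noteq> 2" using N p by (auto simp: divide_le_0_iff)
      then have "N - 2 \<noteq> 0" using N by simp
      with True show ?thesis by (simp add: v_def power_0_left)
    next
      case False
      then have "w ^ (N - 2) = w powr real (N - 2)" using w by (simp add: powr_realpow)
      also have "\<dots> \<le> v" unfolding v_def using w N by (intro powr_mono') auto
      finally show ?thesis .
    qed
    have 1: "(y * v) * E1 \<le> c * G * (y powr p * w ^ (N + 1)) + (c * G) powr (- (1 / (p - 1))) * E1 powr p'"
      using young_ineq[of "y * v" E1 "c * G" p] y v E c G p by (simp add: powr_mult p'_def)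
    have 2: "(t * (y * v)) * E2 \<le> \<tau> * G * (t powr p * (y powr p * w ^ (N + 1)))
      + (\<tau> * G) powr (- (1 / (p - 1))) * E2 powr p'"
      using young_ineq[of "t * (y * v)" E2 "\<tau> * G" p] t y v E \<tau> G p by (simp add: powr_mult p'_def)
    have "(E1 + t * E2) * w ^ (N - 2) * y \<le> (E1 + t * E2) * v * y"
      using E t y wv by (intro mult_right_mono mult_left_mono) auto
    also have "\<dots> = (y * v) * E1 + (t * (y * v)) * E2" by (simp add: algebra_simps)
    also have "\<dots> \<le> c * G * (y powr p * w ^ (N + 1)) + \<tau> * G * (t powr p * (y powr p * w ^ (N + 1))) + K"
      using 1 2 by (simp add: K_def)
    finally have "(E1 + t * E2) * w ^ (N - 2) * y * \<phi> (snd z)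
      \<le> (c * G * (y powr p * w ^ (N + 1)) + \<tau> * G * (t powr p * (y powr p * w ^ (N + 1))) + K) * \<phi> (snd z)"
      using \<phi>(1) by (rule mult_right_mono)
    then show ?thesis using True by (simp add: t_def y_def w_def algebra_simps)
  qed simp
  have "(\<integral>\<^sup>+ z. ennreal (indicator {0..T} (fst z)
    * ((E1 + fst z / T * E2) * time_weight T (fst z) ^ (N - 2)) * (\<bar>h z\<bar> * \<phi> (snd z))) \<partial>?P)
    \<le> (\<integral>\<^sup>+ z. (ennreal (c * G) * ennreal (indicator {0..T} (fst z)
      * (1 * time_weight T (fst z) ^ (N + 1)) * (\<bar>h z\<bar> powr p * \<phi> (snd z)))
      + ennreal (\<tau> * G) * ennreal (indicator {0..T} (fst z)
        * ((fst z / T) powr p * time_weight T (fst z) ^ (N + 1)) * (\<bar>h z\<bar> powr p * \<phi> (snd z))))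
      + ennreal K * ennreal (indicator {0..T} (fst z) * \<phi> (snd z)) \<partial>?P)"
  proof (rule nn_integral_mono)
    fix z
    have nn: "0 \<le> indicator {0..T} (fst z) * (a * time_weight T (fst z) ^ (N + 1))
      * (\<bar>h z\<bar> powr p * \<phi> (snd z))" if "a \<ge> 0" for a
      using that time_weight_bounds[OF T, of "fst z"] \<phi>(1)[of "snd z"] by (cases "fst z \<in> {0..T}") auto
    have nn3: "0 \<le> indicator {0..T} (fst z) * \<phi> (snd z)" using \<phi>(1)[of "snd z"] by simp
    show "ennreal (indicator {0..T} (fst z) * ((E1 + fst z / T * E2)
      * time_weight T (fst z) ^ (N - 2)) * (\<bar>h z\<bar> * \<phi> (snd z))) \<le>
       (ennreal (c * G) * ennreal (indicator {0..T} (fst z) * (1 * time_weight T (fst z) ^ (N + 1))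
         * (\<bar>h z\<bar> powr p * \<phi> (snd z)))
      + ennreal (\<tau> * G) * ennreal (indicator {0..T} (fst z)
        * ((fst z / T) powr p * time_weight T (fst z) ^ (N + 1)) * (\<bar>h z\<bar> powr p * \<phi> (snd z))))
      + ennreal K * ennreal (indicator {0..T} (fst z) * \<phi> (snd z))"
      using ennreal_leI[OF point[of z]] nn[of 1] nn[of "(fst z / T) powr p"] nn3 c G \<tau> K
      by (simp only: ennreal_plus ennreal_mult' mult_nonneg_nonneg add_nonneg_nonneg less_imp_le
        powr_ge_zero zero_le_one)
  qed
  also have "\<dots> = (ennreal (c * G) * ?X + ennreal (\<tau> * G) * ?Y) + ennreal K
    * (\<integral>\<^sup>+ z. ennreal (indicator {0..T} (fst z) * \<phi> (snd z)) \<partial>?P)"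
    unfolding space_time_energy_def by (simp add: nn_integral_add nn_integral_cmult)
  also have "(\<integral>\<^sup>+ z. ennreal (indicator {0..T} (fst z) * \<phi> (snd z)) \<partial>?P) \<le> ennreal (T * M)"
  proof -
    have "(\<integral>\<^sup>+ z. ennreal (indicator {0..T} (fst z) * \<phi> (snd z)) \<partial>?P)
      = (\<integral>\<^sup>+ t. \<integral>\<^sup>+ x. ennreal (indicator {0..T} t * \<phi> x) \<partial>lborel \<partial>lborel)"
      by (subst lborel.nn_integral_fst[symmetric]) simp_all
    also have "\<dots> = (\<integral>\<^sup>+ t. (\<integral>\<^sup>+ x. ennreal (\<phi> x) \<partial>lborel) * indicator {0..T} t \<partial>lborel)"
      by (intro nn_integral_cong) (auto simp: indicator_def)
    also have "\<dots> = (\<integral>\<^sup>+ x. ennreal (\<phi> x) \<partial>lborel) * ennreal T"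
      using T by (subst nn_integral_cmult_indicator) auto
    also have "\<dots> \<le> ennreal M * ennreal T" using M by (intro mult_right_mono) auto
    finally show ?thesis using T M by (simp add: mult.commute flip: ennreal_mult')
  qed
  finally have R: "(\<integral>\<^sup>+ z. ennreal (indicator {0..T} (fst z)
    * ((E1 + fst z / T * E2) * time_weight T (fst z) ^ (N - 2)) * (\<bar>h z\<bar> * \<phi> (snd z))) \<partial>?P)
    \<le> ennreal (c * G) * ?X + ennreal (\<tau> * G) * ?Y + ennreal K * ennreal (T * M)"
    by (meson add_left_mono mult_left_mono order.trans zero_le)
  have YX: "?Y \<le> ?X"
    using T p \<phi>(1) by (intro late_energy_le) auto
  obtain X where X: "?X = ennreal X" "X \<ge> 0" using weak(2) by (cases ?X) auto
  obtain Y where Y: "?Y = ennreal Y" "Y \<ge> 0" using weak(2) YX by (cases ?Y) (auto simp: top_unique)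
  have "ennreal (2 * c * G) * ennreal X \<le> ennreal (c * G) * ennreal X + ennreal (\<tau> * G) * ennreal Y
    + ennreal K * ennreal (T * M) + ennreal D"
    using order.trans[OF weak(1) add_right_mono[OF R]] by (simp add: X Y c_def)
  also have "\<dots> = ennreal (c * G * X + \<tau> * G * Y + K * (T * M) + D)"
    using c G \<tau> K T M D0 X Y by (simp flip: ennreal_mult' ennreal_plus)
  finally have "ennreal (2 * c * G * X) \<le> ennreal (c * G * X + \<tau> * G * Y + K * (T * M) + D)"
    using X(2) by (simp only: ennreal_mult'')
  then have "2 * c * G * X \<le> c * G * X + \<tau> * G * Y + K * (T * M) + D"
    using c G \<tau> K T M D0 X Y by (subst (asm) ennreal_le_iff)
      (auto intro!: add_nonneg_nonneg mult_nonneg_nonneg)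
  then have "G * (c * X) \<le> G * (\<tau> * Y + (K * (T * M) / G + D / G))"
    using G by (simp add: algebra_simps)
  then have main: "c * X \<le> \<tau> * Y + (K * (T * M) / G + D / G)" using G by simp
  have GD: "D / G = T powr (- (1 - \<gamma>)) * D" unfolding G_def using T
    by (simp add: powr_minus_divide[of T "1 - \<gamma>"] del: minus_diff_eq)
  have GK: "K * (T * M) / G = T powr (1 - (1 - \<gamma>) * p') * M
    * (c powr (- (1 / (p - 1))) * E1 powr p' + \<tau> powr (- (1 / (p - 1))) * E2 powr p')"
  proof -
    define F where "F = c powr (- (1 / (p - 1))) * E1 powr p' + \<tau> powr (- (1 / (p - 1))) * E2 powr p'"
    have "K = G powr (- (1 / (p - 1))) * F"
      using c G \<tau> by (simp add: K_def F_def powr_mult algebra_simps)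
    then have "K * (T * M) / G = (G powr (- (1 / (p - 1))) * G powr (-1) * T powr 1) * M * F"
      using G T by (simp add: powr_minus_divide)
    also have "G powr (- (1 / (p - 1))) * G powr (-1) = G powr (- p')"
    proof -
      have "- (1 / (p - 1)) + - 1 = - p'" using p by (simp add: p'_def field_simps)
      then show ?thesis by (simp only: powr_add[symmetric])
    qed
    also have "G powr (- p') * T powr 1 = T powr (1 - (1 - \<gamma>) * p')"
    proof -
      have "(1 - \<gamma>) * - p' + 1 = 1 - (1 - \<gamma>) * p'" by (simp add: algebra_simps)
      then show ?thesis unfolding G_def powr_powr by (simp only: powr_add[symmetric])
    qed
    finally show ?thesis by (simp add: F_def)
  qed
  have "ennreal (c * X) \<le> ennreal (\<tau> * Y + (K * (T * M) / G + D / G))" using main by (rule ennreal_leI)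
  also have "\<dots> = ennreal \<tau> * ennreal Y + ennreal (K * (T * M) / G + D / G)"
    using \<tau> Y K T M G D0 by (simp add: ennreal_mult')
  finally have "ennreal c * ?X \<le> ennreal \<tau> * ?Y + ennreal (K * (T * M) / G + D / G)"
    using c by (simp add: X Y ennreal_mult')
  then show ?thesis unfolding GD GK unfolding E1_def E2_def D_def .
qed

section \<open>Scaling limits\<close>

text \<open>What Young's inequality leaves on the right-hand side: the coefficients to the power \<open>p'\<close>, times the
  space-time volume \<open>T * \<mu> powr d\<close>, divided by the gain \<open>T powr (1 - \<gamma>)\<close> of the memory term to the
  power \<open>p'\<close>.\<close>

definition scaling_remainder :: "real \<Rightarrow> real \<Rightarrow> real \<Rightarrow> real \<Rightarrow> real \<Rightarrow> real \<Rightarrow> real \<Rightarrow> real" where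
  "scaling_remainder p \<gamma> \<theta> d \<tau> T \<mu> = (let p' = p / (p - 1) in
     T powr (1 - (1 - \<gamma>) * p') * \<mu> powr d *
       ((1 / \<mu> + 1 / T\<^sup>2) powr p' + \<tau> powr (- (1 / (p - 1))) * (T powr (-1) * \<mu> powr (- \<theta>)) powr p'))"

lemma scaled_energy_estimate:
  fixes h :: "real \<times> 'a::euclidean_space \<Rightarrow> real" and p \<gamma> \<theta> :: real
  assumes h [measurable]: "h \<in> borel_measurable (borel \<Otimes>\<^sub>M borel)"
    and \<theta>: "0 \<le> \<theta>" "\<theta> < 1" and \<gamma>: "0 \<le> \<gamma>" and p: "p > 1"
    and sol: "\<And>T. T > 0 \<Longrightarrow> weak_solution_on \<theta> \<gamma> p u0 u1 T (\<lambda>t x. h (t, x))"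
    and data: "integrable lborel u0" "integrable lborel u1"
  defines "d \<equiv> real DIM('a) / 2"
  obtains \<kappa> c A :: real and N where "\<kappa> > 0" "c > 0" "A \<ge> 0"
    "\<And>T \<mu> \<tau>. T \<ge> 1 \<Longrightarrow> \<mu> \<ge> 1 \<Longrightarrow> \<tau> > 0 \<Longrightarrow>
       ennreal c * space_time_energy T N p h (bracket_power (- \<kappa>) \<mu>) (\<lambda>_. 1) \<le>
       ennreal \<tau> * space_time_energy T N p h (bracket_power (- \<kappa>) \<mu>) (\<lambda>t. (t / T) powr p) +
       ennreal (A * (scaling_remainder p \<gamma> \<theta> d \<tau> T \<mu> + T powr (- (1 - \<gamma>))))"
    "\<And>T \<mu>. T \<ge> 1 \<Longrightarrow> \<mu> \<ge> 1 \<Longrightarrow> space_time_energy T N p h (bracket_power (- \<kappa>) \<mu>) (\<lambda>_. 1) < \<infinity>"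
proof -
  obtain \<kappa> C where \<kappa>: "\<kappa> > 0" and C: "C \<ge> 0"
    and test: "\<And>\<mu>. \<mu> > 0 \<Longrightarrow> (bracket_power (- \<kappa>) \<mu> :: 'a \<Rightarrow> real) \<in> test_functions \<theta>"
    and frac: "\<And>\<mu>. \<mu> > 0 \<Longrightarrow> \<exists>g. has_frac_laplacian \<theta> (bracket_power (- \<kappa>) \<mu> :: 'a \<Rightarrow> real) g \<and>
        (\<forall>x. \<bar>g x\<bar> \<le> C * \<mu> powr (- \<theta>) * bracket_power (- \<kappa>) \<mu> x)"
    and lap: "\<And>\<mu> (x::'a). \<mu> > 0 \<Longrightarrow> \<bar>laplacian (bracket_power (- \<kappa>) \<mu>) x\<bar> \<le> C * \<mu> powr (-1)
      * bracket_power (- \<kappa>) \<mu> x"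
    and bilap: "\<And>\<mu> (x::'a). \<mu> > 0 \<Longrightarrow> \<bar>laplacian (laplacian (bracket_power (- \<kappa>) \<mu>)) x\<bar> \<le> C
      * \<mu> powr (-2) * bracket_power (- \<kappa>) \<mu> x"
    and mass: "\<And>\<mu>. \<mu> > 0 \<Longrightarrow> (\<integral>\<^sup>+ x. ennreal (bracket_power (- \<kappa>) \<mu> (x::'a)) \<partial>lborel)
      \<le> ennreal (C * \<mu> powr d)"
    using test_function_family[OF \<theta>, where 'a='a] unfolding d_def by blast
  define p' where "p' = p / (p - 1)"
  have p': "p' > 0" using p by (simp add: p'_def)
  \<comment> \<open>Large enough that two derivatives of the cutoff are bounded by the power \<open>1/p\<close>
    of the energy weight.\<close>
  define N where "N = nat \<lceil>(1 + 2 * p) / (p - 1)\<rceil> + 2"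
  have N: "N \<ge> 2" by (simp add: N_def)
  have N': "real (N + 1) / p \<le> real (N - 2)"
  proof -
    have "(1 + 2 * p) / (p - 1) \<le> real N" unfolding N_def by linarith
    then have "1 + 2 * p \<le> real N * (p - 1)" using p by (simp add: pos_divide_le_eq)
    moreover have "real (N - 2) = real N - 2" using N by simp
    ultimately have "real (N + 1) \<le> real (N - 2) * p" by (simp add: algebra_simps)
    then show ?thesis using p by (simp only: pos_divide_le_eq)
  qed
  define B where "B = 2 * real N + 4 * (real N)\<^sup>2"
  have B: "B \<ge> 0" by (simp add: B_def)
  define c where "c = (1/4) ^ (N + 1) / (2::real)"
  have c: "c > 0" by (simp add: c_def)
  define U0 U1 where "U0 = (LINT x|lborel. \<bar>u0 x\<bar>)" and "U1 = (LINT x|lborel. \<bar>u1 x\<bar>)"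
  have U: "U0 \<ge> 0" "U1 \<ge> 0" by (auto simp: U0_def U1_def)
  define c' where "c' = c powr (- (1 / (p - 1)))"
  have c': "c' \<ge> 0" by (simp add: c'_def)
  define q where "q = 2 * C + B * (1 + C)"
  have q: "q \<ge> 0" using C B by (simp add: q_def)
  define A where "A = C * (c' * q powr p' + (B * C) powr p') + (C * U0 + (1 + C) * U1)"
  have A: "C * (c' * q powr p') \<le> A" "C * (B * C) powr p' \<le> A" "C * U0 + (1 + C) * U1 \<le> A" "A \<ge> 0"
    using C U c' by (auto simp: A_def distrib_left)
  have est: "ennreal c * space_time_energy T N p h (bracket_power (- \<kappa>) \<mu>) (\<lambda>_. 1) \<le>
       ennreal \<tau> * space_time_energy T N p h (bracket_power (- \<kappa>) \<mu>) (\<lambda>t. (t / T) powr p) +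
       ennreal (A * (scaling_remainder p \<gamma> \<theta> d \<tau> T \<mu> + T powr (- (1 - \<gamma>)))) \<and>
       space_time_energy T N p h (bracket_power (- \<kappa>) \<mu>) (\<lambda>_. 1) < \<infinity>"
    if T: "T \<ge> 1" and \<mu>: "\<mu> \<ge> 1" and \<tau>: "\<tau> > 0" for T \<mu> \<tau>
  proof -
    have T0: "T > 0" and \<mu>0: "\<mu> > 0" using T \<mu> by auto
    obtain g where g: "has_frac_laplacian \<theta> (bracket_power (- \<kappa>) \<mu> :: 'a \<Rightarrow> real) g"
      "\<And>x. \<bar>g x\<bar> \<le> C * \<mu> powr (- \<theta>) * bracket_power (- \<kappa>) \<mu> x" using frac[OF \<mu>0] by blast
    have \<phi>: "0 \<le> bracket_power (- \<kappa>) \<mu> x" "bracket_power (- \<kappa>) \<mu> x \<le> 1" for x :: 'a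
      using \<kappa> by (auto intro!: bracket_nonneg bracket_le_1[OF \<mu>0])
    have nn: "0 \<le> C * \<mu> powr (- \<theta>)" "0 \<le> C * \<mu> powr (-1)" "0 \<le> C * \<mu> powr (-2)" "0 \<le> C * \<mu> powr d"
      using C by auto
    note we = weak_energy_estimate[OF h bracket_meas \<phi> T0 \<gamma> N N' p sol[OF T0] test[OF \<mu>0] g(1) nn(1)
      g(2) nn(2) lap[OF \<mu>0] nn(3) bilap[OF \<mu>0] data
        mass[OF \<mu>0] nn(4) \<tau>, folded p'_def B_def c_def, folded c'_def U0_def U1_def]
    note fin = weak_solution_inequality(2)[OF h bracket_meas \<phi> T0 \<gamma> N sol[OF T0] test[OF \<mu>0] g(1)
      nn(1) g(2) nn(2) lap[OF \<mu>0] nn(3) bilap[OF \<mu>0] data]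
    have m: "\<mu> powr (- \<theta>) \<le> 1" "\<mu> powr (-1) = 1 / \<mu>" "\<mu> powr (-1) \<le> 1" "\<mu> powr (-2) \<le> 1 / \<mu>"
    proof -
      show "\<mu> powr (- \<theta>) \<le> 1" using powr_mono[of "- \<theta>" 0 \<mu>] \<mu> \<theta> by simp
      show m1: "\<mu> powr (-1) = 1 / \<mu>" using \<mu>0 by (simp add: powr_minus_divide)
      show "\<mu> powr (-1) \<le> 1" using m1 \<mu> by simp
      show "\<mu> powr (-2) \<le> 1 / \<mu>" using powr_mono[of "-2" "-1" \<mu>] \<mu> m1 by simp
    qed
    have im: "0 \<le> 1 / \<mu>" "1 / \<mu> \<le> 1" using \<mu> by auto
    define s where "s = 1 / \<mu> + 1 / T\<^sup>2"
    define \<tau>' where "\<tau>' = \<tau> powr (- (1 / (p - 1)))"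
    define r where "r = (T powr (-1) * \<mu> powr (- \<theta>)) powr p'"
    define P where "P = T powr (1 - (1 - \<gamma>) * p')"
    have nn2: "s \<ge> 0" "\<tau>' \<ge> 0" "r \<ge> 0" "P \<ge> 0" using im by (auto simp: s_def \<tau>'_def r_def P_def)
    define e1 where "e1 = C * \<mu> powr (-1) + C * \<mu> powr (-2) + B / T\<^sup>2 * (1 + C * \<mu> powr (-1))"
    have e1: "e1 \<ge> 0" using C B by (simp add: e1_def)
    have E1: "e1 powr p' \<le> q powr p' * s powr p'"
    proof -
      have "e1 \<le> C * (1 / \<mu>) + C * (1 / \<mu>) + B / T\<^sup>2 * (1 + C * 1)"
        unfolding e1_def using m C B by (intro add_mono mult_left_mono) auto
      also have "\<dots> = 2 * C * (1 / \<mu>) + B * (1 + C) * (1 / T\<^sup>2)" by simp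
      also have "\<dots> \<le> q * (1 / \<mu>) + q * (1 / T\<^sup>2)"
        using im C B by (intro add_mono mult_right_mono) (auto simp: q_def)
      also have "\<dots> = q * s" by (simp add: s_def distrib_left)
      finally have "e1 powr p' \<le> (q * s) powr p'"
        using e1 p' by (intro powr_mono2) auto
      then show ?thesis using q nn2 by (simp add: powr_mult)
    qed
    have E2: "(B / T * (C * \<mu> powr (- \<theta>))) powr p' = (B * C) powr p' * r"
    proof -
      have "B / T * (C * \<mu> powr (- \<theta>)) = (B * C) * (T powr (-1) * \<mu> powr (- \<theta>))"
        using T0 by (simp add: powr_minus_divide)
      then show ?thesis unfolding r_def using B C by (simp only: powr_mult)
    qed
    have D: "C * \<mu> powr (- \<theta>) * U0 + (1 + C * \<mu> powr (-1)) * U1 \<le> A"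
    proof -
      have "C * \<mu> powr (- \<theta>) * U0 + (1 + C * \<mu> powr (-1)) * U1 \<le> C * 1 * U0 + (1 + C * 1) * U1"
        using m C U by (intro add_mono mult_right_mono mult_left_mono add_left_mono) auto
      with A(3) show ?thesis by simp
    qed
    have main: "P * (C * \<mu> powr d) * (c' * e1 powr p' + \<tau>' * (B / T * (C * \<mu> powr (- \<theta>))) powr p')
      \<le> A * (P * \<mu> powr d * (s powr p' + \<tau>' * r))"
    proof -
      have "C * (c' * e1 powr p' + \<tau>' * (B / T * (C * \<mu> powr (- \<theta>))) powr p')
        \<le> C * (c' * (q powr p' * s powr p') + \<tau>' * ((B * C) powr p' * r))"
        unfolding E2 using E1 C c' by (intro mult_left_mono add_right_mono) auto
      also have "\<dots> = (C * (c' * q powr p')) * s powr p' + (C * (B * C) powr p') * (\<tau>' * r)"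
        by (simp add: algebra_simps)
      also have "\<dots> \<le> A * s powr p' + A * (\<tau>' * r)"
        using A nn2 by (intro add_mono mult_right_mono) auto
      finally have "(P * \<mu> powr d) * (C * (c' * e1 powr p' + \<tau>' * (B / T * (C * \<mu> powr (- \<theta>))) powr p'))
        \<le> (P * \<mu> powr d) * (A * s powr p' + A * (\<tau>' * r))"
        using nn2 by (intro mult_left_mono) auto
      then show ?thesis by (simp only: mult_ac distrib_left)
    qed
    have "P * (C * \<mu> powr d) * (c' * e1 powr p' + \<tau>' * (B / T * (C * \<mu> powr (- \<theta>))) powr p')
       + T powr (- (1 - \<gamma>)) * (C * \<mu> powr (- \<theta>) * U0 + (1 + C * \<mu> powr (-1)) * U1)
      \<le> A * (P * \<mu> powr d * (s powr p' + \<tau>' * r)) + T powr (- (1 - \<gamma>)) * A"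
      using D by (intro add_mono main mult_left_mono) auto
    also have "\<dots> = A * (P * \<mu> powr d * (s powr p' + \<tau>' * r) + T powr (- (1 - \<gamma>)))"
      by (simp add: distrib_left)
    finally show ?thesis
      using we fin unfolding scaling_remainder_def Let_def p'_def[symmetric] e1_def[symmetric]
        s_def[symmetric] \<tau>'_def[symmetric] r_def[symmetric] P_def[symmetric]
      by (blast intro: order.trans add_left_mono ennreal_leI)
  qed
  show thesis
    by (rule that[OF \<kappa> c A(4)]) (use est[of _ _ 1] est in auto)
qed

definition total_energy :: "real \<Rightarrow> (real \<times> 'a::euclidean_space \<Rightarrow> real) \<Rightarrow> ('a \<Rightarrow> real) \<Rightarrow> ennreal" where
  "total_energy p h \<phi> = (\<integral>\<^sup>+ z. ennreal (indicator {0..} (fst z) * (\<bar>h z\<bar> powr p * \<phi> (snd z)))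
    \<partial>(lborel \<Otimes>\<^sub>M lborel))"

text \<open>Fatou's lemma; the time weights tend to 1 pointwise.\<close>

lemma total_energy_le_limit:
  fixes h :: "real \<times> 'a::euclidean_space \<Rightarrow> real"
  assumes [measurable]: "h \<in> borel_measurable (borel \<Otimes>\<^sub>M borel)" "\<And>k. \<phi> k \<in> borel_measurable borel"
    and T: "filterlim T at_top sequentially" and \<phi>: "\<And>x. (\<lambda>k. \<phi> k x) \<longlonglongrightarrow> \<phi>' x"
    and le: "eventually (\<lambda>k. space_time_energy (T k) N p h (\<phi> k) (\<lambda>_. 1) \<le> b k) sequentially"
      and b: "b \<longlonglongrightarrow> b'"
  shows "total_energy p h \<phi>' \<le> b'"
proof -
  define f where "f = (\<lambda>k z. ennreal (indicator {0..T k} (fst z)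
    * (1 * time_weight (T k) (fst z) ^ (N + 1)) * (\<bar>h z\<bar> powr p * \<phi> k (snd z))))"
  have lim: "(\<lambda>k. f k z) \<longlonglongrightarrow> ennreal (indicator {0..} (fst z) * (\<bar>h z\<bar> powr p * \<phi>' (snd z)))"
    for z :: "real \<times> 'a"
  proof -
    have ind: "(\<lambda>k. indicator {0..T k} (fst z) :: real) \<longlonglongrightarrow> indicator {0..} (fst z)"
    proof (rule tendsto_eventually)
      show "eventually (\<lambda>k. indicator {0..T k} (fst z) = (indicator {0..} (fst z) :: real)) sequentially"
        using filterlim_at_top[THEN iffD1, OF T, rule_format, of "fst z"]
          by eventually_elim (auto simp: indicator_def)
    qed
    have "(\<lambda>k. fst z / T k) \<longlonglongrightarrow> 0"
      using T by (intro tendsto_divide_0[OF tendsto_const] filterlim_at_top_imp_at_infinity)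
    then have "(\<lambda>k. time_weight (T k) (fst z)) \<longlonglongrightarrow> 1 - 0\<^sup>2" unfolding time_weight_def
      by (intro tendsto_intros)
    then have c: "(\<lambda>k. 1 * time_weight (T k) (fst z) ^ (N + 1)) \<longlonglongrightarrow> 1 * (1 - 0\<^sup>2) ^ (N + 1)"
      by (intro tendsto_mult tendsto_const tendsto_power)
    have "(\<lambda>k. indicator {0..T k} (fst z) * (1 * time_weight (T k) (fst z) ^ (N + 1))
      * (\<bar>h z\<bar> powr p * \<phi> k (snd z))) \<longlonglongrightarrow>
        indicator {0..} (fst z) * (1 * (1 - 0\<^sup>2) ^ (N + 1)) * (\<bar>h z\<bar> powr p * \<phi>' (snd z))"
      by (rule tendsto_mult[OF tendsto_mult[OF ind c] tendsto_mult[OF tendsto_const \<phi>]])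
    then show ?thesis unfolding f_def by (intro tendsto_ennrealI) simp
  qed
  have "total_energy p h \<phi>' = (\<integral>\<^sup>+ z. liminf (\<lambda>k. f k z) \<partial>(lborel \<Otimes>\<^sub>M lborel))"
    unfolding total_energy_def using lim_imp_Liminf[OF _ lim] by simp
  also have "\<dots> \<le> liminf (\<lambda>k. \<integral>\<^sup>+ z. f k z \<partial>(lborel \<Otimes>\<^sub>M lborel))"
    by (rule nn_integral_liminf) (simp add: f_def)
  also have "\<dots> \<le> liminf b"
    using le by (intro Liminf_mono) (auto simp: f_def space_time_energy_def elim: eventually_mono)
  also have "\<dots> = b'" using b by (simp add: lim_imp_Liminf)
  finally show ?thesis .
qed

text \<open>For finite total energy, the part weighted towards times comparable with \<open>T\<close> is negligible. This is
  what decides the critical case.\<close>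

lemma late_energy_vanishes:
  fixes h :: "real \<times> 'a::euclidean_space \<Rightarrow> real"
  assumes [measurable]: "h \<in> borel_measurable (borel \<Otimes>\<^sub>M borel)"
    and \<phi>m [measurable]: "\<And>k. \<phi> k \<in> borel_measurable borel" and \<phi>: "\<And>k x. 0 \<le> \<phi> k x" "\<And>k x. \<phi> k x \<le> 1"
    and T: "filterlim T at_top sequentially" "\<And>k. T k > 0" and p: "p > 0"
    and fin: "total_energy p h (\<lambda>_. 1) < \<infinity>"
  shows "(\<lambda>k. space_time_energy (T k) N p h (\<phi> k) (\<lambda>t. (t / T k) powr p)) \<longlonglongrightarrow> 0"
proof -
  define f where "f = (\<lambda>k z. indicator {0..T k} (fst z)
    * ((fst z / T k) powr p * time_weight (T k) (fst z) ^ (N + 1)) * (\<bar>h z\<bar> powr p * \<phi> k (snd z)))"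
  have [measurable]: "f k \<in> borel_measurable (borel \<Otimes>\<^sub>M borel)" for k unfolding f_def by measurable
  have eq: "space_time_energy (T k) N p h (\<phi> k) (\<lambda>t. (t / T k) powr p)
    = (\<integral>\<^sup>+ z. ennreal (f k z) \<partial>(lborel \<Otimes>\<^sub>M lborel))" for k
    by (simp only: space_time_energy_def f_def)
  have "(\<lambda>k. space_time_energy (T k) N p h (\<phi> k) (\<lambda>t. (t / T k) powr p))
    \<longlonglongrightarrow> (\<integral>\<^sup>+ z. 0 \<partial>((lborel \<Otimes>\<^sub>M lborel) :: (real \<times> 'a) measure))"
    unfolding eq
  proof (rule nn_integral_dominated_convergence[where w
    = "\<lambda>z. ennreal (indicator {0..} (fst z) * (\<bar>h z\<bar> powr p * 1))"])
    show "(\<integral>\<^sup>+ z. ennreal (indicator {0..} (fst z) * (\<bar>h z\<bar> powr p * 1)) \<partial>(lborel \<Otimes>\<^sub>M lborel)) < \<infinity>"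
      using fin by (simp add: total_energy_def)
    have bound: "0 \<le> f k z \<and> f k z \<le> (indicator {0..} (fst z) * (fst z / T k) powr p) * \<bar>h z\<bar> powr p \<and>
       (indicator {0..T k} (fst z) * (fst z / T k) powr p) \<le> 1" for k z
    proof (cases "fst z \<in> {0..T k}")
      case True
      have z: "0 \<le> time_weight (T k) (fst z)" "time_weight (T k) (fst z) \<le> 1"
        using time_weight_bounds[OF T(2) True] by auto
      then have z': "time_weight (T k) (fst z) ^ (N + 1) \<le> 1" by (intro power_le_one)
      have t1: "(fst z / T k) powr p \<le> 1" using True T(2)[of k] p by (intro powr_le1) auto
      have "(fst z / T k) powr p * time_weight (T k) (fst z) ^ (N + 1)
        * (\<bar>h z\<bar> powr p * \<phi> k (snd z)) \<le> (fst z / T k) powr p * 1 * (\<bar>h z\<bar> powr p * 1)"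
        using z z' \<phi> by (intro mult_mono mult_left_mono) auto
      then show ?thesis using True z \<phi> t1 by (auto simp: f_def)
    next
      case False
      then show ?thesis by (simp add: f_def)
    qed
    show "AE z in lborel \<Otimes>\<^sub>M lborel. ennreal (f k z)
      \<le> ennreal (indicator {0..} (fst z) * (\<bar>h z\<bar> powr p * 1))" for k
    proof (intro AE_I2 ennreal_leI)
      fix z :: "real \<times> 'a"
      show "f k z \<le> indicator {0..} (fst z) * (\<bar>h z\<bar> powr p * 1)"
      proof (cases "fst z \<in> {0..T k}")
        case True
        then have "(indicator {0..} (fst z) * (fst z / T k) powr p) * \<bar>h z\<bar> powr p \<le> 1 * \<bar>h z\<bar> powr p"
          using bound[of k z] by (intro mult_right_mono) auto
        then show ?thesis using bound[of k z] True by auto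
      qed (simp add: f_def)
    qed
    show "AE z in lborel \<Otimes>\<^sub>M lborel. (\<lambda>k. ennreal (f k z)) \<longlonglongrightarrow> 0"
    proof (rule AE_I2)
      fix z :: "real \<times> 'a"
      have "(\<lambda>k. fst z / T k) \<longlonglongrightarrow> 0"
        using T by (intro tendsto_divide_0[OF tendsto_const] filterlim_at_top_imp_at_infinity)
      then have "(\<lambda>k. \<bar>fst z / T k\<bar>) \<longlonglongrightarrow> 0" by (rule tendsto_rabs_zero)
      then have "(\<lambda>k. \<bar>fst z / T k\<bar> powr p) \<longlonglongrightarrow> 0"
        using p by (intro tendsto_zero_powrI) auto
      then have "(\<lambda>k. \<bar>fst z / T k\<bar> powr p * \<bar>h z\<bar> powr p) \<longlonglongrightarrow> 0 * \<bar>h z\<bar> powr p" by (intro tendsto_intros)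
      then have lim: "(\<lambda>k. \<bar>fst z / T k\<bar> powr p * \<bar>h z\<bar> powr p) \<longlonglongrightarrow> 0" by simp
      have "(\<lambda>k. f k z) \<longlonglongrightarrow> 0"
      proof (rule tendsto_sandwich[OF _ _ tendsto_const lim])
        show "\<forall>\<^sub>F k in sequentially. 0 \<le> f k z"
          using bound[of _ z] by (intro always_eventually) auto
        show "\<forall>\<^sub>F k in sequentially. f k z \<le> \<bar>fst z / T k\<bar> powr p * \<bar>h z\<bar> powr p"
        proof (intro always_eventually allI)
          fix k
          have "(indicator {0..} (fst z) * (fst z / T k) powr p) * \<bar>h z\<bar> powr p
            \<le> \<bar>fst z / T k\<bar> powr p * \<bar>h z\<bar> powr p"
            using T(2)[of k] by (intro mult_right_mono) (auto simp: indicator_def)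
          then show "f k z \<le> \<bar>fst z / T k\<bar> powr p * \<bar>h z\<bar> powr p"
            using bound[of k z] by linarith
        qed
      qed
      from tendsto_ennrealI[OF this]
      show "(\<lambda>k. ennreal (f k z)) \<longlonglongrightarrow> 0" by simp
    qed
  qed simp_all
  then show ?thesis by simp
qed

lemma ennreal_absorb:
  assumes le: "ennreal c * X \<le> ennreal (c / 2) * X + ennreal R" and X: "X < \<infinity>" and c: "c > 0" and R: "R \<ge> 0"
  shows "X \<le> ennreal (2 / c * R)"
proof -
  obtain x where x: "X = ennreal x" "x \<ge> 0" using X by (cases X) auto
  have "ennreal (c * x) \<le> ennreal (c / 2 * x) + ennreal R"
    using le x(2) unfolding x(1) by (simp only: ennreal_mult'')
  also have "\<dots> = ennreal (c / 2 * x + R)" using x c R by simp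
  finally have "c * x \<le> c / 2 * x + R"
    using x c R by (subst (asm) ennreal_le_iff) auto
  then have "x \<le> 2 / c * R" using c by (simp add: field_simps)
  then show ?thesis unfolding x by (rule ennreal_leI)
qed

text \<open>With \<open>\<mu> = 1\<close> the remainder decays like \<open>T powr (1 - (1 - \<gamma>) * p')\<close>, and the exponent is negative
  exactly when \<open>p * \<gamma> < 1\<close>.\<close>

lemma energy_zero_below_inverse_gamma:
  fixes h :: "real \<times> 'a::euclidean_space \<Rightarrow> real" and p \<gamma> \<theta> :: real
  assumes h [measurable]: "h \<in> borel_measurable (borel \<Otimes>\<^sub>M borel)"
    and \<theta>: "0 \<le> \<theta>" "\<theta> < 1" and \<gamma>: "0 \<le> \<gamma>" "\<gamma> < 1" and p: "p > 1"
    and sol: "\<And>T. T > 0 \<Longrightarrow> weak_solution_on \<theta> \<gamma> p u0 u1 T (\<lambda>t x. h (t, x))"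
    and data: "integrable lborel u0" "integrable lborel u1"
    and small: "p * \<gamma> < 1"
  shows "\<exists>\<kappa>. total_energy p h (bracket_power (- \<kappa>) 1) = 0"
proof -
  define p' where "p' = p / (p - 1)"
  define d where "d = real DIM('a) / 2"
  obtain \<kappa> c A :: real and N where \<kappa>: "\<kappa> > 0" and c: "c > 0" and A: "A \<ge> 0"
    and est: "\<And>T \<mu> \<tau>. T \<ge> 1 \<Longrightarrow> \<mu> \<ge> 1 \<Longrightarrow> \<tau> > 0 \<Longrightarrow>
       ennreal c * space_time_energy T N p h (bracket_power (- \<kappa>) \<mu>) (\<lambda>_. 1) \<le>
       ennreal \<tau> * space_time_energy T N p h (bracket_power (- \<kappa>) \<mu>) (\<lambda>t. (t / T) powr p) +
       ennreal (A * (scaling_remainder p \<gamma> \<theta> d \<tau> T \<mu> + T powr (- (1 - \<gamma>))))"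
    and fin: "\<And>T \<mu>. T \<ge> 1 \<Longrightarrow> \<mu> \<ge> 1 \<Longrightarrow> space_time_energy T N p h (bracket_power (- \<kappa>) \<mu>) (\<lambda>_. 1) < \<infinity>"
    using scaled_energy_estimate[OF h \<theta> \<gamma>(1) p sol data] unfolding d_def by metis
  have p': "p' > 0" using p by (simp add: p'_def)
  define \<tau>' where "\<tau>' = (c / 2) powr (- (1 / (p - 1)))"
  have \<tau>': "\<tau>' \<ge> 0" by (simp add: \<tau>'_def)
  define T where "T = (\<lambda>k. real (Suc k))"
  have T: "T k \<ge> 1" "T k > 0" for k by (auto simp: T_def)
  have Tlim: "filterlim T at_top sequentially"
    unfolding T_def by (rule filterlim_compose[OF filterlim_real_sequentially filterlim_Suc])
  define b where "b = (\<lambda>k. 2 / c * (A * (T k powr (1 - (1 - \<gamma>) * p') * (2 powr p' + \<tau>')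
    + T k powr (- (1 - \<gamma>)))))"
  have e: "1 - (1 - \<gamma>) * p' < 0"
  proof -
    have "p - 1 < (1 - \<gamma>) * p" using small by (simp add: algebra_simps)
    then have "1 < (1 - \<gamma>) * p / (p - 1)" using p by (simp add: pos_less_divide_eq)
    then show ?thesis by (simp add: p'_def)
  qed
  have "total_energy p h (bracket_power (- \<kappa>) 1) \<le> ennreal (2 / c * (A * (0 * (2 powr p' + \<tau>') + 0)))"
  proof (rule total_energy_le_limit[OF h bracket_meas Tlim tendsto_const])
    show "(\<lambda>k. ennreal (b k)) \<longlonglongrightarrow> ennreal (2 / c * (A * (0 * (2 powr p' + \<tau>') + 0)))"
      unfolding b_def using e \<gamma> by (intro tendsto_intros tendsto_neg_powr Tlim) auto
    show "\<forall>\<^sub>F k in sequentially. space_time_energy (T k) N p h (bracket_power (- \<kappa>) 1) (\<lambda>_. 1)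
      \<le> ennreal (b k)"
    proof (intro always_eventually allI)
      fix k
      define R where "R = A * (T k powr (1 - (1 - \<gamma>) * p') * (2 powr p' + \<tau>') + T k powr (- (1 - \<gamma>)))"
      have R: "R \<ge> 0" using A \<tau>' by (auto simp: R_def intro!: mult_nonneg_nonneg add_nonneg_nonneg)
      let ?X = "space_time_energy (T k) N p h (bracket_power (- \<kappa>) 1) (\<lambda>_. 1)"
      have "(1 / 1 + 1 / (T k)\<^sup>2) powr p' \<le> 2 powr p'"
        using T[of k] p' by (intro powr_mono2) (auto simp: field_simps)
      moreover have "\<tau>' * (T k powr (-1) * 1 powr (- \<theta>)) powr p' \<le> \<tau>' * 1"
        using T[of k] p' \<tau>' by (intro mult_left_mono powr_le1) (auto simp: powr_minus_divide)
      ultimately have "scaling_remainder p \<gamma> \<theta> d (c / 2) (T k) 1 \<le> T k powr (1 - (1 - \<gamma>) * p')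
        * 1 powr d * (2 powr p' + \<tau>')"
        unfolding scaling_remainder_def Let_def p'_def[symmetric] \<tau>'_def[symmetric]
          by (intro mult_left_mono) auto
      then have "A * (scaling_remainder p \<gamma> \<theta> d (c / 2) (T k) 1 + T k powr (- (1 - \<gamma>))) \<le> R"
        unfolding R_def using A by (intro mult_left_mono add_right_mono) auto
      then have "ennreal c * ?X \<le> ennreal (c / 2) * ?X + ennreal R"
        using est[OF T(1)[of k] order_refl, of "c / 2"] c
          late_energy_le[of "T k" p "bracket_power (- \<kappa>) 1" N h] T[of k] p
        by (meson add_mono bracket_nonneg ennreal_leI half_gt_zero less_trans mult_left_mono
          order.trans zero_le zero_less_one)
      from ennreal_absorb[OF this fin[OF T(1) order_refl] c R]
      show "?X \<le> ennreal (b k)" by (simp add: b_def R_def)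
    qed
  qed
  then show ?thesis by (intro exI[of _ \<kappa>]) simp
qed

text \<open>For \<open>\<mu> = K * T powr a\<close> with \<open>a = 1/(1 - \<theta>)\<close> the terms \<open>1/\<mu>\<close> and \<open>T powr (-1) * \<mu> powr (-\<theta>)\<close> have the same
  power of \<open>T\<close>, and \<open>1/T\<^sup>2\<close> is of lower order. The factor \<open>K powr (-\<theta>)\<close> of the second is estimated by 1,
  since that term is later made small by \<open>\<tau>'\<close>.\<close>

lemma parabolic_scaling_bound:
  fixes p' d \<theta> \<gamma> K T \<tau>' :: real
  assumes p': "p' > 0" and \<theta>: "0 \<le> \<theta>" "\<theta> < 1" and K: "K \<ge> 1" and T: "T \<ge> 1" and \<tau>': "\<tau>' \<ge> 0"
  defines "a \<equiv> 1 / (1 - \<theta>)"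
  defines "\<mu> \<equiv> K * T powr a"
  assumes le: "\<mu> \<le> T\<^sup>2" and e: "1 - (1 - \<gamma>) * p' + a * d - a * p' \<le> 0"
  shows "T powr (1 - (1 - \<gamma>) * p') * \<mu> powr d
    * ((1 / \<mu> + 1 / T\<^sup>2) powr p' + \<tau>' * (T powr (-1) * \<mu> powr (- \<theta>)) powr p')
    \<le> K powr d * (2 powr p' * K powr (- p') + \<tau>')"
proof -
  have \<mu>: "\<mu> > 0" using K T by (simp add: \<mu>_def)
  have 1: "(1 / \<mu> + 1 / T\<^sup>2) powr p' \<le> 2 powr p' * K powr (- p') * T powr (- (a * p'))"
  proof -
    have "1 / T\<^sup>2 \<le> 1 / \<mu>" using le \<mu> T by (intro divide_left_mono mult_pos_pos) auto
    then have "(1 / \<mu> + 1 / T\<^sup>2) powr p' \<le> (2 / \<mu>) powr p'" using \<mu> p' T by (intro powr_mono2) auto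
    also have "\<dots> = 2 powr p' * K powr (- p') * T powr (- (a * p'))"
      using K T by (simp add: \<mu>_def powr_divide powr_mult powr_powr powr_minus_divide)
    finally show ?thesis .
  qed
  have 2: "(T powr (-1) * \<mu> powr (- \<theta>)) powr p' \<le> T powr (- (a * p'))"
  proof -
    have "T powr (-1) * \<mu> powr (- \<theta>) = K powr (- \<theta>) * (T powr (-1) * T powr (- (a * \<theta>)))"
      using K T by (simp add: \<mu>_def powr_mult powr_powr)
    also have "T powr (-1) * T powr (- (a * \<theta>)) = T powr (- a)"
    proof -
      have "-1 + - (a * \<theta>) = - a" using \<theta> by (simp add: a_def field_simps)
      then show ?thesis by (simp only: powr_add[symmetric])
    qed
    also have "K powr (- \<theta>) * T powr (- a) \<le> 1 * T powr (- a)"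
      using powr_mono[of "- \<theta>" 0 K] K \<theta> by (intro mult_right_mono) auto
    finally have "(T powr (-1) * \<mu> powr (- \<theta>)) powr p' \<le> (1 * T powr (- a)) powr p'"
      using p' by (intro powr_mono2) auto
    then show ?thesis by (simp add: powr_powr)
  qed
  have "(1 / \<mu> + 1 / T\<^sup>2) powr p' + \<tau>' * (T powr (-1) * \<mu> powr (- \<theta>)) powr p'
    \<le> 2 powr p' * K powr (- p') * T powr (- (a * p')) + \<tau>' * T powr (- (a * p'))"
    using 1 2 \<tau>' by (intro add_mono mult_left_mono) auto
  then have "T powr (1 - (1 - \<gamma>) * p') * \<mu> powr d
    * ((1 / \<mu> + 1 / T\<^sup>2) powr p' + \<tau>' * (T powr (-1) * \<mu> powr (- \<theta>)) powr p')
    \<le> T powr (1 - (1 - \<gamma>) * p') * \<mu> powr d * (2 powr p' * K powr (- p') * T powr (- (a * p')) + \<tau>'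
      * T powr (- (a * p')))"
    by (intro mult_left_mono) auto
  also have "T powr (1 - (1 - \<gamma>) * p') * \<mu> powr d
    * (2 powr p' * K powr (- p') * T powr (- (a * p')) + \<tau>' * T powr (- (a * p')))
     = (T powr (1 - (1 - \<gamma>) * p') * T powr (a * d) * T powr (- (a * p')))
       * (K powr d * (2 powr p' * K powr (- p') + \<tau>'))"
  proof -
    have \<mu>d: "\<mu> powr d = K powr d * T powr (a * d)" using K T by (simp add: \<mu>_def powr_mult powr_powr)
    show ?thesis unfolding \<mu>d by (simp add: algebra_simps)
  qed
  also have "T powr (1 - (1 - \<gamma>) * p') * T powr (a * d) * T powr (- (a * p'))
    = T powr (1 - (1 - \<gamma>) * p' + a * d - a * p')"
    by (simp flip: powr_add)
  also have "T powr (1 - (1 - \<gamma>) * p' + a * d - a * p')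
    * (K powr d * (2 powr p' * K powr (- p') + \<tau>')) \<le> 1 * (K powr d * (2 powr p' * K powr (- p') + \<tau>'))"
    using powr_mono[OF e T] T \<tau>' by (intro mult_right_mono) auto
  finally show ?thesis by simp
qed

text \<open>The hypothesis \<open>e\<close> says that \<open>p\<close> is at most the critical exponent. First \<open>K = 1\<close> bounds the total
  energy; then \<open>T\<close> tends to infinity for fixed \<open>K\<close>, and finally \<open>K\<close> tends to infinity.\<close>

lemma energy_zero_up_to_critical:
  fixes h :: "real \<times> 'a::euclidean_space \<Rightarrow> real" and p \<gamma> \<theta> :: real
  assumes h [measurable]: "h \<in> borel_measurable (borel \<Otimes>\<^sub>M borel)"
    and \<theta>: "0 \<le> \<theta>" "\<theta> < 1 / 2" and \<gamma>: "0 \<le> \<gamma>" "\<gamma> < 1" and p: "p > 1"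
    and sol: "\<And>T. T > 0 \<Longrightarrow> weak_solution_on \<theta> \<gamma> p u0 u1 T (\<lambda>t x. h (t, x))"
    and data: "integrable lborel u0" "integrable lborel u1"
  defines "p' \<equiv> p / (p - 1)" and "d \<equiv> real DIM('a) / 2" and "a \<equiv> 1 / (1 - \<theta>)"
  assumes e: "1 - (1 - \<gamma>) * p' + a * d - a * p' \<le> 0" and dp': "d < p'"
  shows "total_energy p h (\<lambda>_. 1) = 0"
proof -
  have \<theta>1: "\<theta> < 1" using \<theta> by simp
  obtain \<kappa> c A :: real and N where \<kappa>: "\<kappa> > 0" and c: "c > 0" and A: "A \<ge> 0"
    and est: "\<And>T \<mu> \<tau>. T \<ge> 1 \<Longrightarrow> \<mu> \<ge> 1 \<Longrightarrow> \<tau> > 0 \<Longrightarrow>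
       ennreal c * space_time_energy T N p h (bracket_power (- \<kappa>) \<mu>) (\<lambda>_. 1) \<le>
       ennreal \<tau> * space_time_energy T N p h (bracket_power (- \<kappa>) \<mu>) (\<lambda>t. (t / T) powr p) +
       ennreal (A * (scaling_remainder p \<gamma> \<theta> d \<tau> T \<mu> + T powr (- (1 - \<gamma>))))"
    and fin: "\<And>T \<mu>. T \<ge> 1 \<Longrightarrow> \<mu> \<ge> 1 \<Longrightarrow> space_time_energy T N p h (bracket_power (- \<kappa>) \<mu>) (\<lambda>_. 1) < \<infinity>"
    using scaled_energy_estimate[OF h \<theta>(1) \<theta>1 \<gamma>(1) p sol data] unfolding d_def by metis
  have p': "p' > 0" using p by (simp add: p'_def)
  have a: "a > 0" "a < 2" using \<theta> by (auto simp: a_def field_simps)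
  define T where "T = (\<lambda>k. real (Suc k))"
  have T: "T k \<ge> 1" "T k > 0" for k by (auto simp: T_def)
  have Tlim: "filterlim T at_top sequentially"
    unfolding T_def by (rule filterlim_compose[OF filterlim_real_sequentially filterlim_Suc])
  define \<mu> where "\<mu> = (\<lambda>K k. K * T k powr a)"
  have \<mu>: "\<mu> K k \<ge> 1" "\<mu> K k > 0" if "K \<ge> 1" for K k
  proof -
    have "1 * 1 \<le> K * T k powr a" using that T[of k] a by (intro mult_mono ge_one_powr_ge_zero) auto
    then show "\<mu> K k \<ge> 1" by (simp add: \<mu>_def)
    then show "\<mu> K k > 0" by simp
  qed
  define \<phi> where "\<phi> = (\<lambda>K k. bracket_power (- \<kappa>) (\<mu> K k) :: 'a \<Rightarrow> real)"
  have \<phi>m: "\<phi> K k \<in> borel_measurable borel" for K k by (simp add: \<phi>_def)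
  have \<phi>: "0 \<le> \<phi> K k x" "\<phi> K k x \<le> 1" if "K \<ge> 1" for K k x
    using \<mu>[OF that] \<kappa> by (auto simp: \<phi>_def intro!: bracket_nonneg bracket_le_1)
  have \<phi>lim: "(\<lambda>k. \<phi> K k x) \<longlonglongrightarrow> 1" if K: "K \<ge> 1" for K x
  proof -
    have "(\<lambda>k. T k powr (- a)) \<longlonglongrightarrow> 0" using a by (intro tendsto_neg_powr Tlim) auto
    then have "(\<lambda>k. (1 + (norm x)\<^sup>2 / (4 * K) * T k powr (- a)) powr (- \<kappa>))
      \<longlonglongrightarrow> (1 + (norm x)\<^sup>2 / (4 * K) * 0) powr (- \<kappa>)"
      by (intro tendsto_intros) auto
    moreover have "\<phi> K k x = (1 + (norm x)\<^sup>2 / (4 * K) * T k powr (- a)) powr (- \<kappa>)" for k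
      using K T[of k] by (simp add: \<phi>_def bracket_power_def \<mu>_def powr_minus_divide mult.assoc)
    ultimately show ?thesis by simp
  qed
  define X where "X = (\<lambda>K k. space_time_energy (T k) N p h (\<phi> K k) (\<lambda>_. 1))"
  define Y where "Y = (\<lambda>K k. space_time_energy (T k) N p h (\<phi> K k) (\<lambda>t. (t / T k) powr p))"
  define G where "G = (\<lambda>K \<tau>. K powr d * (2 powr p' * K powr (- p') + \<tau> powr (- (1 / (p - 1)))))"
  have G: "G K \<tau> \<ge> 0" for K \<tau> by (simp add: G_def)
  have ev: "\<forall>\<^sub>F k in sequentially. ennreal c * X K k \<le> ennreal \<tau> * Y K k
    + ennreal (A * (G K \<tau> + T k powr (- (1 - \<gamma>))))"
    if K: "K \<ge> 1" and \<tau>: "\<tau> > 0" for K \<tau>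
  proof -
    \<comment> \<open>Here \<open>\<theta> < 1/2\<close> enters: \<open>a < 2\<close> makes \<open>\<mu> \<le> T\<^sup>2\<close> for large \<open>T\<close>.\<close>
    have "(\<lambda>k. T k powr (- (2 - a))) \<longlonglongrightarrow> 0" using a by (intro tendsto_neg_powr Tlim) auto
    then have "\<forall>\<^sub>F k in sequentially. T k powr (- (2 - a)) < 1 / K"
      using K by (intro order_tendstoD) auto
    then show ?thesis
    proof eventually_elim
      case (elim k)
      have "K * T k powr (- (2 - a)) * T k powr 2 \<le> 1 * T k powr 2"
        using elim K by (intro mult_right_mono) (auto simp: field_simps)
      also have "K * T k powr (- (2 - a)) * T k powr 2 = \<mu> K k"
        unfolding \<mu>_def mult.assoc by (simp flip: powr_add)
      finally have le: "\<mu> K k \<le> (T k)\<^sup>2" using T[of k] by (simp add: powr_numeral)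
      have "scaling_remainder p \<gamma> \<theta> d \<tau> (T k) (\<mu> K k) \<le> G K \<tau>"
        unfolding G_def \<mu>_def a_def scaling_remainder_def Let_def p'_def[symmetric] using le e
        by (intro parabolic_scaling_bound p' \<theta>(1) \<theta>1 K T) (auto simp: \<mu>_def a_def)
      then have "ennreal (A * (scaling_remainder p \<gamma> \<theta> d \<tau> (T k) (\<mu> K k) + T k powr (- (1 - \<gamma>))))
        \<le> ennreal (A * (G K \<tau> + T k powr (- (1 - \<gamma>))))"
        using A by (intro ennreal_leI mult_left_mono add_right_mono) auto
      with est[OF T(1)[of k] \<mu>(1)[OF K, of k] \<tau>] show ?case
        unfolding X_def Y_def \<phi>_def by (meson add_left_mono order.trans)
    qed
  qed
  have T\<gamma>: "(\<lambda>k. T k powr (- (1 - \<gamma>))) \<longlonglongrightarrow> 0" using \<gamma> by (intro tendsto_neg_powr Tlim) auto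
  have bounded: "total_energy p h (\<lambda>_. 1) < \<infinity>"
  proof -
    have "total_energy p h (\<lambda>_. 1) \<le> ennreal (2 / c * (A * (G 1 (c / 2) + 0)))"
    proof (rule total_energy_le_limit[OF h \<phi>m Tlim \<phi>lim[OF order_refl]])
      show "(\<lambda>k. ennreal (2 / c * (A * (G 1 (c / 2) + T k powr (- (1 - \<gamma>))))))
        \<longlonglongrightarrow> ennreal (2 / c * (A * (G 1 (c / 2) + 0)))"
        by (intro tendsto_intros T\<gamma>)
      have "c / 2 > 0" using c by simp
      from ev[OF order_refl this]
      show "\<forall>\<^sub>F k in sequentially. space_time_energy (T k) N p h (\<phi> 1 k) (\<lambda>_. 1)
        \<le> ennreal (2 / c * (A * (G 1 (c / 2) + T k powr (- (1 - \<gamma>)))))"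
      proof eventually_elim
        case (elim k)
        have "Y 1 k \<le> X 1 k" unfolding X_def Y_def using T[of k] p \<phi> by (intro late_energy_le) auto
        then have "ennreal c * X 1 k \<le> ennreal (c / 2) * X 1 k
          + ennreal (A * (G 1 (c / 2) + T k powr (- (1 - \<gamma>))))"
          using elim by (meson add_right_mono mult_left_mono order.trans zero_le)
        from ennreal_absorb[OF this _ c] show ?case
          using fin[OF T(1)[of k] \<mu>(1)[OF order_refl, of k]] A G by (simp add: X_def \<phi>_def)
      qed
    qed
    then show ?thesis by (rule order.strict_trans1) simp
  qed
  have small: "total_energy p h (\<lambda>_. 1) \<le> ennreal
    (1 / c * (A * ((2 powr p' + 1) * K powr (d - p'))))" if K: "K \<ge> 1" for K
  proof -
    \<comment> \<open>With this choice \<open>\<tau> powr (-1/(p-1)) = K powr (-p')\<close>, so both parts of \<open>G\<close> are of the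
    same size.\<close>
    define \<tau> where "\<tau> = K powr p"
    have \<tau>: "\<tau> > 0" using K by (simp add: \<tau>_def)
    have Gv: "G K \<tau> = (2 powr p' + 1) * K powr (d - p')"
    proof -
      have "\<tau> powr (- (1 / (p - 1))) = K powr (- p')" using p by (simp add: \<tau>_def powr_powr p'_def)
      then have "G K \<tau> = (2 powr p' + 1) * (K powr d * K powr (- p'))" by (simp add: G_def algebra_simps)
      then show ?thesis by (simp flip: powr_add)
    qed
    have Ylim: "(\<lambda>k. Y K k) \<longlonglongrightarrow> 0"
      unfolding Y_def using T p \<phi>[OF K] by (intro late_energy_vanishes h \<phi>m Tlim bounded) auto
    have "total_energy p h (\<lambda>_. 1) \<le> ennreal (1 / c) * (ennreal \<tau> * 0 + ennreal (A * (G K \<tau> + 0)))"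
    proof (rule total_energy_le_limit[OF h \<phi>m Tlim \<phi>lim[OF K]])
      show "(\<lambda>k. ennreal (1 / c) * (ennreal \<tau> * Y K k
        + ennreal (A * (G K \<tau> + T k powr (- (1 - \<gamma>)))))) \<longlonglongrightarrow> ennreal (1 / c)
        * (ennreal \<tau> * 0 + ennreal (A * (G K \<tau> + 0)))"
        by (intro ennreal_tendsto_cmult tendsto_add Ylim tendsto_ennrealI tendsto_mult tendsto_const
          T\<gamma>) auto
      show "\<forall>\<^sub>F k in sequentially. space_time_energy (T k) N p h (\<phi> K k) (\<lambda>_. 1) \<le> ennreal (1 / c)
        * (ennreal \<tau> * Y K k + ennreal (A * (G K \<tau> + T k powr (- (1 - \<gamma>)))))"
        using ev[OF K \<tau>]
      proof eventually_elim
        case (elim k)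
        have "X K k = ennreal (1 / c) * (ennreal c * X K k)"
          using c by (simp flip: mult.assoc ennreal_mult')
        also have "\<dots> \<le> ennreal (1 / c) * (ennreal \<tau> * Y K k + ennreal (A * (G K \<tau> + T k powr (- (1 - \<gamma>)))))"
          by (intro mult_left_mono elim) simp
        finally show ?case by (simp add: X_def)
      qed
    qed
    then show ?thesis using c A by (simp add: Gv flip: ennreal_mult')
  qed
  have "(\<lambda>k. ennreal (1 / c * (A * ((2 powr p' + 1) * T k powr (d - p')))))
    \<longlonglongrightarrow> ennreal (1 / c * (A * ((2 powr p' + 1) * 0)))"
    using dp' by (intro tendsto_intros tendsto_neg_powr Tlim) auto
  then have "total_energy p h (\<lambda>_. 1) \<le> ennreal (1 / c * (A * ((2 powr p' + 1) * 0)))"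
    by (rule LIMSEQ_le_const) (use small T in auto)
  then show ?thesis by simp
qed

section \<open>The nonexistence theorem\<close>

lemma integrable_of_weighted:
  fixes f :: "'a::euclidean_space \<Rightarrow> real"
  assumes f: "integrable (weighted_lborel q) f" and q: "q \<ge> 0"
  shows "integrable lborel f"
proof -
  have w: "1 \<le> japanese_bracket x powr q" for x :: 'a
    using q by (intro ge_one_powr_ge_zero) (auto simp: japanese_bracket_def)
  have [measurable]: "(japanese_bracket :: 'a \<Rightarrow> real) \<in> borel_measurable borel"
    unfolding japanese_bracket_def[abs_def] by measurable
  have fm [measurable]: "f \<in> borel_measurable borel"
    using borel_measurable_integrable[OF f] by (simp add: weighted_lborel_def)
  have "integrable lborel (\<lambda>x. japanese_bracket x powr q *\<^sub>R f x)"
    using f unfolding weighted_lborel_def by (subst (asm) integrable_density) auto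
  then show ?thesis
  proof (rule Bochner_Integration.integrable_bound)
    show "AE x in lborel. norm (f x) \<le> norm (japanese_bracket x powr q *\<^sub>R f x)"
      using w by (intro AE_I2) (simp add: abs_mult mult_le_cancel_right1)
  qed simp
qed

text \<open>Composition with \<open>max 0\<close> extends \<open>u\<close> to negative times without losing joint measurability.\<close>

lemma measurable_of_Lp_Lp_weighted:
  fixes u :: "real \<Rightarrow> 'a::euclidean_space \<Rightarrow> real"
  assumes "u \<in> Lp_Lp_weighted p q"
  shows "(\<lambda>(t, x). u t x) \<in> borel_measurable (restrict_space lborel {0..} \<Otimes>\<^sub>M lborel)"
    and "(\<lambda>(t, x). u (max 0 t) x) \<in> borel_measurable (borel \<Otimes>\<^sub>M borel)"
proof -
  have "sets (restrict_space lborel {0..} \<Otimes>\<^sub>M (weighted_lborel (- q) :: 'a measure))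
    = sets (restrict_space (lborel :: real measure) {0..} \<Otimes>\<^sub>M lborel)"
    by (intro sets_pair_measure_cong) (simp_all add: weighted_lborel_def)
  then show m: "(\<lambda>(t, x). u t x) \<in> borel_measurable (restrict_space lborel {0..} \<Otimes>\<^sub>M lborel)"
    using assms by (simp add: Lp_Lp_weighted_def Let_def cong: measurable_cong_sets)
  have "(\<lambda>z :: real \<times> 'a. (max 0 (fst z), snd z)) \<in> (borel \<Otimes>\<^sub>M borel) \<rightarrow>\<^sub>M
    (restrict_space lborel {0..} \<Otimes>\<^sub>M (lborel :: 'a measure))"
    by (intro measurable_Pair measurable_restrict_space2) (auto simp: space_pair_measure)
  from measurable_compose[OF this m]
  show "(\<lambda>(t, x). u (max 0 t) x) \<in> borel_measurable (borel \<Otimes>\<^sub>M borel)"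
    by (simp add: case_prod_beta)
qed

lemma trivial_if_energy_zero:
  fixes u :: "real \<Rightarrow> 'a::euclidean_space \<Rightarrow> real"
  assumes m: "(\<lambda>(t, x). u t x) \<in> borel_measurable (restrict_space lborel {0..} \<Otimes>\<^sub>M lborel)"
    and h: "(\<lambda>(t, x). u (max 0 t) x) \<in> borel_measurable (borel \<Otimes>\<^sub>M borel)"
    and zero: "total_energy p (\<lambda>(t, x). u (max 0 t) x) \<phi> = 0"
    and \<phi> [measurable]: "\<phi> \<in> borel_measurable borel" and pos: "\<And>x. \<phi> x > 0"
  shows "\<not> nontrivial_function u"
proof -
  define w where "w = (\<lambda>z. ennreal (\<bar>case z of (t, x) \<Rightarrow> u t x\<bar> powr p * \<phi> (snd z)))"
  define h where "h = (\<lambda>(t, x). u (max 0 t) x)"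
  have hm [measurable]: "h \<in> borel_measurable (borel \<Otimes>\<^sub>M borel)" using h by (simp add: h_def)
  let ?M = "restrict_space (lborel :: real measure) {0..} \<Otimes>\<^sub>M (lborel :: 'a measure)"
  have wm: "w \<in> borel_measurable ?M"
    unfolding w_def using m by measurable
  have "(\<integral>\<^sup>+ z. w z \<partial>?M) = (\<integral>\<^sup>+ t. \<integral>\<^sup>+ x. w (t, x) \<partial>lborel \<partial>restrict_space lborel {0..})"
    by (rule lborel.nn_integral_fst[OF wm, symmetric])
  also have "\<dots> = (\<integral>\<^sup>+ t. (\<integral>\<^sup>+ x. w (t, x) \<partial>lborel) * indicator {0..} t \<partial>lborel)"
    by (subst nn_integral_restrict_space) auto
  also have "\<dots> = (\<integral>\<^sup>+ t. \<integral>\<^sup>+ x. ennreal (indicator {0..} t * (\<bar>h (t, x)\<bar> powr p * \<phi> x)) \<partial>lborel \<partial>lborel)"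
    by (intro nn_integral_cong) (auto simp: w_def h_def indicator_def max_def)
  also have "\<dots> = total_energy p h \<phi>"
    unfolding total_energy_def by (subst lborel.nn_integral_fst[symmetric]) simp_all
  finally have "(\<integral>\<^sup>+ z. w z \<partial>?M) = 0" using zero by (simp add: h_def)
  then have "AE z in ?M. w z = 0" by (simp add: nn_integral_0_iff_AE wm)
  then have "AE z in ?M. case z of (t, x) \<Rightarrow> u t x = 0"
  proof eventually_elim
    case (elim z)
    obtain t x where z: "z = (t, x)" by (cases z)
    have "\<bar>u t x\<bar> powr p * \<phi> x \<le> 0" using elim by (simp add: w_def z ennreal_eq_0_iff)
    then have "\<bar>u t x\<bar> powr p \<le> 0" using pos[of x] by (simp add: mult_le_0_iff)
    then show ?case by (simp add: z)
  qed
  then show ?thesis by (simp add: nontrivial_function_def)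
qed

theorem theorem1p1:
  fixes \<theta> \<gamma> p q :: real
    and u0 u1 :: "real ^ 'n \<Rightarrow> real"
    and u :: "real \<Rightarrow> real ^ 'n \<Rightarrow> real"
  assumes "0 \<le> \<theta>" and "\<theta> < 1 / 2"
    and "0 < \<gamma>" and "\<gamma> < 1"
    and "1 < p"
    and "q = real CARD('n) + 2 * \<theta>"
    and "integrable (weighted_lborel q) u0"
    and "integrable (weighted_lborel q) u1"
    and "(LINT x|lborel. u1 x) > 0"
    and "u \<in> Lp_Lp_weighted p q"
    and "nontrivial_function u"
    and "global_weak_solution \<theta> \<gamma> p u0 u1 u"
  shows "p_bar CARD('n) \<gamma> \<theta> \<le> ereal p \<and>
    ((real CARD('n) - 2) / real CARD('n) < \<gamma> \<longrightarrow>
       p_bar CARD('n) \<gamma> \<theta> = p_crit CARD('n) \<gamma> \<theta> \<and> p_bar CARD('n) \<gamma> \<theta> < ereal p) \<and>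
    p_crit CARD('n) \<gamma> \<theta> \<noteq> \<infinity>"
proof -
  define n where "n = real CARD('n)"
  have n: "n > 0" by (simp add: n_def)
  define h where "h = (\<lambda>(t, x). u (max 0 t) x)"
  note m = measurable_of_Lp_Lp_weighted[OF \<open>u \<in> Lp_Lp_weighted p q\<close>, folded h_def]
  have q0: "q \<ge> 0" using assms(1,6) by simp
  note data = integrable_of_weighted[OF assms(7) q0] integrable_of_weighted[OF assms(8) q0]
  have sol: "weak_solution_on \<theta> \<gamma> p u0 u1 T (\<lambda>t x. h (t, x))" if "T > 0" for T
  proof (rule weak_solution_on_cong)
    show "weak_solution_on \<theta> \<gamma> p u0 u1 T u"
      using assms(12) that unfolding global_weak_solution_def by blast
    show "u t = (\<lambda>x. h (t, x))" if "t \<ge> 0" for t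
      using that by (simp add: h_def max_absorb2)
  qed
  have triv: False if "total_energy p h \<phi> = 0" "\<phi> \<in> borel_measurable borel" "\<And>x. \<phi> x > 0" for \<phi>
    using trivial_if_energy_zero[OF m(1) m(2)[unfolded h_def] that(1)[unfolded h_def] that(2,3)]
      assms(11) by blast
  have \<theta>1: "\<theta> < 1" and \<gamma>0: "0 \<le> \<gamma>" using assms(1-4) by auto
  have low: "1 \<le> p * \<gamma>"
  proof (rule ccontr)
    assume "\<not> 1 \<le> p * \<gamma>"
    then obtain \<kappa> where "total_energy p h (bracket_power (- \<kappa>) 1) = 0"
      using energy_zero_below_inverse_gamma[OF m(2) assms(1) \<theta>1 \<gamma>0 assms(4) assms(5) sol data] by auto
    then show False by (rule triv) (auto intro: bracket_pos bracket_meas)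
  qed
  have upper: "2 * (1 + (1 - \<gamma>) * (1 - \<theta>)) < (p - 1) * (n - 2 + 2 * \<gamma> * (1 - \<theta>))" if big: "(n - 2) / n < \<gamma>"
  proof (rule ccontr)
    assume neg: "\<not> ?thesis"
    define p' d a where "p' = p / (p - 1)" and "d = n / 2" and "a = 1 / (1 - \<theta>)"
    define s where "s = 1 + (1 - \<gamma>) * (1 - \<theta>)"
    have s: "s > 0" using assms(1-4) \<theta>1 by (simp add: s_def add_pos_nonneg)
    have p1: "p - 1 > 0" using assms(1-5) by simp
    have pp: "p' * (p - 1) = p" using p1 by (simp add: p'_def)
    have "n - 2 + 2 * \<gamma> * (1 - \<theta>) = 2 * (d - 1 + \<gamma> * (1 - \<theta>))"
      by (simp add: d_def)
    then have "(p - 1) * (n - 2 + 2 * \<gamma> * (1 - \<theta>)) = 2 * ((p - 1) * (d - 1 + \<gamma> * (1 - \<theta>)))"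
      by simp
    with neg have "(p - 1) * (d - 1 + \<gamma> * (1 - \<theta>)) \<le> s" by (simp add: s_def)
    then have "(p - 1) * ((1 - \<theta>) + d) \<le> p * s" by (simp add: s_def algebra_simps)
    also have "p * s = (p - 1) * (p' * s)" using pp by (simp add: mult_ac)
    finally have ps: "(1 - \<theta>) + d \<le> p' * s" using p1 by simp
    have e: "1 - (1 - \<gamma>) * p' + a * d - a * p' \<le> 0"
    proof -
      have "a * ((1 - \<theta>) + d) \<le> a * (p' * s)" using ps \<theta>1 by (intro mult_left_mono) (auto simp: a_def)
      moreover have "a * (1 - \<theta>) = 1" using \<theta>1 by (simp add: a_def)
      moreover have "a * (p' * s) = a * p' + (a * (1 - \<theta>)) * ((1 - \<gamma>) * p')"
        by (simp add: s_def algebra_simps)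
      ultimately show ?thesis by (simp add: distrib_left)
    qed
    have "d < p'"
    proof -
      have "d * (1 - \<gamma>) < 1" using big n by (simp add: d_def field_simps)
      then have "d * (1 - \<gamma>) * (1 - \<theta>) < 1 * (1 - \<theta>)" using \<theta>1 by (intro mult_strict_right_mono) auto
      then have "d * s < (1 - \<theta>) + d" by (simp add: s_def algebra_simps)
      with ps have "d * s < p' * s" by linarith
      then show ?thesis using s by simp
    qed
    then have "total_energy p h (\<lambda>_. 1) = 0"
      using energy_zero_up_to_critical[OF m(2) assms(1,2) \<gamma>0 assms(4) assms(5) sol data] e
      by (simp add: p'_def d_def a_def n_def)
    then show False by (rule triv) auto
  qed
  show ?thesis
  proof (cases "\<gamma> \<le> (n - 2) / n")
    case True
    have "1 / \<gamma> \<le> p" using low assms(3) by (simp add: pos_divide_le_eq)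
    moreover have "n - 2 + 2 * \<gamma> * (1 - \<theta>) > 0"
    proof -
      have "\<gamma> * n \<le> n - 2" using True n by (simp add: pos_le_divide_eq)
      moreover have "\<gamma> * n > 0" using n assms(3) by simp
      moreover have "2 * \<gamma> * (1 - \<theta>) > 0" using assms(1-4) \<theta>1 by simp
      ultimately show ?thesis by linarith
    qed
    ultimately show ?thesis using True by (simp add: p_bar_def p_crit_def Let_def n_def)
  next
    case False
    define D where "D = n - 2 + 2 * \<gamma> * (1 - \<theta>)"
    have up: "2 * (1 + (1 - \<gamma>) * (1 - \<theta>)) < (p - 1) * D" using upper False by (simp add: D_def)
    moreover have "2 * (1 + (1 - \<gamma>) * (1 - \<theta>)) > 0" using assms(1-4) \<theta>1 by (simp add: add_pos_nonneg)
    ultimately have D: "D > 0" using assms(5) by (smt (verit) mult_nonneg_nonpos)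
    have "p_crit CARD('n) \<gamma> \<theta> = ereal (1 + 2 * (1 + (1 - \<gamma>) * (1 - \<theta>)) / D)"
      using D by (simp add: p_crit_def Let_def D_def n_def)
    moreover have "2 * (1 + (1 - \<gamma>) * (1 - \<theta>)) / D < p - 1" using up D by (simp only: pos_divide_less_eq)
    ultimately show ?thesis using False by (simp add: p_bar_def n_def)
  qed
qed

end
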